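(* For any integer $d$ with $3\leq d\leq 11$ and any integer $r$ such that $d/2\leq r\leq d-1$, there exists a maximal Tjurina curve of type $(d,r)$. Moreover, for any integer $d$ with $3\leq d\leq 11$ and any integer $r$ with $d/2\leq r\leq d-2$, there exists a line arrangement in $\mathbb{P}^2$ which is a maximal Tjurina curve of type $(d,r)$.
   Context: Let $S=\mathbb{C}[x,y,z]$ with its standard grading, and let $C:f=0$ be a reduced curve of degree $d$ in the complex projective plane $\mathbb{P}^2$, with $f\in S$ homogeneous of degree $d$ and partial derivatives $f_x,f_y,f_z$. Let $$AR(f)=\{(a,b,c)\in S^3 : af_x+bf_y+cf_z=0\},$$ graded so that $(a,b,c)$ with $a,b,c$ homogeneous of degree $k$ has degree $k$, and let $mdr(f)$ be the minimal degree of a non-zero homogeneous element of $AR(f)$. The global Tjurina number $\tau(C)$ is the degree of the Jacobian ideal $J_f=(f_x,f_y,f_z)$ (i.e. $\dim_{\mathbb{C}}(S/J_f)_k$ for large $k$), equivalently the sum of the Tjurina numbers of all singular points of $C$. For integers $d,r$ with $d/2\leq r\leq d-1$ set $$\tau(d,r)_{max}=(d-1)(d-r-1)+r^2-\binom{2r-d+2}{2}.$$ A reduced plane curve $C:f=0$ is called a maximal Tjurina curve of type $(d,r)$ if $\deg f=d$, $mdr(f)=r$ and $\tau(C)=\tau(d,r)_{max}$. A line arrangement is a curve $C:f=0$ where $f$ is a product of pairwise non-proportional linear forms. *)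

theory Defs
  imports Complex_Main "HOL-Library.Poly_Mapping" "HOL-Library.Numeral_Type"
    "HOL-Computational_Algebra.Squarefree"
begin

text \<open>The ring \<open>S = \<complex>[x,y,z]\<close>: finitely supported functions from exponent vectors to
  coefficients, with the convolution product of \<open>Poly_Mapping\<close>.  The three variables
  \<open>x, y, z\<close> are indexed by the elements \<open>0, 1, 2\<close> of the three-element type \<open>3\<close>.\<close>

type_synonym S = "(3 \<Rightarrow>\<^sub>0 nat) \<Rightarrow>\<^sub>0 complex"

definition scal :: "complex \<Rightarrow> S \<Rightarrow> S" where
  "scal c p = Poly_Mapping.single 0 c * p"

definition homogeneous :: "nat \<Rightarrow> S \<Rightarrow> bool" where
  "homogeneous k p \<longleftrightarrow> (\<forall>m\<in>Poly_Mapping.keys p. (\<Sum>i\<in>UNIV. Poly_Mapping.lookup m i) = k)"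

text \<open>The subtraction of exponents truncates at \<open>0\<close>, but only in terms whose new coefficient
  is \<open>0\<close>.\<close>

definition partial_deriv :: "3 \<Rightarrow> S \<Rightarrow> S" where
  "partial_deriv i p = (\<Sum>m\<in>Poly_Mapping.keys p.
     Poly_Mapping.single (m - Poly_Mapping.single i 1)
       (of_nat (Poly_Mapping.lookup m i) * Poly_Mapping.lookup p m))"

definition AR :: "S \<Rightarrow> (S \<times> S \<times> S) set" where
  "AR f = {(a, b, c). a * partial_deriv 0 f + b * partial_deriv 1 f + c * partial_deriv 2 f = 0}"

text \<open>The minimum exists for every \<open>f\<close>: \<open>AR f\<close> contains the Koszul syzygies, and if these
  all vanish it is all of \<open>S\<^sup>3\<close>.\<close>

definition mdr :: "S \<Rightarrow> nat" where
  "mdr f = (LEAST k. \<exists>a b c. (a, b, c) \<in> AR f \<and> (a, b, c) \<noteq> (0, 0, 0) \<and>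
     homogeneous k a \<and> homogeneous k b \<and> homogeneous k c)"

definition jacobian_ideal :: "S \<Rightarrow> S set" where
  "jacobian_ideal f =
     {a * partial_deriv 0 f + b * partial_deriv 1 f + c * partial_deriv 2 f | a b c. True}"

text \<open>\<open>quotient_dim V W n\<close>: the image of the subspace \<open>V\<close> in the quotient by the subspace
  \<open>W\<close> has dimension \<open>n\<close> over \<open>\<complex>\<close>, that is, there are \<open>n\<close> elements of \<open>V\<close> whose classes
  modulo \<open>W\<close> are a basis of that image (spanning, and linearly independent).\<close>

definition quotient_dim :: "S set \<Rightarrow> S set \<Rightarrow> nat \<Rightarrow> bool" where
  "quotient_dim V W n \<longleftrightarrow> (\<exists>B\<subseteq>V. finite B \<and> card B = n \<and>
     (\<forall>v\<in>V. \<exists>c. v - (\<Sum>b\<in>B. scal (c b) b) \<in> W) \<and>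
     (\<forall>c. (\<Sum>b\<in>B. scal (c b) b) \<in> W \<longrightarrow> (\<forall>b\<in>B. c b = 0)))"

text \<open>For \<open>f\<close> homogeneous, \<open>(S/J\<^sub>f)\<^sub>k\<close> is the image of \<open>S\<^sub>k\<close> in \<open>S/J\<^sub>f\<close>.  For reduced
  \<open>f\<close> its dimension is constant for large \<open>k\<close>, since the singular locus is then finite.\<close>

definition tjurina_number :: "S \<Rightarrow> nat" where
  "tjurina_number f = (THE t. \<forall>\<^sub>F k in sequentially.
     quotient_dim {p. homogeneous k p} (jacobian_ideal f) t)"

text \<open>Used only for \<open>d / 2 \<le> r \<le> d - 1\<close>, where the subtraction on \<open>nat\<close> inside the binomial
  coefficient does not truncate.\<close>

definition tau_max :: "nat \<Rightarrow> nat \<Rightarrow> int" where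
  "tau_max d r = (int d - 1) * (int d - int r - 1) + int r ^ 2 - int ((2 * r + 2 - d) choose 2)"

text \<open>A plane curve \<open>C : f = 0\<close> is given by its equation \<open>f\<close>.  Being reduced means that \<open>f\<close>
  has no multiple factor; \<open>squarefree f\<close> also excludes \<open>f = 0\<close>.\<close>

definition reduced_plane_curve :: "nat \<Rightarrow> S \<Rightarrow> bool" where
  "reduced_plane_curve d f \<longleftrightarrow> 0 < d \<and> homogeneous d f \<and> squarefree f"

definition maximal_tjurina_curve :: "nat \<Rightarrow> nat \<Rightarrow> S \<Rightarrow> bool" where
  "maximal_tjurina_curve d r f \<longleftrightarrow>
     reduced_plane_curve d f \<and> mdr f = r \<and> int (tjurina_number f) = tau_max d r"

definition line_arrangement :: "S \<Rightarrow> bool" where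
  "line_arrangement f \<longleftrightarrow> (\<exists>n (l :: nat \<Rightarrow> S).
     (\<forall>i<n. homogeneous 1 (l i) \<and> l i \<noteq> 0) \<and>
     (\<forall>i<n. \<forall>j<n. i \<noteq> j \<longrightarrow> (\<nexists>c. l j = scal c (l i))) \<and>
     f = (\<Prod>i<n. l i))"

end

theory Submission
  imports Defs "HOL-Computational_Algebra.Polynomial" "HOL-Library.Product_Plus" "HOL-Library.Multiset"
begin

text \<open>For an arrangement with equation \<open>f\<close>, contraction with the Euler field identifies syzygies of
  \<open>f\<close> with one-forms \<open>w\<close> that are parallel to \<open>n\<close> along each line \<open>n\<close> of the arrangement. When a line \<open>n\<close> is
  added to \<open>d\<close> lines which it meets in \<open>h\<close> points, such a \<open>w\<close> restricts on \<open>n\<close> to \<open>q * n\<close>, where \<open>q\<close>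
  vanishes at the \<open>h\<close> points. In degrees below \<open>h\<close> this forces \<open>q = 0\<close>, so that \<open>w\<close> is the equation of \<open>n\<close> times a one-form
  for the smaller arrangement; in large degrees every such \<open>q\<close> occurs. Hence \<open>mdr\<close> grows by one if \<open>h\<close> is large
  enough, and \<open>\<tau>\<close> grows by \<open>2 * d - h\<close>. Adding a line with \<open>h = r + 2\<close> turns type \<open>(d, r)\<close> into type
  \<open>(d + 1, r + 1)\<close>, and all types with \<open>r \<le> d - 2\<close> are reached in this way from grids of \<open>2 * s + 1\<close> lines,
  which are free of exponents \<open>(s, s)\<close>. The upper bound for \<open>mdr\<close> comes from a point of high multiplicity.

  For \<open>r = d - 1\<close> the curve must be irreducible, and the nodal Chebyshev curve works: a syzygy of smaller degree
  would give a form of degree at most \<open>d - 3\<close> vanishing at the critical points that are not nodes, and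
  pulling it back to a rational Chebyshev curve through those points shows that it is zero.\<close>

section \<open>Polynomials in three variables\<close>

text \<open>Passing from type (d, r) to type (d + 1, r + 1) raises \<open>tau_max\<close> by 2d - r
  - 2, which is 2d - h exactly for h = r + 2; and r + 2 is also the least h for which the degree
  argument on the new line lets the lower bound for \<open>mdr\<close> grow. Along such a chain s =
  d - 1 - r is constant, and the chain starts just outside the admissible range, at a grid with d =
  2s + 1 and r = s. For s = 0 the recipe fails, because a line would have to meet d lines in d + 1
  points; so r = d - 1 needs another curve. There the target is (d - 1)(d - 2)/2, the largest number
  of nodes of an irreducible curve of degree d.

  The recursions \<open>rho\<close> and \<open>tau\<close> depend only on which lines meet a given
  line in the same point. On integer coefficients they can be executed, so the existence claim ends
  in a finite computation. The Tjurina number is visible only through dimensions in large degrees;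
  hence the surjectivity of restriction there, which is the laborious half of the argument.\<close>

lemma UNIV_three: "(UNIV :: 3 set) = {0, 1, 2}"
proof -
  have "card {0, 1, 2 :: 3} = CARD(3)" by simp
  then show ?thesis by (metis card_subset_eq finite top_greatest)
qed

lemma exhaust_three: "i = 0 \<or> i = 1 \<or> i = (2 :: 3)"
  using UNIV_three by blast

abbreviation lookup where "lookup \<equiv> Poly_Mapping.lookup"
abbreviation keys where "keys \<equiv> Poly_Mapping.keys"
abbreviation single where "single \<equiv> Poly_Mapping.single"

definition mdeg :: "(3 \<Rightarrow>\<^sub>0 nat) \<Rightarrow> nat" where "mdeg m = (\<Sum>i\<in>UNIV. lookup m i)"

lemma mdeg_eq: "mdeg m = lookup m 0 + lookup m 1 + lookup m 2"
  unfolding mdeg_def UNIV_three by simp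

lemma mdeg_simps [simp]: "mdeg 0 = 0" "mdeg (m + n) = mdeg m + mdeg n" "mdeg (single i a) = a"
  using exhaust_three[of i] by (auto simp: mdeg_eq lookup_add lookup_single when_def)

lemma poly_single_induct:
  fixes p :: S
  assumes "\<And>m c. P (single m c)" "\<And>p q. P p \<Longrightarrow> P q \<Longrightarrow> P (p + q)"
  shows "P p"
proof -
  have "P (\<Sum>m\<in>K. single m (lookup p m))" if "finite K" for K
    using that by (induction K rule: finite_induct) (use assms(1)[of 0 0] assms in auto)
  moreover have "(\<Sum>m\<in>keys p. single m (lookup p m)) = p"
    by (rule poly_mapping_eqI)
      (auto simp: lookup_sum lookup_single when_def in_keys_iff)
  ultimately show ?thesis by (metis finite_keys)
qed

section \<open>Constants, variables and the grading\<close>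

definition C :: "complex \<Rightarrow> S" where "C = single 0"
definition X :: "3 \<Rightarrow> S" where "X i = single (single i 1) 1"

lemma C_simps [simp]: "C 0 = 0" "C 1 = 1" "C (a + b) = C a + C b" "C (a - b) = C a - C b"
  "C (- a) = - C a" "C (a * b) = C a * C b"
  by (simp_all add: C_def single_add single_diff single_uminus mult_single)

lemma C_power [simp]: "C (a ^ n) = C a ^ n" by (induction n) simp_all
lemma C_of_nat [simp]: "C (of_nat n) = of_nat n" by (induction n) (simp_all)
lemma C_numeral [simp]: "C (numeral n) = numeral n" using C_of_nat[of "numeral n"] by simp
lemma C_eq_iff [simp]: "C a = C b \<longleftrightarrow> a = b"
  unfolding C_def by (metis lookup_single_eq)
lemma C_eq_0 [simp]: "C a = 0 \<longleftrightarrow> a = 0" using C_eq_iff[of a 0] by simp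

lemma scal_C: "scal c p = C c * p" by (simp add: scal_def C_def)

lemma X_power: "X i ^ n = single (single i n) 1"
  by (induction n) (simp_all add: X_def mult_single single_add[symmetric])

lemma single_eq: "single m c = C c * X 0 ^ lookup m 0 * X 1 ^ lookup m 1 * X 2 ^ lookup m 2"
proof -
  have "m = single 0 (lookup m 0) + single 1 (lookup m 1) + single 2 (lookup m 2)"
  proof (rule poly_mapping_eqI)
    fix i :: 3 show "lookup m i = lookup (single 0 (lookup m 0) + single 1 (lookup m 1) + single 2 (lookup m 2)) i"
      using exhaust_three[of i] by (auto simp: lookup_add lookup_single)
  qed
  then show ?thesis by (simp add: X_power C_def mult_single)
qed

text \<open>Constants and variables generate S as a ring, so this rule suffices for identities
  between ring homomorphisms and for congruences, without touching exponent vectors.\<close>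

lemma poly_induct [case_names const var add mult]:
  assumes const: "\<And>c. P (C c)" and var: "\<And>i. P (X i)"
    and add: "\<And>p q. P p \<Longrightarrow> P q \<Longrightarrow> P (p + q)" and mult: "\<And>p q. P p \<Longrightarrow> P q \<Longrightarrow> P (p * q)"
  shows "P p"
proof (rule poly_single_induct)
  have pow: "P (X i ^ n)" for i n
    by (induction n) (use const[of 1] var mult in auto)
  show "P (single m c)" for m c unfolding single_eq by (intro mult const pow)
qed (rule add)

lemma homogeneous_iff: "homogeneous k p \<longleftrightarrow> (\<forall>m\<in>keys p. mdeg m = k)"
  by (simp add: homogeneous_def mdeg_def)

lemma homogeneous_0 [simp]: "homogeneous k 0" by (simp add: homogeneous_iff)
lemma homogeneous_add: "homogeneous k p \<Longrightarrow> homogeneous k q \<Longrightarrow> homogeneous k (p + q)"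
  unfolding homogeneous_iff using Poly_Mapping.keys_add[of p q] by blast
lemma homogeneous_uminus [simp]: "homogeneous k (- p) \<longleftrightarrow> homogeneous k p"
  unfolding homogeneous_iff by simp
lemma homogeneous_diff: "homogeneous k p \<Longrightarrow> homogeneous k q \<Longrightarrow> homogeneous k (p - q)"
  using homogeneous_add[of k p "- q"] by simp
lemma homogeneous_sum: "(\<And>i. i \<in> A \<Longrightarrow> homogeneous k (f i)) \<Longrightarrow> homogeneous k (sum f A)"
  by (induction A rule: infinite_finite_induct) (auto intro: homogeneous_add)
lemma homogeneous_mult:
  assumes "homogeneous j p" "homogeneous k q" shows "homogeneous (j + k) (p * q)"
  unfolding homogeneous_iff
proof
  fix m assume "m \<in> keys (p * q)"
  then obtain a b where "m = a + b" "a \<in> keys p" "b \<in> keys q" using keys_mult[of p q] by blast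
  then show "mdeg m = j + k" using assms by (auto simp: homogeneous_iff)
qed
lemma homogeneous_mult': "homogeneous j p \<Longrightarrow> homogeneous k q \<Longrightarrow> i = j + k \<Longrightarrow> homogeneous i (p * q)"
  by (simp add: homogeneous_mult)
lemma homogeneous_single [simp]: "homogeneous k (single m c) \<longleftrightarrow> c = 0 \<or> mdeg m = k"
  by (simp add: homogeneous_iff)
lemma homogeneous_C [simp]: "homogeneous 0 (C c)" by (simp add: C_def)
lemma homogeneous_1 [simp]: "homogeneous 0 1" using homogeneous_C[of 1] by simp
lemma homogeneous_X [simp]: "homogeneous 1 (X i)" by (simp add: X_def)
lemma homogeneous_C_mult: "homogeneous k p \<Longrightarrow> homogeneous k (C c * p)"
  using homogeneous_mult[of 0 "C c" k p] by simp
lemma homogeneous_scal: "homogeneous k p \<Longrightarrow> homogeneous k (scal c p)"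
  by (simp add: scal_C homogeneous_C_mult)
lemma homogeneous_power: "homogeneous j p \<Longrightarrow> homogeneous (n * j) (p ^ n)"
  by (induction n) (auto intro: homogeneous_mult)
lemma homogeneous_prod_list:
  "(\<And>p. p \<in> set ps \<Longrightarrow> homogeneous 1 p) \<Longrightarrow> homogeneous (length ps) (prod_list ps)"
proof (induction ps)
  case (Cons p ps)
  then show ?case using homogeneous_mult[of 1 p "length ps" "prod_list ps"] by simp
qed simp

lemma homogeneous_0_imp_C: assumes "homogeneous 0 p" obtains c where "p = C c"
proof -
  have "m = 0" if "m \<in> keys p" for m
  proof (rule poly_mapping_eqI)
    fix i :: 3 show "lookup m i = lookup 0 i"
      using assms that exhaust_three[of i] by (auto simp: homogeneous_iff mdeg_eq)
  qed
  then have "p = C (lookup p 0)"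
    by (intro poly_mapping_eqI) (auto simp: C_def lookup_single when_def in_keys_iff)
  then show ?thesis by (rule that)
qed

definition hom_part :: "nat \<Rightarrow> S \<Rightarrow> S" where
  "hom_part k p = (\<Sum>m\<in>{m \<in> keys p. mdeg m = k}. single m (lookup p m))"

lemma lookup_hom_part: "lookup (hom_part k p) m = (if mdeg m = k then lookup p m else 0)"
  by (auto simp: hom_part_def lookup_sum lookup_single when_def in_keys_iff)

lemma hom_part_simps [simp]: "hom_part k 0 = 0" "hom_part k (p + q) = hom_part k p + hom_part k q"
  "hom_part k (p - q) = hom_part k p - hom_part k q"
  by (rule poly_mapping_eqI; simp add: lookup_hom_part lookup_add lookup_minus)+

lemma homogeneous_hom_part [simp]: "homogeneous k (hom_part k p)"
  by (auto simp: homogeneous_iff in_keys_iff lookup_hom_part split: if_splits)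

lemma hom_part_homogeneous: "homogeneous j p \<Longrightarrow> hom_part k p = (if k = j then p else 0)"
  by (rule poly_mapping_eqI) (auto simp: lookup_hom_part homogeneous_iff in_keys_iff)

lemma eq_0_if_hom_part_eq_0: assumes "\<And>k. hom_part k p = 0" shows "p = 0"
proof (rule poly_mapping_eqI)
  fix m show "lookup p m = lookup 0 m" using assms[of "mdeg m"] lookup_hom_part[of "mdeg m" p m] by simp
qed

lemma hom_part_mult: assumes "homogeneous d q" shows "hom_part k (p * q) = (if d \<le> k then hom_part (k - d) p * q else 0)"
proof (induction p rule: poly_single_induct)
  case (1 m c)
  have 1: "homogeneous (mdeg m + d) (single m c * q)"
    by (intro homogeneous_mult assms) simp
  have 2: "homogeneous (mdeg m) (single m c)" by simp
  show ?case by (auto simp: hom_part_homogeneous[OF 1] hom_part_homogeneous[OF 2])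
qed (auto simp: algebra_simps)

text \<open>By \<open>hom_part_mult\<close>, multiplication by \<open>p\<close> shifts homogeneous
  components by \<open>j\<close>. As S is a domain, a component of \<open>q\<close> in any degree
  other than \<open>k - j\<close> would survive in the product.\<close>

lemma homogeneous_cancel:
  assumes "homogeneous j p" "p \<noteq> 0" "homogeneous k (p * q)" "q \<noteq> 0"
  shows "homogeneous (k - j) q" "j \<le> k"
proof -
  have *: "hom_part i q = 0" if "i + j \<noteq> k" for i
  proof -
    have "hom_part i q * p = hom_part (i + j) (q * p)" using hom_part_mult[OF assms(1), of "i + j" q] by simp
    also have "\<dots> = 0" using assms(3) that by (simp add: hom_part_homogeneous mult.commute)
    finally show ?thesis using assms(2) by simp
  qed
  obtain i where "hom_part i q \<noteq> 0" using eq_0_if_hom_part_eq_0 assms(4) by blast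
  with * show "j \<le> k" by (metis le_add2)
  show "homogeneous (k - j) q" unfolding homogeneous_iff
  proof
    fix m assume "m \<in> keys q"
    then have "hom_part (mdeg m) q \<noteq> 0" by (metis in_keys_iff lookup_hom_part lookup_zero)
    with * show "mdeg m = k - j" by fastforce
  qed
qed

lemma homogeneous_dvd_imp_eq_0:
  assumes "homogeneous j p" "p dvd q" "homogeneous k q" "k < j" shows "q = 0"
  using assms homogeneous_cancel(2) by (metis dvd_def leD mult_eq_0_iff)

section \<open>Partial derivatives and Euler's relation\<close>

abbreviation pd where "pd \<equiv> partial_deriv"

lemma pd_single [simp]: "pd i (single m c) = single (m - single i 1) (of_nat (lookup m i) * c)"
  by (simp add: partial_deriv_def)

lemma pd_eq_sum: "finite K \<Longrightarrow> keys p \<subseteq> K \<Longrightarrow> pd i p = (\<Sum>m\<in>K. single (m - single i 1) (of_nat (lookup m i) * lookup p m))"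
  unfolding partial_deriv_def by (rule sum.mono_neutral_left) (auto simp: in_keys_iff)

lemma pd_add [simp]: "pd i (p + q) = pd i p + pd i q"
proof -
  let ?K = "keys p \<union> keys q"
  have "keys (p + q) \<subseteq> ?K" by (rule Poly_Mapping.keys_add)
  then show ?thesis
    by (simp add: pd_eq_sum[of ?K] lookup_add ring_distribs single_add sum.distrib)
qed

lemma pd_mult: "pd i (p * q) = pd i p * q + p * pd i q"
proof (induction p rule: poly_single_induct)
  case (1 m c)
  show ?case
  proof (induction q rule: poly_single_induct)
    case (1 n e)
    have shift: "a + b - single i 1 = (a - single i 1) + b" if "lookup a i \<noteq> 0" for a b :: "3 \<Rightarrow>\<^sub>0 nat"
      by (rule poly_mapping_eqI) (use that in \<open>auto simp: lookup_add lookup_minus lookup_single when_def\<close>)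
    \<comment> \<open>Truncation in the exponent happens only when \<open>lookup m i = 0\<close>,
      and then both coefficients vanish.\<close>
    have "single (m + n - single i 1) (of_nat (lookup m i) * c * e) = single (m - single i 1 + n) (of_nat (lookup m i) * c * e)"
      by (cases "lookup m i = 0") (simp_all add: shift[unfolded One_nat_def])
    moreover have "single (m + n - single i 1) (of_nat (lookup n i) * c * e) = single (m + (n - single i 1)) (of_nat (lookup n i) * c * e)"
      by (cases "lookup n i = 0") (use shift[of n m] in \<open>simp_all add: add.commute\<close>)
    ultimately show ?case
      by (simp add: mult_single lookup_add ring_distribs single_add mult_ac add.commute)
  qed (simp add: algebra_simps)
qed (simp add: algebra_simps)

lemma pd_C [simp]: "pd i (C c) = 0" by (simp add: C_def)
lemma pd_1 [simp]: "pd i 1 = 0" using pd_C[of i 1] by simp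
lemma pd_numeral [simp]: "pd i (numeral n) = 0" using pd_C[of i "numeral n"] by simp
lemma pd_X [simp]: "pd i (X j) = (if i = j then 1 else 0)"
  by (auto simp: X_def lookup_single)
lemma pd_C_mult [simp]: "pd i (C c * p) = C c * pd i p" by (simp add: pd_mult)
lemma pd_uminus [simp]: "pd i (- p) = - pd i p" using pd_C_mult[of i "-1" p] by simp
lemma pd_diff [simp]: "pd i (p - q) = pd i p - pd i q" using pd_add[of i p "- q"] by simp

lemma homogeneous_pd: assumes "homogeneous k p" shows "homogeneous (k - 1) (pd i p)"
  unfolding partial_deriv_def
proof (rule homogeneous_sum)
  fix m assume m: "m \<in> keys p"
  have "mdeg (m - single i 1) = mdeg m - 1" if "lookup m i \<noteq> 0"
  proof -
    have "m = m - single i 1 + single i 1"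
      by (rule poly_mapping_eqI) (use that in \<open>auto simp: lookup_add lookup_minus lookup_single when_def\<close>)
    then have "mdeg m = mdeg (m - single i 1) + 1" by (metis mdeg_simps(2,3))
    then show ?thesis by simp
  qed
  then show "homogeneous (k - 1) (single (m - single i 1) (of_nat (lookup m i) * lookup p m))"
    using assms m by (auto simp: homogeneous_iff)
qed

lemma euler: assumes "homogeneous k p" shows "X 0 * pd 0 p + X 1 * pd 1 p + X 2 * pd 2 p = of_nat k * p"
proof -
  have 1: "X i * pd i (single m c) = of_nat (lookup m i) * single m c" for i m c
  proof -
    have "single i 1 + (m - single i 1) = m" if "lookup m i \<noteq> 0"
      by (rule poly_mapping_eqI) (use that in \<open>auto simp: lookup_add lookup_minus lookup_single when_def\<close>)
    then have "X i * pd i (single m c) = single m (of_nat (lookup m i) * c)"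
      by (cases "lookup m i = 0") (simp_all add: X_def mult_single)
    also have "\<dots> = C (of_nat (lookup m i)) * single m c"
      unfolding C_def by (simp only: mult_single add_0)
    finally show ?thesis by simp
  qed
  have 2: "X 0 * pd 0 (single m c) + X 1 * pd 1 (single m c) + X 2 * pd 2 (single m c) = of_nat (mdeg m) * single m c" for m c
    unfolding 1 by (simp add: mdeg_eq algebra_simps)
  have "X 0 * pd 0 q + X 1 * pd 1 q + X 2 * pd 2 q = (\<Sum>m\<in>keys q. of_nat (mdeg m) * single m (lookup q m))" for q
  proof -
    have "pd i q = (\<Sum>m\<in>keys q. pd i (single m (lookup q m)))" for i
      by (simp only: partial_deriv_def[of i q] pd_single)
    then show ?thesis unfolding 2[symmetric] by (simp only: sum.distrib sum_distrib_left)
  qed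
  also have "(\<Sum>m\<in>keys p. of_nat (mdeg m) * single m (lookup p m)) = (\<Sum>m\<in>keys p. of_nat k * single m (lookup p m))"
    using assms by (intro sum.cong) (auto simp: homogeneous_iff)
  also have "\<dots> = of_nat k * p"
    unfolding sum_distrib_left[symmetric]
    by (rule arg_cong[where f = "(*) _"], rule poly_mapping_eqI)
      (auto simp: lookup_sum lookup_single when_def in_keys_iff)
  finally show ?thesis .
qed

text \<open>Evaluation in an arbitrary commutative ring, along a homomorphism on the coefficients.
  The instances are S itself (substitution of forms), the complex numbers (values at points) and
  univariate polynomials (pullback to a parametrised curve).\<close>

locale coeff_hom =
  fixes \<iota> :: "complex \<Rightarrow> 'a :: comm_ring_1"
  assumes hom_add: "\<iota> (a + b) = \<iota> a + \<iota> b" and hom_mult: "\<iota> (a * b) = \<iota> a * \<iota> b" and hom_1: "\<iota> 1 = 1"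
begin

lemma hom_0: "\<iota> 0 = 0" using hom_add[of 0 0] by simp

definition mon :: "'a \<times> 'a \<times> 'a \<Rightarrow> (3 \<Rightarrow>\<^sub>0 nat) \<Rightarrow> 'a" where
  "mon v m = (case v of (x, y, z) \<Rightarrow> x ^ lookup m 0 * y ^ lookup m 1 * z ^ lookup m 2)"

definition ev :: "'a \<times> 'a \<times> 'a \<Rightarrow> S \<Rightarrow> 'a" where
  "ev v p = (\<Sum>m\<in>keys p. \<iota> (lookup p m) * mon v m)"

lemma mon_add: "mon v (m + n) = mon v m * mon v n"
  by (simp add: mon_def lookup_add power_add split: prod.split)

lemma ev_single: "ev v (single m c) = \<iota> c * mon v m" by (simp add: ev_def hom_0)

lemma ev_eq_sum: "finite K \<Longrightarrow> keys p \<subseteq> K \<Longrightarrow> ev v p = (\<Sum>m\<in>K. \<iota> (lookup p m) * mon v m)"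
  unfolding ev_def by (rule sum.mono_neutral_left) (auto simp: in_keys_iff hom_0)

lemma ev_add [simp]: "ev v (p + q) = ev v p + ev v q"
proof -
  let ?K = "keys p \<union> keys q"
  have "keys (p + q) \<subseteq> ?K" by (rule Poly_Mapping.keys_add)
  then show ?thesis
    by (simp add: ev_eq_sum[of ?K] lookup_add ring_distribs hom_add sum.distrib)
qed

lemma ev_mult [simp]: "ev v (p * q) = ev v p * ev v q"
proof (induction p rule: poly_single_induct)
  case (1 m c)
  show ?case
    by (induction q rule: poly_single_induct)
      (simp_all add: mult_single ev_single mon_add hom_mult ring_distribs mult_ac)
qed (simp add: ring_distribs)

lemma ev_C [simp]: "ev v (C c) = \<iota> c" by (simp add: C_def ev_single mon_def split: prod.split)
lemma ev_0 [simp]: "ev v 0 = 0" using ev_C[of v 0] by (simp add: hom_0 del: ev_C)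
lemma ev_1 [simp]: "ev v 1 = 1" using ev_C[of v 1] by (simp add: hom_1 del: ev_C)
lemma ev_uminus [simp]: "ev v (- p) = - ev v p" using ev_add[of v p "- p"] by (simp del: ev_add add: eq_neg_iff_add_eq_0 add.commute)
lemma ev_diff [simp]: "ev v (p - q) = ev v p - ev v q" using ev_add[of v p "- q"] by simp
lemma ev_power [simp]: "ev v (p ^ n) = ev v p ^ n" by (induction n) simp_all
lemma ev_of_nat [simp]: "ev v (of_nat n) = of_nat n" by (induction n) simp_all
lemma ev_numeral [simp]: "ev v (numeral n) = numeral n" using ev_of_nat[of v "numeral n"] by simp
lemma ev_X [simp]: "ev v (X 0) = fst v" "ev v (X 1) = fst (snd v)" "ev v (X 2) = snd (snd v)"
  by (simp_all add: X_def ev_single mon_def lookup_single hom_1 split: prod.split)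
lemma ev_prod_list [simp]: "ev v (prod_list ps) = prod_list (map (ev v) ps)" by (induction ps) simp_all

lemma ev_scaled:
  assumes "homogeneous k p"
  shows "ev (t * a, t * b, t * c) p = t ^ k * ev (a, b, c) p"
  unfolding ev_def sum_distrib_left
  by (intro sum.cong) (use assms in \<open>auto simp: homogeneous_iff mon_def mdeg_eq power_mult_distrib power_add mult_ac\<close>)

end

interpretation sv: coeff_hom C by unfold_locales simp_all
interpretation cv: coeff_hom "\<lambda>c. c" by unfold_locales simp_all

section \<open>Dimensions of spaces of forms\<close>

context vector_space
begin

text \<open>S is infinite-dimensional over the complex numbers, and \<open>dim\<close> is
  informative only where a finite basis exists, so finiteness is recorded for each subspace
  separately.\<close>

definition fin_dim :: "'b set \<Rightarrow> bool" where
  "fin_dim V \<longleftrightarrow> subspace V \<and> (\<exists>T. finite T \<and> V \<subseteq> span T)"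

lemma fin_dim_subset: "local.fin_dim V \<Longrightarrow> subspace U \<Longrightarrow> U \<subseteq> V \<Longrightarrow> local.fin_dim U"
  unfolding fin_dim_def by blast

lemma fin_dim_finite: "local.fin_dim V \<Longrightarrow> B \<subseteq> V \<Longrightarrow> independent B \<Longrightarrow> finite B"
  unfolding fin_dim_def using independent_span_bound by blast

lemma span_Int_eq_0:
  assumes B: "independent B" "K \<subseteq> B" and x: "x \<in> span K" "x \<in> span (B - K)"
  shows "x = 0"
proof -
  have "representation B x = representation K x" "representation B x = representation (B - K) x"
    using B x by (auto intro: representation_extend)
  then have "representation B x b = 0" for b
    using representation_ne_zero[of K x b] representation_ne_zero[of "B - K" x b] by auto
  moreover have "x \<in> span B" using x(1) span_mono[OF B(2)] by blast
  ultimately show ?thesis using sum_nonzero_representation_eq[OF B(1), of x] by simp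
qed

lemma adapted_basis:
  assumes "local.fin_dim V" "subspace U" "U \<subseteq> V"
  obtains B K where "K \<subseteq> B" "B \<subseteq> V" "independent B" "V \<subseteq> span B" "finite B" "card B = dim V"
    "span K = U" "card K = dim U"
proof -
  obtain K where K: "K \<subseteq> U" "independent K" "U \<subseteq> span K" "card K = dim U" by (rule basis_exists)
  from K(1) assms(3) have "K \<subseteq> V" by blast
  then obtain B where B: "K \<subseteq> B" "B \<subseteq> V" "independent B" "V \<subseteq> span B"
    by (rule maximal_independent_subset_extend[OF _ K(2)])
  show ?thesis
    by (rule that[OF B fin_dim_finite[OF assms(1) B(2,3)] basis_card_eq_dim[OF B(2,4,3)] _ K(4)])
      (use K assms(2) span_minimal in blast)
qed

end

context vector_space_pair
begin

lemma subspace_kernel: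
  assumes f: "Vector_Spaces.linear s1 s2 f" and V: "vs1.subspace V"
  shows "vs1.subspace {v \<in> V. f v = 0}"
proof -
  interpret f: Vector_Spaces.linear s1 s2 f by (rule f)
  show ?thesis using V by (auto simp: vs1.subspace_def f.add f.scale)
qed

text \<open>A basis \<open>K\<close> of the kernel extends to a basis \<open>B\<close> of
  \<open>V\<close>; the map is injective on the span of \<open>B - K\<close>, and the images of
  these vectors form a basis of the image.\<close>

lemma rank_nullity:
  assumes f: "Vector_Spaces.linear s1 s2 f" and V: "vs1.fin_dim V"
  shows "vs2.fin_dim (f ` V)" "vs1.dim V = vs1.dim {v \<in> V. f v = 0} + vs2.dim (f ` V)"
proof -
  interpret f: Vector_Spaces.linear s1 s2 f by (rule f)
  have sV: "vs1.subspace V" using V by (simp add: vs1.fin_dim_def)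
  have "vs1.subspace {v \<in> V. f v = 0}" by (rule subspace_kernel[OF f sV])
  then obtain B K where B: "K \<subseteq> B" "B \<subseteq> V" "vs1.independent B" "V \<subseteq> vs1.span B" "finite B"
    "card B = vs1.dim V" and K: "vs1.span K = {v \<in> V. f v = 0}" "card K = vs1.dim {v \<in> V. f v = 0}"
    by (rule vs1.adapted_basis[OF V _ Collect_subset])
  define D where "D = B - K"
  have DV: "vs1.span D \<subseteq> V" using B(2) sV by (intro vs1.span_minimal) (auto simp: D_def)
  have inj: "inj_on f (vs1.span D)"
    unfolding linear_inj_on_iff_eq_0[OF f vs1.subspace_span]
    using vs1.span_Int_eq_0[OF B(3,1)] K(1) DV by (auto simp: D_def)
  have ind: "vs2.independent (f ` D)"
    by (rule linear_independent_injective_image[OF f _ inj])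
      (use B(3) vs1.independent_mono in \<open>auto simp: D_def\<close>)
  have span: "f ` V \<subseteq> vs2.span (f ` D)"
  proof (rule image_subsetI)
    fix v assume "v \<in> V"
    moreover have "B = K \<union> D" using B(1) by (auto simp: D_def)
    ultimately have "v \<in> vs1.span (K \<union> D)" using B(4) by auto
    then obtain a b where ab: "v = a + b" "a \<in> vs1.span K" "b \<in> vs1.span D"
      unfolding vs1.span_Un by blast
    then have "f v = f b" using K(1) by (simp add: f.add)
    then show "f v \<in> vs2.span (f ` D)" using ab(3) by (simp add: f.span_image)
  qed
  have sub: "vs2.subspace (f ` V)" by (rule f.subspace_image[OF sV])
  show "vs2.fin_dim (f ` V)"
    unfolding vs2.fin_dim_def using sub span B(5) by (intro conjI exI[of _ "f ` D"]) (auto simp: D_def)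
  have "card (f ` D) = card D" by (rule card_image) (use inj vs1.span_superset in \<open>auto intro: inj_on_subset\<close>)
  moreover have "card (f ` D) = vs2.dim (f ` V)"
    by (rule vs2.basis_card_eq_dim[OF _ span ind]) (use B(2) in \<open>auto simp: D_def\<close>)
  moreover have "card B = card K + card D"
    using B(1,5) by (simp add: D_def card_Diff_subset finite_subset card_mono)
  ultimately show "vs1.dim V = vs1.dim {v \<in> V. f v = 0} + vs2.dim (f ` V)"
    using B(6) K(2) by simp
qed

lemma dim_image_inj:
  assumes f: "Vector_Spaces.linear s1 s2 f" and V: "vs1.fin_dim V" and inj: "\<And>v. v \<in> V \<Longrightarrow> f v = 0 \<Longrightarrow> v = 0"
  shows "vs2.dim (f ` V) = vs1.dim V"
proof -
  have "0 \<in> V" using V by (simp add: vs1.fin_dim_def vs1.subspace_0)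
  moreover have "f 0 = 0" using f by (simp add: linear_0)
  ultimately have "{v \<in> V. f v = 0} = {0}" using inj by auto
  then show ?thesis
    using rank_nullity[OF f V] vs1.dim_unique[of "{}" "{0}" 0] vs1.independent_empty by simp
qed

end

section \<open>The vector spaces at hand and dimensions of quotients\<close>

lemma vector_space_scal: "vector_space scal"
  by unfold_locales (simp_all add: scal_C algebra_simps)

definition scal3 :: "complex \<Rightarrow> S \<times> S \<times> S \<Rightarrow> S \<times> S \<times> S" where
  "scal3 c = (\<lambda>(p, q, r). (scal c p, scal c q, scal c r))"

lemma vector_space_scal3: "vector_space scal3"
  by unfold_locales (auto simp: scal3_def scal_C algebra_simps)

lemma vector_space_complex: "vector_space ((*) :: complex \<Rightarrow> complex \<Rightarrow> complex)"
  by unfold_locales (simp_all add: algebra_simps)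

interpretation vS: vector_space scal by (rule vector_space_scal)
interpretation vS3: vector_space scal3 by (rule vector_space_scal3)
interpretation vC: vector_space "(*) :: complex \<Rightarrow> complex \<Rightarrow> complex" by (rule vector_space_complex)
interpretation pSS: vector_space_pair scal scal
  by (rule vector_space_pair.intro[OF vector_space_scal vector_space_scal])
interpretation p3S: vector_space_pair scal3 scal
  by (rule vector_space_pair.intro[OF vector_space_scal3 vector_space_scal])
interpretation p33: vector_space_pair scal3 scal3
  by (rule vector_space_pair.intro[OF vector_space_scal3 vector_space_scal3])
interpretation pSC: vector_space_pair scal "(*) :: complex \<Rightarrow> complex \<Rightarrow> complex"
  by (rule vector_space_pair.intro[OF vector_space_scal vector_space_complex])

text \<open>Representatives of a basis modulo \<open>W\<close>, joined with a basis of
  \<open>V \<inter> W\<close>, form a basis of \<open>V\<close>. In particular \<open>n\<close> is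
  determined by \<open>V\<close> and \<open>W\<close>, which makes the definite description in
  \<open>tjurina_number\<close> meaningful.\<close>

lemma quotient_dim_imp:
  assumes V: "vS.fin_dim V" and W: "vS.subspace W" and q: "quotient_dim V W n"
  shows "vS.dim V = vS.dim (V \<inter> W) + n"
proof -
  have sV: "vS.subspace V" using V by (simp add: vS.fin_dim_def)
  from q obtain B where B: "B \<subseteq> V" "finite B" "card B = n"
    "\<And>v. v \<in> V \<Longrightarrow> \<exists>c. v - (\<Sum>b\<in>B. scal (c b) b) \<in> W"
    "\<And>c b. (\<Sum>b\<in>B. scal (c b) b) \<in> W \<Longrightarrow> b \<in> B \<Longrightarrow> c b = 0"
    unfolding quotient_dim_def by blast
  obtain K where K: "K \<subseteq> V \<inter> W" "vS.independent K" "V \<inter> W \<subseteq> vS.span K" "card K = vS.dim (V \<inter> W)"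
    by (rule vS.basis_exists)
  have finK: "finite K" using vS.fin_dim_finite[OF V _ K(2)] K(1) by blast
  have nin: "b \<notin> vS.span (K \<union> D)" if "D \<subseteq> B" "b \<in> B" "b \<notin> D" for b D
  proof
    assume "b \<in> vS.span (K \<union> D)"
    then obtain w d where wd: "b = w + d" "w \<in> vS.span K" "d \<in> vS.span D" unfolding vS.span_Un by blast
    have finD: "finite D" using that(1) B(2) finite_subset by blast
    obtain u where u: "d = (\<Sum>v\<in>D. scal (u v) v)" using wd(3) by (auto simp: vS.span_finite[OF finD])
    \<comment> \<open>These are the coefficients of \<open>b - d\<close>, which is the element
      \<open>w\<close> of \<open>W\<close>; the coefficient 1 at \<open>b\<close> contradicts
      independence modulo \<open>W\<close>.\<close>
    define c where "c v = (if v = b then 1 else if v \<in> D then - u v else 0)" for v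
    have "(\<Sum>v\<in>B. scal (c v) v) = (\<Sum>v\<in>insert b D. scal (c v) v)"
      by (rule sum.mono_neutral_right) (use that B(2) in \<open>auto simp: c_def\<close>)
    also have "\<dots> = b + (\<Sum>v\<in>D. scal (c v) v)" using that(3) finD by (simp add: c_def)
    also have "(\<Sum>v\<in>D. scal (c v) v) = (\<Sum>v\<in>D. - scal (u v) v)"
      by (rule sum.cong) (use that(3) in \<open>auto simp: c_def\<close>)
    also have "b + \<dots> = w" using wd(1) u by (simp add: sum_negf)
    also have "w \<in> W" using wd(2) K(1) vS.span_minimal[OF _ W] by blast
    finally have "c b = 0" using B(5) that(2) by blast
    then show False by (simp add: c_def)
  qed
  have "vS.independent (K \<union> D) \<and> card (K \<union> D) = card K + card D" if "finite D" "D \<subseteq> B" for D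
    using that
  proof (induction D rule: finite_induct)
    case (insert b D)
    then have b: "b \<notin> vS.span (K \<union> D)" using nin[of D b] by auto
    then have "b \<notin> K \<union> D" using vS.span_base by blast
    moreover have "vS.independent (insert b (K \<union> D))"
      using b insert by (intro vS.independent_insertI) auto
    ultimately show ?case using insert finK by simp
  qed (use K(2) in simp)
  from this[OF B(2)] have ind: "vS.independent (K \<union> B)" and card: "card (K \<union> B) = card K + n"
    using B(3) by auto
  have "V \<subseteq> vS.span (K \<union> B)"
  proof
    fix v assume v: "v \<in> V"
    then obtain c where c: "v - (\<Sum>b\<in>B. scal (c b) b) \<in> W" using B(4) by blast
    have sB: "(\<Sum>b\<in>B. scal (c b) b) \<in> vS.span B"
      by (intro vS.span_sum vS.span_scale vS.span_base)
    then have "v - (\<Sum>b\<in>B. scal (c b) b) \<in> V"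
      using v B(1) sV vS.span_minimal vS.subspace_diff by blast
    with c have "v - (\<Sum>b\<in>B. scal (c b) b) \<in> vS.span K" using K(3) by blast
    with sB show "v \<in> vS.span (K \<union> B)" unfolding vS.span_Un by force
  qed
  then have "card (K \<union> B) = vS.dim V"
    using vS.basis_card_eq_dim[OF _ _ ind] K(1) B(1) by blast
  with card K(4) show ?thesis by simp
qed

lemma quotient_dim_if:
  assumes V: "vS.fin_dim V" and W: "vS.subspace W" and n: "vS.dim V = vS.dim (V \<inter> W) + n"
  shows "quotient_dim V W n"
proof -
  have sV: "vS.subspace V" using V by (simp add: vS.fin_dim_def)
  have sVW: "vS.subspace (V \<inter> W)" using sV W by (rule vS.subspace_inter)
  obtain B K where B: "K \<subseteq> B" "B \<subseteq> V" "vS.independent B" "V \<subseteq> vS.span B" "finite B"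
    "card B = vS.dim V" and K: "vS.span K = V \<inter> W" "card K = vS.dim (V \<inter> W)"
    by (rule vS.adapted_basis[OF V sVW Int_lower1])
  define D where "D = B - K"
  have fin: "finite D" "finite K" using B(1,5) by (auto simp: D_def finite_subset)
  have iD: "vS.independent D" using B(3) vS.independent_mono by (auto simp: D_def)
  show ?thesis unfolding quotient_dim_def
  proof (intro exI[of _ D] conjI ballI allI impI)
    show "D \<subseteq> V" "finite D" using B(2) fin by (auto simp: D_def)
    show "card D = n" using B(1,6) K(2) n fin by (simp add: D_def card_Diff_subset)
    fix v assume "v \<in> V"
    moreover have "B = K \<union> D" using B(1) by (auto simp: D_def)
    ultimately have "v \<in> vS.span (K \<union> D)" using B(4) by auto
    then obtain a d where ad: "v = a + d" "a \<in> vS.span K" "d \<in> vS.span D" unfolding vS.span_Un by blast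
    moreover obtain u where "d = (\<Sum>v\<in>D. scal (u v) v)" using ad(3) by (auto simp: vS.span_finite[OF fin(1)])
    ultimately have "v - (\<Sum>b\<in>D. scal (u b) b) \<in> W" using K(1) by auto
    then show "\<exists>c. v - (\<Sum>b\<in>D. scal (c b) b) \<in> W" by blast
  next
    fix c b assume c: "(\<Sum>b\<in>D. scal (c b) b) \<in> W" and b: "b \<in> D"
    have sD: "(\<Sum>b\<in>D. scal (c b) b) \<in> vS.span D"
      by (intro vS.span_sum vS.span_scale vS.span_base)
    moreover have "vS.span D \<subseteq> V" using B(2) sV by (intro vS.span_minimal) (auto simp: D_def)
    ultimately have "(\<Sum>b\<in>D. scal (c b) b) \<in> vS.span K" using c K(1) by blast
    then have "(\<Sum>b\<in>D. scal (c b) b) = 0" using vS.span_Int_eq_0[OF B(3,1)] sD by (simp add: D_def)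
    then show "c b = 0" using vS.independentD[OF iD fin(1) order.refl _ b] by blast
  qed
qed

section \<open>Spaces of forms and of triples of forms\<close>

definition forms :: "nat \<Rightarrow> S set" where "forms k = {p. homogeneous k p}"

lemma subspace_forms: "vS.subspace (forms k)"
  by (auto simp: vS.subspace_def forms_def homogeneous_add homogeneous_scal)

lemma lookup_scal [simp]: "lookup (scal c p) m = c * lookup p m"
proof -
  have "scal c p = Poly_Mapping.map ((*) c) p" unfolding scal_def by (simp add: mult_map_scale_conv_mult)
  then show ?thesis by (simp add: Poly_Mapping.map.rep_eq when_def)
qed

lemma finite_mdeg: "finite {m. mdeg m = k}" and card_mdeg: "card {m. mdeg m = k} = (k + 2) choose 2"
proof -
  let ?g = "\<lambda>(a, b). single 0 a + single 1 b + single 2 (k - a - b) :: 3 \<Rightarrow>\<^sub>0 nat"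
  let ?P = "SIGMA a:{..k}. {..k - a}"
  have eq: "{m. mdeg m = k} = ?g ` ?P"
  proof (intro subset_antisym subsetI)
    fix m assume m: "m \<in> {m. mdeg m = k}"
    have "m = ?g (lookup m 0, lookup m 1)"
    proof (rule poly_mapping_eqI)
      fix i :: 3 show "lookup m i = lookup (?g (lookup m 0, lookup m 1)) i"
        using exhaust_three[of i] m by (auto simp: lookup_add lookup_single mdeg_eq)
    qed
    moreover have "(lookup m 0, lookup m 1) \<in> ?P" using m by (auto simp: mdeg_eq)
    ultimately show "m \<in> ?g ` ?P" by blast
  qed auto
  then show "finite {m. mdeg m = k}" by simp
  have "inj_on ?g ?P"
  proof (rule inj_onI)
    fix x y assume "?g x = ?g y"
    then have "lookup (?g x) i = lookup (?g y) i" for i by simp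
    from this[of 0] this[of 1] show "x = y"
      by (auto simp: lookup_add lookup_single prod_eq_iff split: prod.splits)
  qed
  then have "card {m. mdeg m = k} = card ?P" unfolding eq by (rule card_image)
  also have "\<dots> = (\<Sum>a\<le>k. k - a + 1)" by simp
  also have "\<dots> = (\<Sum>a\<le>k. a + 1)" using sum.atLeastAtMost_rev[of "\<lambda>a. a + 1" 0 k] by (simp add: atMost_atLeast0)
  also have "\<dots> = (k + 2) choose 2"
    by (induction k) (simp_all add: numeral_2_eq_2)
  finally show "card {m. mdeg m = k} = (k + 2) choose 2" .
qed

lemma fin_dim_forms: "vS.fin_dim (forms k)" and dim_forms: "vS.dim (forms k) = (k + 2) choose 2"
proof -
  let ?B = "(\<lambda>m. single m 1) ` {m. mdeg m = k} :: S set"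
  have inj: "inj_on (\<lambda>m. single m (1 :: complex)) {m. mdeg m = k}"
    by (rule inj_onI) (metis inj_single lookup_single_eq lookup_single_not_eq zero_neq_one)
  have sub: "?B \<subseteq> forms k" by (auto simp: forms_def)
  have span: "forms k \<subseteq> vS.span ?B"
  proof
    fix p assume p: "p \<in> forms k"
    have "p = (\<Sum>m\<in>keys p. scal (lookup p m) (single m 1))"
      by (rule poly_mapping_eqI) (auto simp: lookup_sum lookup_single when_def in_keys_iff if_distrib cong: if_cong)
    also have "\<dots> \<in> vS.span ?B"
      using p by (intro vS.span_sum vS.span_scale vS.span_base) (auto simp: forms_def homogeneous_iff)
    finally show "p \<in> vS.span ?B" .
  qed
  have ind: "vS.independent ?B"
  proof (rule vS.independent_if_scalars_zero)
    show "finite ?B" by (simp add: finite_mdeg)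
    fix u b assume u: "(\<Sum>x\<in>?B. scal (u x) x) = 0" and "b \<in> ?B"
    then obtain m where m: "mdeg m = k" "b = single m 1" by auto
    have "0 = lookup (\<Sum>x\<in>?B. scal (u x) x) m" using u by simp
    also have "\<dots> = (\<Sum>n | mdeg n = k. u (single n 1) * lookup (single n 1) m)"
      by (simp add: sum.reindex[OF inj] lookup_sum)
    also have "\<dots> = u b" using m by (simp add: lookup_single when_def finite_mdeg if_distrib cong: if_cong)
    finally show "u b = 0" by simp
  qed
  show "vS.fin_dim (forms k)" unfolding vS.fin_dim_def using subspace_forms span finite_mdeg by blast
  show "vS.dim (forms k) = (k + 2) choose 2"
    by (rule vS.dim_unique[OF sub span ind]) (simp add: card_image[OF inj] card_mdeg)
qed

definition forms3 :: "nat \<Rightarrow> (S \<times> S \<times> S) set" where "forms3 k = forms k \<times> forms k \<times> forms k"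

lemma subspace_forms3: "vS3.subspace (forms3 k)"
  using subspace_forms[of k] by (auto simp: vS.subspace_def vS3.subspace_def forms3_def scal3_def zero_prod_def)

lemma linear_fst3: "Vector_Spaces.linear scal3 scal fst"
  and linear_snd3: "Vector_Spaces.linear scal3 scal (\<lambda>v. fst (snd v))"
  and linear_trd3: "Vector_Spaces.linear scal3 scal (\<lambda>v. snd (snd v))"
  by (auto simp: Vector_Spaces.linear_iff scal3_def vector_space_scal vector_space_scal3 split: prod.split)

lemma linear_emb3: "Vector_Spaces.linear scal scal3 (\<lambda>p. (p, 0, 0))"
  "Vector_Spaces.linear scal scal3 (\<lambda>p. (0, p, 0))" "Vector_Spaces.linear scal scal3 (\<lambda>p. (0, 0, p))"
  by (auto simp: Vector_Spaces.linear_iff scal3_def vector_space_scal vector_space_scal3)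

interpretation pS3: vector_space_pair scal scal3
  by (rule vector_space_pair.intro[OF vector_space_scal vector_space_scal3])

lemma fin_dim_forms3: "vS3.fin_dim (forms3 k)"
proof -
  obtain T where T: "finite T" "forms k \<subseteq> vS.span T" using fin_dim_forms[of k] by (auto simp: vS.fin_dim_def)
  let ?f = "\<lambda>p. (p, 0, 0) :: S \<times> S \<times> S" let ?g = "\<lambda>p. (0, p, 0) :: S \<times> S \<times> S" let ?h = "\<lambda>p. (0, 0, p) :: S \<times> S \<times> S"
  let ?T = "?f ` T \<union> (?g ` T \<union> ?h ` T)"
  have "forms3 k \<subseteq> vS3.span ?T"
  proof
    fix v assume "v \<in> forms3 k"
    then obtain a b c where v: "v = (a, b, c)" "a \<in> vS.span T" "b \<in> vS.span T" "c \<in> vS.span T"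
      using T(2) by (auto simp: forms3_def)
    have "?f a \<in> vS3.span (?f ` T)" "?g b \<in> vS3.span (?g ` T)" "?h c \<in> vS3.span (?h ` T)"
      using v by (auto simp: pS3.linear_span_image linear_emb3)
    moreover have "v = ?f a + (?g b + ?h c)" using v by simp
    ultimately show "v \<in> vS3.span ?T" unfolding vS3.span_Un by blast
  qed
  then show ?thesis unfolding vS3.fin_dim_def using subspace_forms3 T(1)
    by (intro conjI exI[of _ ?T]) auto
qed

lemma dim_forms3: "vS3.dim (forms3 k) = 3 * ((k + 2) choose 2)"
proof -
  have 0: "0 \<in> forms k" using vS.subspace_0[OF subspace_forms] .
  let ?U = "{v \<in> forms3 k. fst v = 0}"
  let ?U' = "{v \<in> ?U. fst (snd v) = 0}"
  have sU: "vS3.subspace ?U" by (rule p3S.subspace_kernel[OF linear_fst3 subspace_forms3])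
  then have U: "vS3.fin_dim ?U" using vS3.fin_dim_subset[OF fin_dim_forms3] by blast
  have "vS3.subspace ?U'" by (rule p3S.subspace_kernel[OF linear_snd3 sU])
  then have U': "vS3.fin_dim ?U'" using vS3.fin_dim_subset[OF U] by blast
  have "fst ` forms3 k = forms k" using 0 by (force simp: forms3_def)
  moreover have "(\<lambda>v. fst (snd v)) ` ?U = forms k" using 0 by (force simp: forms3_def)
  moreover have "(\<lambda>v. snd (snd v)) ` ?U' = forms k" using 0 by (force simp: forms3_def)
  moreover have "vS.dim ((\<lambda>v. snd (snd v)) ` ?U') = vS3.dim ?U'"
    by (rule p3S.dim_image_inj[OF linear_trd3 U']) (auto simp: zero_prod_def)
  ultimately show ?thesis
    using p3S.rank_nullity(2)[OF linear_fst3 fin_dim_forms3[of k]] p3S.rank_nullity(2)[OF linear_snd3 U]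
      dim_forms[of k] by simp
qed

section \<open>Linear forms and points\<close>

text \<open>Lines and points of the plane are both given by triples, and the ring is left open: the
  entries will be complex numbers, forms (for syzygies and one-forms) and integers (for the explicit
  arrangements).\<close>

definition dot :: "'a :: comm_ring_1 \<times> 'a \<times> 'a \<Rightarrow> 'a \<times> 'a \<times> 'a \<Rightarrow> 'a" where
  "dot u v = fst u * fst v + fst (snd u) * fst (snd v) + snd (snd u) * snd (snd v)"

definition cross :: "'a :: comm_ring_1 \<times> 'a \<times> 'a \<Rightarrow> 'a \<times> 'a \<times> 'a \<Rightarrow> 'a \<times> 'a \<times> 'a" where
  "cross u v = (fst (snd u) * snd (snd v) - snd (snd u) * fst (snd v),
     snd (snd u) * fst v - fst u * snd (snd v), fst u * fst (snd v) - fst (snd u) * fst v)"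

definition smult3 :: "'a :: comm_ring_1 \<Rightarrow> 'a \<times> 'a \<times> 'a \<Rightarrow> 'a \<times> 'a \<times> 'a" where
  "smult3 c v = (c * fst v, c * fst (snd v), c * snd (snd v))"

definition map3 :: "('a \<Rightarrow> 'b) \<Rightarrow> 'a \<times> 'a \<times> 'a \<Rightarrow> 'b \<times> 'b \<times> 'b" where
  "map3 h v = (h (fst v), h (fst (snd v)), h (snd (snd v)))"

lemmas vec_defs = dot_def cross_def smult3_def map3_def

lemma dot_commute: "dot u v = dot v u" by (simp add: dot_def mult.commute)
lemma dot_cross_self [simp]: "dot u (cross u v) = 0" "dot v (cross u v) = 0"
  "dot (cross u v) u = 0" "dot (cross u v) v = 0"
  by (simp_all add: dot_def cross_def algebra_simps)
lemma dot_cross_swap: "dot a (cross n b) = - dot b (cross n a)"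
  by (simp add: dot_def cross_def algebra_simps)
lemma dot_cross_rotate: "dot (cross u v) w = dot v (cross w u)"
  by (simp add: dot_def cross_def algebra_simps)
lemma cross_self [simp]: "cross u u = 0"
  by (simp add: cross_def zero_prod_def algebra_simps)
lemma cross_0 [simp]: "cross 0 u = 0" "cross u 0 = 0"
  by (simp_all add: cross_def zero_prod_def)
lemma dot_0 [simp]: "dot 0 u = 0" "dot u 0 = 0"
  by (simp_all add: dot_def zero_prod_def)
lemma cross_eq_0_commute: "cross u v = 0 \<longleftrightarrow> cross v u = 0"
  by (auto simp: cross_def zero_prod_def algebra_simps)
lemma smult3_eq_0 [simp]: "smult3 c v = 0 \<longleftrightarrow> c = 0 \<or> v = (0 :: 'a :: idom \<times> 'a \<times> 'a)"
  by (cases v) (auto simp: smult3_def zero_prod_def)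

text \<open>Cramer's rule, one coordinate at a time. For \<open>v = E3\<close> it writes the
  variables as combinations of three linear forms.\<close>

lemma cramer:
  "fst v * dot c (cross a b) = dot a v * fst (cross b c) + dot b v * fst (cross c a) + dot c v * fst (cross a b)"
  "fst (snd v) * dot c (cross a b) = dot a v * fst (snd (cross b c)) + dot b v * fst (snd (cross c a)) + dot c v * fst (snd (cross a b))"
  "snd (snd v) * dot c (cross a b) = dot a v * snd (snd (cross b c)) + dot b v * snd (snd (cross c a)) + dot c v * snd (snd (cross a b))"
  by (simp_all add: dot_def cross_def algebra_simps)

lemma dot_eq_1_exists:
  fixes v :: "'a :: field \<times> 'a \<times> 'a"
  assumes "v \<noteq> 0" obtains e where "dot e v = 1"
proof -
  obtain a b c where v: "v = (a, b, c)" by (cases v)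
  with assms consider "a \<noteq> 0" | "b \<noteq> 0" | "c \<noteq> 0" by (auto simp: zero_prod_def)
  then show ?thesis
  proof cases
    case 1 then show ?thesis by (intro that[of "(1 / a, 0, 0)"]) (simp add: v dot_def)
  next
    case 2 then show ?thesis by (intro that[of "(0, 1 / b, 0)"]) (simp add: v dot_def)
  next
    case 3 then show ?thesis by (intro that[of "(0, 0, 1 / c)"]) (simp add: v dot_def)
  qed
qed

lemma parallel_if_cross_eq_0:
  fixes u v :: "'a :: field \<times> 'a \<times> 'a"
  assumes "cross u v = 0" "u \<noteq> 0" shows "\<exists>c. v = smult3 c u"
proof -
  obtain e where e: "dot e u = 1" using dot_eq_1_exists[OF assms(2)] .
  obtain u1 u2 u3 v1 v2 v3 e1 e2 e3 where [simp]: "u = (u1, u2, u3)" "v = (v1, v2, v3)" "e = (e1, e2, e3)"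
    by (cases u, cases v, cases e) auto
  have z: "u2 * v3 = u3 * v2" "u3 * v1 = u1 * v3" "u1 * v2 = u2 * v1" and 1: "e1 * u1 + e2 * u2 + e3 * u3 = 1"
    using assms(1) e by (auto simp: cross_def dot_def zero_prod_def)
  have "v1 = (e1 * v1 + e2 * v2 + e3 * v3) * u1" "v2 = (e1 * v1 + e2 * v2 + e3 * v3) * u2"
    "v3 = (e1 * v1 + e2 * v2 + e3 * v3) * u3"
    using z 1 by algebra+
  then have "v = smult3 (dot e v) u" by (simp add: dot_def smult3_def)
  then show ?thesis ..
qed

section \<open>Linear forms and restriction to a line\<close>

definition E3 :: "S \<times> S \<times> S" where "E3 = (X 0, X 1, X 2)"

definition lf :: "complex \<times> complex \<times> complex \<Rightarrow> S" where "lf n = dot (map3 C n) E3"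

lemma lf_eq: "lf n = C (fst n) * X 0 + C (fst (snd n)) * X 1 + C (snd (snd n)) * X 2"
  by (simp add: lf_def vec_defs E3_def)

lemma homogeneous_lf [simp]: "homogeneous 1 (lf n)" "homogeneous (Suc 0) (lf n)"
  unfolding lf_eq using homogeneous_X by (auto intro!: homogeneous_add homogeneous_C_mult)

lemma ev_lf [simp]: "cv.ev P (lf n) = dot n P"
  by (simp add: lf_eq dot_def)

lemma sv_ev_lf: "sv.ev V (lf n) = dot (map3 C n) V"
  by (simp add: lf_eq dot_def map3_def)

lemma lf_0 [simp]: "lf 0 = 0" by (simp add: lf_eq zero_prod_def)

lemma lf_eq_0 [simp]: "lf n = 0 \<longleftrightarrow> n = 0"
proof
  assume "lf n = 0"
  then have "cv.ev P (lf n) = 0" for P by simp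
  from this[of "(1, 0, 0)"] this[of "(0, 1, 0)"] this[of "(0, 0, 1)"]
  show "n = 0" by (simp add: dot_def prod_eq_iff zero_prod_def)
qed simp

lemma homogeneous_prod_lf: "homogeneous (length ns) (prod_list (map lf ns))"
proof -
  have "homogeneous 1 p" if "p \<in> set (map lf ns)" for p using that by auto
  from homogeneous_prod_list[of "map lf ns", OF this] show ?thesis by simp
qed

lemma lf_smult3: "lf (smult3 c n) = C c * lf n"
  by (simp add: lf_eq smult3_def algebra_simps)

text \<open>For \<open>dot n e = 1\<close> this substitutes the linear projection along
  \<open>e\<close> onto the plane on which \<open>n\<close> vanishes. Restriction to the line
  \<open>n\<close> thus becomes an endomorphism of S, and no quotient ring is needed.\<close>

definition proj :: "complex \<times> complex \<times> complex \<Rightarrow> complex \<times> complex \<times> complex \<Rightarrow> S \<Rightarrow> S" where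
  "proj n e = sv.ev (X 0 - lf n * C (fst e), X 1 - lf n * C (fst (snd e)), X 2 - lf n * C (snd (snd e)))"

lemma proj_simps [simp]: "proj n e (p + q) = proj n e p + proj n e q" "proj n e (p * q) = proj n e p * proj n e q"
  "proj n e (p - q) = proj n e p - proj n e q" "proj n e (C c) = C c" "proj n e 0 = 0" "proj n e 1 = 1"
  "proj n e (prod_list ps) = prod_list (map (proj n e) ps)" "proj n e (p ^ k) = proj n e p ^ k"
  "proj n e (- p) = - proj n e p"
  by (simp_all add: proj_def)

lemma proj_lf: assumes "dot n e = 1" shows "proj n e (lf n) = 0"
proof -
  have "proj n e (lf n) = lf n - lf n * C (dot n e)"
    by (simp add: proj_def sv_ev_lf) (simp add: lf_eq vec_defs algebra_simps)
  then show ?thesis using assms by simp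
qed

lemma lf_dvd_diff_proj: "lf n dvd p - proj n e p"
proof (induction p rule: poly_induct)
  case (var i)
  then show ?case using exhaust_three[of i] by (auto simp: proj_def)
next
  case (add p q)
  then show ?case using dvd_add[of "lf n" "p - proj n e p" "q - proj n e q"] by (simp add: algebra_simps)
next
  case (mult p q)
  have "p * q - proj n e (p * q) = (p - proj n e p) * q + proj n e p * (q - proj n e q)" by (simp add: algebra_simps)
  then show ?case using mult by (metis dvd_add dvd_mult dvd_mult2)
qed simp

lemma lf_dvd_iff: assumes "dot n e = 1" shows "lf n dvd p \<longleftrightarrow> proj n e p = 0"
proof
  assume "lf n dvd p" then show "proj n e p = 0" using proj_lf[OF assms] by (auto elim!: dvdE)
next
  assume "proj n e p = 0" then show "lf n dvd p" using lf_dvd_diff_proj[of n p e] by simp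
qed

text \<open>\<open>lf n\<close> generates the kernel of \<open>proj n e\<close>, an endomorphism of
  a domain.\<close>

lemma prime_lf: assumes "n \<noteq> 0" shows "prime_elem (lf n)"
proof -
  obtain e where e: "dot n e = 1" using dot_eq_1_exists[OF assms] by (metis dot_commute)
  show ?thesis
    by (rule prime_elemI) (use assms in \<open>auto simp: lf_dvd_iff[OF e]\<close>)
qed

lemma lf_dvd_lf_iff: assumes "n \<noteq> 0" "cross n m \<noteq> 0" shows "\<not> lf n dvd lf m"
proof
  assume "lf n dvd lf m"
  then obtain q where q: "lf m = lf n * q" by (rule dvdE)
  have "m \<noteq> 0" using assms(2) by auto
  then have "q \<noteq> 0" using q by auto
  then have "homogeneous (1 - 1) q"
    using homogeneous_cancel(1)[of 1 "lf n" 1 q] q assms(1) homogeneous_lf(1)[of m] by simp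
  then obtain c where "q = C c" using homogeneous_0_imp_C by auto
  with q have "lf m = lf (smult3 c n)" by (simp add: lf_smult3)
  then have "lf (m - smult3 c n) = 0" by (simp add: lf_eq algebra_simps)
  then have "m = smult3 c n" by simp
  then show False using assms(2) by (simp add: vec_defs zero_prod_def)
qed

lemma prime_dvd_prod_list:
  fixes p :: "'a :: comm_semiring_1"
  shows "prime_elem p \<Longrightarrow> p dvd prod_list qs \<Longrightarrow> \<exists>q\<in>set qs. p dvd q"
proof (induction qs)
  case (Cons q qs)
  then show ?case using prime_elem_dvd_multD[of p q "prod_list qs"] by auto
qed (simp add: prime_elem_def)

lemma lf_dvd_prod_lf_imp:
  assumes "lf n dvd prod_list (map lf ns)" "n \<noteq> 0" shows "\<exists>m\<in>set ns. cross n m = 0"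
  using prime_dvd_prod_list[OF prime_lf[OF assms(2)] assms(1)] lf_dvd_lf_iff[OF assms(2)] by auto

lemma homogeneous_lf_cancel:
  assumes "homogeneous k (lf n * q)" "n \<noteq> 0" shows "homogeneous (k - 1) q"
  using homogeneous_cancel(1)[OF homogeneous_lf(1) _ assms(1)] assms(2) by (cases "q = 0") auto

lemma sv_ev_C: "sv.ev (map3 C P) p = C (cv.ev P p)"
proof (induction p rule: poly_induct)
  case (var i) then show ?case using exhaust_three[of i] by (auto simp: map3_def)
qed simp_all

text \<open>The substitution \<open>?V\<close> collapses everything to multiples of the point
  \<open>?P\<close>. It changes a polynomial only by an element of the ideal of \<open>lf a\<close>
  and \<open>lf b\<close>, and it turns \<open>p\<close> into \<open>lf m ^ k\<close> times the
  value of \<open>p\<close> at the point, which is zero.\<close>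

lemma vanishing_at_point:
  assumes ab: "cross a b \<noteq> 0" and p: "homogeneous k p" "cv.ev (cross a b) p = 0"
  shows "\<exists>u v. p = lf a * u + lf b * v \<and> homogeneous (k - 1) u \<and> homogeneous (k - 1) v"
proof (cases k)
  case 0
  then obtain c where "p = C c" using p(1) homogeneous_0_imp_C by blast
  then have "p = 0" using p(2) by simp
  then show ?thesis by (intro exI[of _ 0]) simp
next
  case (Suc j)
  let ?P = "cross a b"
  obtain m where m: "dot m ?P = 1" using dot_eq_1_exists[OF ab] .
  let ?V = "(lf m * C (fst ?P), lf m * C (fst (snd ?P)), lf m * C (snd (snd ?P)))"
  have C3: "map3 C (cross u v) = cross (map3 C u) (map3 C v)" for u v by (simp add: vec_defs)
  have 1: "dot (map3 C m) (cross (map3 C a) (map3 C b)) = 1"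
  proof -
    have "dot (map3 C m) (map3 C ?P) = C (dot m ?P)" by (simp add: dot_def map3_def)
    then show ?thesis using m by (simp add: C3)
  qed
  have "\<exists>u v. p - sv.ev ?V p = lf a * u + lf b * v" for p
  proof (induction p rule: poly_induct)
    case (const c) show ?case by (intro exI[of _ 0]) simp
  next
    case (var i)
    \<comment> \<open>As \<open>dot m ?P = 1\<close>, Cramer's rule writes each variable as a
      combination of \<open>lf a\<close>, \<open>lf b\<close> and \<open>lf m\<close>, and the term
      with \<open>lf m\<close> is exactly its value under the substitution.\<close>
    let ?a = "cross (map3 C b) (map3 C m)" and ?b = "cross (map3 C m) (map3 C a)"
    have P: "cross (map3 C a) (map3 C b) = (C (fst ?P), C (fst (snd ?P)), C (snd (snd ?P)))"
      by (simp add: C3[symmetric]) (simp add: map3_def)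
    note cr = cramer[of E3 "map3 C m" "map3 C a" "map3 C b", unfolded 1 mult_1_right lf_def[symmetric],
        unfolded P E3_def fst_conv snd_conv]
    have "X 0 - sv.ev ?V (X 0) = lf a * fst ?a + lf b * fst ?b"
      unfolding sv.ev_X fst_conv snd_conv by (subst cr(1)) simp
    moreover have "X 1 - sv.ev ?V (X 1) = lf a * fst (snd ?a) + lf b * fst (snd ?b)"
      unfolding sv.ev_X fst_conv snd_conv by (subst cr(2)) simp
    moreover have "X 2 - sv.ev ?V (X 2) = lf a * snd (snd ?a) + lf b * snd (snd ?b)"
      unfolding sv.ev_X fst_conv snd_conv by (subst cr(3)) simp
    ultimately show ?case using exhaust_three[of i] by metis
  next
    case (add p q)
    then obtain u v u' v' where uv: "p - sv.ev ?V p = lf a * u + lf b * v" "q - sv.ev ?V q = lf a * u' + lf b * v'" by blast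
    have "p + q - sv.ev ?V (p + q) = (p - sv.ev ?V p) + (q - sv.ev ?V q)" by simp
    also have "\<dots> = lf a * (u + u') + lf b * (v + v')" unfolding uv by (simp add: algebra_simps)
    finally show ?case by blast
  next
    case (mult p q)
    then obtain u v u' v' where uv: "p - sv.ev ?V p = lf a * u + lf b * v" "q - sv.ev ?V q = lf a * u' + lf b * v'" by blast
    have "p * q - sv.ev ?V (p * q) = (p - sv.ev ?V p) * q + sv.ev ?V p * (q - sv.ev ?V q)" by (simp add: algebra_simps)
    also have "\<dots> = lf a * (u * q + sv.ev ?V p * u') + lf b * (v * q + sv.ev ?V p * v')" unfolding uv by (simp add: algebra_simps)
    finally show ?case by blast
  qed
  then obtain u v where uv: "p - sv.ev ?V p = lf a * u + lf b * v" by blast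
  have "sv.ev ?V p = lf m ^ k * C (cv.ev ?P p)"
    unfolding sv.ev_scaled[OF p(1)] using sv_ev_C[of ?P p] by (simp add: map3_def)
  then have "p = lf a * u + lf b * v" using uv p(2) by simp
  then have "hom_part k p = hom_part k (u * lf a) + hom_part k (v * lf b)" by (metis hom_part_simps(2) mult.commute)
  then have "p = lf a * hom_part (k - 1) u + lf b * hom_part (k - 1) v"
    using Suc by (simp add: hom_part_mult[OF homogeneous_lf(1)] hom_part_homogeneous[OF p(1)] mult.commute)
  then show ?thesis using homogeneous_hom_part by blast
qed

text \<open>Points on the line \<open>n\<close> are encoded by lines \<open>a\<close> crossing \<open>n\<close> there: the point is \<open>cross n a\<close>.\<close>
lemma vanishing_on_line:
  assumes "\<And>a. a \<in> set as \<Longrightarrow> cross n a \<noteq> 0" "sorted_wrt (\<lambda>a b. dot b (cross n a) \<noteq> 0) as"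
    "homogeneous k q" "\<And>a. a \<in> set as \<Longrightarrow> cv.ev (cross n a) q = 0"
  shows "\<exists>u v. q = lf n * u + prod_list (map lf as) * v \<and>
    (if k < length as then v = 0 else homogeneous (k - length as) v)"
  using assms
proof (induction as arbitrary: k q)
  case Nil
  then show ?case by (intro exI[of _ 0] exI[of _ q]) simp
next
  case (Cons a as)
  obtain u0 v0 where q: "q = lf n * u0 + lf a * v0" "homogeneous (k - 1) v0"
    using vanishing_at_point[of n a k q] Cons.prems by auto
  show ?case
  proof (cases k)
    \<comment> \<open>\<open>k - 1\<close> is the right degree only for positive \<open>k\<close>; a
      constant with a zero vanishes.\<close>
    case 0
    then obtain c where "q = C c" using Cons.prems(3) homogeneous_0_imp_C by blast
    then have "q = 0" using Cons.prems(4)[of a] by simp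
    then show ?thesis by (intro exI[of _ 0]) simp
  next
    case (Suc j)
    \<comment> \<open>At the remaining points \<open>lf n\<close> vanishes and \<open>lf a\<close>
      does not, so the zeros of \<open>q\<close> pass to \<open>v0\<close>.\<close>
    have "cv.ev (cross n b) v0 = 0" if "b \<in> set as" for b
    proof -
      have "dot a (cross n b) \<noteq> 0" using Cons.prems(2) that dot_cross_swap[of a n b] by auto
      then show ?thesis using Cons.prems(4)[of b] that by (simp add: q(1))
    qed
    then obtain u v where uv: "v0 = lf n * u + prod_list (map lf as) * v"
      "if j < length as then v = 0 else homogeneous (j - length as) v"
      using Cons.IH[of j v0] Cons.prems(1,2) q(2) Suc by auto
    have "q = lf n * (u0 + lf a * u) + prod_list (map lf (a # as)) * v"
      by (simp add: q(1) uv(1) algebra_simps)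
    with uv(2) Suc show ?thesis by (intro exI conjI) (assumption, auto)
  qed
qed

definition vanishing :: "nat \<Rightarrow> (complex \<times> complex \<times> complex) list \<Rightarrow> S set" where
  "vanishing k Ps = {q \<in> forms k. \<forall>P\<in>set Ps. cv.ev P q = 0}"

lemma fin_dim_vanishing: "vS.fin_dim (vanishing k Ps)"
proof (rule vS.fin_dim_subset[OF fin_dim_forms])
  show "vS.subspace (vanishing k Ps)"
    using subspace_forms[of k] by (auto simp: vS.subspace_def vanishing_def scal_C)
qed (auto simp: vanishing_def)

text \<open>For each \<open>Q\<close> the line \<open>cross Q w\<close> passes through
  \<open>Q\<close> and takes the value 1 at \<open>P\<close>. The product of these lines is filled
  up to degree \<open>k\<close> with powers of a linear form of value 1 at \<open>P\<close>.\<close>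

lemma separating_form:
  assumes "\<And>Q. Q \<in> set Ps \<Longrightarrow> cross P Q \<noteq> 0" "P \<noteq> 0" "length Ps \<le> k"
  obtains q where "q \<in> vanishing k Ps" "cv.ev P q = 1"
proof -
  have "\<exists>q. homogeneous (length Ps) q \<and> (\<forall>Q\<in>set Ps. cv.ev Q q = 0) \<and> cv.ev P q = 1"
    using assms(1)
  proof (induction Ps)
    case Nil
    show ?case by (intro exI[of _ 1]) simp
  next
    case (Cons Q Ps)
    then obtain q where q: "homogeneous (length Ps) q" "\<forall>Q\<in>set Ps. cv.ev Q q = 0" "cv.ev P q = 1" by auto
    obtain w where "dot w (cross P Q) = 1" using dot_eq_1_exists[of "cross P Q"] Cons.prems by auto
    then have "dot (cross Q w) P = 1" by (simp add: dot_cross_rotate)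
    then show ?case
      using q homogeneous_mult[of 1 "lf (cross Q w)" "length Ps" q]
      by (intro exI[of _ "lf (cross Q w) * q"]) auto
  qed
  then obtain q where q: "homogeneous (length Ps) q" "\<forall>Q\<in>set Ps. cv.ev Q q = 0" "cv.ev P q = 1" by blast
  obtain m where m: "dot m P = 1" using dot_eq_1_exists[OF assms(2)] .
  have "homogeneous k (lf m ^ (k - length Ps) * q)"
    by (rule homogeneous_mult'[OF homogeneous_power[OF homogeneous_lf(1)] q(1)]) (use assms(3) in simp)
  then show ?thesis
    by (intro that[of "lf m ^ (k - length Ps) * q"]) (use q m in \<open>auto simp: vanishing_def forms_def\<close>)
qed

lemma linear_ev: "Vector_Spaces.linear scal (*) (cv.ev P)"
  by (auto simp: Vector_Spaces.linear_iff vector_space_scal vector_space_complex scal_C)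

text \<open>A separating form makes evaluation at each further point surjective, so every point
  costs exactly one dimension.\<close>

lemma dim_vanishing:
  assumes "sorted_wrt (\<lambda>P Q. cross P Q \<noteq> 0) Ps" "0 \<notin> set Ps" "length Ps \<le> k + 1"
  shows "vS.dim (vanishing k Ps) + length Ps = (k + 2) choose 2"
  using assms
proof (induction Ps)
  case Nil
  have "vanishing k [] = forms k" by (auto simp: vanishing_def)
  then show ?case by (simp add: dim_forms)
next
  case (Cons P Ps)
  obtain q where q: "q \<in> vanishing k Ps" "cv.ev P q = 1"
    by (rule separating_form[of Ps P k]) (use Cons.prems in auto)
  have "c \<in> cv.ev P ` vanishing k Ps" for c
  proof
    show "c = cv.ev P (scal c q)" by (simp add: scal_C q(2))
    show "scal c q \<in> vanishing k Ps"
      using q(1) fin_dim_vanishing[of k Ps] by (simp add: vS.fin_dim_def vS.subspace_scale)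
  qed
  then have "cv.ev P ` vanishing k Ps = UNIV" by blast
  moreover have "vC.dim (UNIV :: complex set) = 1"
  proof (rule vC.dim_unique[of "{1}"])
    show "UNIV \<subseteq> vC.span {1 :: complex}" by (auto simp: vC.span_singleton)
  qed auto
  moreover have "{q \<in> vanishing k Ps. cv.ev P q = 0} = vanishing k (P # Ps)" by (auto simp: vanishing_def)
  ultimately have "vS.dim (vanishing k Ps) = vS.dim (vanishing k (P # Ps)) + 1"
    using pSC.rank_nullity(2)[OF linear_ev[of P] fin_dim_vanishing[of k Ps]] by simp
  with Cons show ?case by simp
qed

section \<open>Line arrangements\<close>

definition dvd3 :: "S \<Rightarrow> S \<times> S \<times> S \<Rightarrow> bool" where
  "dvd3 p v \<longleftrightarrow> p dvd fst v \<and> p dvd fst (snd v) \<and> p dvd snd (snd v)"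

lemma dvd3_smult3 [simp]: "dvd3 p (smult3 p v)" "dvd3 p v \<Longrightarrow> dvd3 p (smult3 q v)" "p dvd q \<Longrightarrow> dvd3 p (smult3 q v)"
  by (auto simp: dvd3_def smult3_def)
lemma dvd3_0 [simp]: "dvd3 p 0" by (simp add: dvd3_def zero_prod_def)
lemma dvd3_add: "dvd3 p u \<Longrightarrow> dvd3 p v \<Longrightarrow> dvd3 p (u + v)" by (simp add: dvd3_def)
lemma dvd3_mult: "dvd3 q v \<Longrightarrow> dvd3 (p * q) (smult3 p v)" by (auto simp: dvd3_def smult3_def)
lemma dvd3E: assumes "dvd3 p v" obtains u where "v = smult3 p u"
proof -
  from assms obtain a b c where "fst v = p * a" "fst (snd v) = p * b" "snd (snd v) = p * c"
    by (auto simp: dvd3_def dvd_def)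
  then show ?thesis by (intro that[of "(a, b, c)"]) (simp add: smult3_def prod_eq_iff)
qed

lemma cross_smult3 [simp]: "cross u (smult3 c v) = smult3 c (cross u v)" "cross (smult3 c u) v = smult3 c (cross u v)"
  by (simp_all add: cross_def smult3_def algebra_simps)
lemma dot_smult3 [simp]: "dot u (smult3 c v) = c * dot u v" "dot (smult3 c u) v = c * dot u v"
  by (simp_all add: dot_def smult3_def algebra_simps)
lemma dot_add: "dot u (v + w) = dot u v + dot u w" "dot (v + w) u = dot v u + dot w u"
  by (simp_all add: dot_def algebra_simps)
lemma cross_add: "cross u (v + w) = cross u v + cross u w" "cross (v + w) u = cross v u + cross w u"
  by (simp_all add: cross_def algebra_simps)
lemma dot_diff: "dot u (v - w) = dot u v - dot u w" "dot (v - w) u = dot v u - dot w u"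
  by (simp_all add: dot_def algebra_simps)
lemma dot_cross_assoc: "dot u (cross v w) = dot (cross u v) w"
  by (simp add: dot_def cross_def algebra_simps)
lemma smult3_smult3 [simp]: "smult3 c (smult3 d v) = smult3 (c * d) v" by (simp add: smult3_def mult.assoc)
lemma smult3_0 [simp]: "smult3 0 v = 0" by (simp add: smult3_def zero_prod_def)
lemma smult3_1 [simp]: "smult3 1 v = v" by (simp add: smult3_def)
lemma smult3_add: "smult3 c (u + v) = smult3 c u + smult3 c v" by (simp add: smult3_def algebra_simps)

lemma cross_cross: "cross u (cross v w) = smult3 (dot u w) v - smult3 (dot u v) w"
  by (simp add: vec_defs algebra_simps)
lemma cross_cross': "cross (cross u v) w = smult3 (dot u w) v - smult3 (dot v w) u"
  by (simp add: vec_defs algebra_simps)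

lemma scal3_smult3: "scal3 c v = smult3 (C c) v"
  by (simp add: scal3_def smult3_def scal_C split: prod.split)

lemma forms3_iff: "v \<in> forms3 k \<longleftrightarrow> homogeneous k (fst v) \<and> homogeneous k (fst (snd v)) \<and> homogeneous k (snd (snd v))"
  by (cases v) (auto simp: forms3_def forms_def)

abbreviation C3 where "C3 \<equiv> map3 C"

lemma C3_cross: "C3 (cross u v) = cross (C3 u) (C3 v)" by (simp add: vec_defs)
lemma C_dot: "C (dot u v) = dot (C3 u) (C3 v)" by (simp add: vec_defs)
lemma dot_C3_E3 [simp]: "dot (C3 n) E3 = lf n" "dot E3 (C3 n) = lf n"
  by (simp_all add: lf_def dot_commute)
lemma E3_forms3: "E3 \<in> forms3 1" using homogeneous_X by (simp add: forms3_iff E3_def)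
lemma forms3_smult3: "homogeneous j p \<Longrightarrow> v \<in> forms3 k \<Longrightarrow> smult3 p v \<in> forms3 (j + k)"
  by (simp add: forms3_iff smult3_def homogeneous_mult)
lemma homogeneous_dot_C3: "v \<in> forms3 k \<Longrightarrow> homogeneous k (dot (C3 n) v)"
  by (simp add: forms3_iff dot_def map3_def homogeneous_add homogeneous_C_mult)
lemma cross_C3_forms3: "v \<in> forms3 k \<Longrightarrow> cross (C3 n) v \<in> forms3 k"
  by (simp add: forms3_iff cross_def map3_def homogeneous_diff homogeneous_C_mult)
lemma homogeneous_dot: "u \<in> forms3 j \<Longrightarrow> v \<in> forms3 k \<Longrightarrow> homogeneous (j + k) (dot u v)"
  by (simp add: forms3_iff dot_def homogeneous_add homogeneous_mult)
lemma cross_forms3: "u \<in> forms3 j \<Longrightarrow> v \<in> forms3 k \<Longrightarrow> cross u v \<in> forms3 (j + k)"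
  by (simp add: forms3_iff cross_def homogeneous_diff homogeneous_mult)
lemma forms3_add: "u \<in> forms3 k \<Longrightarrow> v \<in> forms3 k \<Longrightarrow> u + v \<in> forms3 k"
  by (simp add: forms3_iff homogeneous_add)
lemma forms3_0 [simp]: "0 \<in> forms3 k" by (simp add: forms3_iff zero_prod_def)

text \<open>Contracting with the Euler field \<open>E3\<close> identifies \<open>AR f\<close> with these one-forms, shifting
  degrees by one; for a line arrangement the condition on them splits into one condition per line.\<close>
definition omega :: "(complex \<times> complex \<times> complex) list \<Rightarrow> nat \<Rightarrow> (S \<times> S \<times> S) set" where
  "omega A k = {w \<in> forms3 k. dot w E3 = 0 \<and> (\<forall>n\<in>set A. dvd3 (lf n) (cross (C3 n) w))}"

text \<open>Representatives in \<open>A\<close> for the points in which \<open>A\<close> meets the line \<open>n\<close>.\<close>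
primrec meets :: "'a :: comm_ring_1 \<times> 'a \<times> 'a \<Rightarrow> ('a \<times> 'a \<times> 'a) list \<Rightarrow> ('a \<times> 'a \<times> 'a) list" where
  "meets n [] = []"
| "meets n (a # A) = (if \<exists>b\<in>set (meets n A). dot a (cross n b) = 0 then meets n A else a # meets n A)"

lemma meets_subset: "set (meets n A) \<subseteq> set A" by (induction A) auto
lemma length_meets: "length (meets n A) \<le> length A" by (induction A) auto
lemma meets_sorted: "sorted_wrt (\<lambda>a b. dot b (cross n a) \<noteq> 0) (meets n A)"
proof (induction A)
  case (Cons a A)
  then show ?case using dot_cross_swap[of a n] by auto
qed simp
lemma meets_cover: "a \<in> set A \<Longrightarrow> \<exists>b\<in>set (meets n A). dot a (cross n b) = 0"
  by (induction A) auto

lemma meets_distinct: "distinct (meets n A)"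
  unfolding distinct_conv_nth
proof (intro allI impI)
  fix i j assume ij: "i < length (meets n A)" "j < length (meets n A)" "i \<noteq> j"
  then have "dot (meets n A ! max i j) (cross n (meets n A ! min i j)) \<noteq> 0"
    using meets_sorted[of n A] unfolding sorted_wrt_iff_nth_less by (simp add: max_def min_def)
  then show "meets n A ! i \<noteq> meets n A ! j" by (metis dot_cross_self(2) max_def min_def)
qed

text \<open>A lower bound for \<open>mdr\<close>: it will turn out that \<open>omega A k\<close> is
  zero for \<open>k \<le> rho A\<close>. The \<open>max\<close> reflects that a further line only
  adds conditions, and \<open>length (meets n A) - 1\<close> is the largest degree in which zeros at
  all these points force a form to vanish on the line.\<close>

primrec rho :: "('a :: comm_ring_1 \<times> 'a \<times> 'a) list \<Rightarrow> nat" where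
  "rho [] = 0"
| "rho (n # A) = max (rho A) (min (length (meets n A) - 1) (rho A + 1))"

text \<open>The Tjurina number of the arrangement. An ordinary \<open>m\<close>-fold point
  contributes \<open>(m - 1)^2\<close>, so a new line through a point of \<open>m\<close> old lines
  adds \<open>2 * m - 1\<close> there; summed over the points of the new line this is
  \<open>2 * length A - length (meets n A)\<close>.\<close>

primrec tau :: "('a :: comm_ring_1 \<times> 'a \<times> 'a) list \<Rightarrow> nat" where
  "tau [] = 0"
| "tau (n # A) = tau A + 2 * length A - length (meets n A)"

definition arrangement :: "('a :: comm_ring_1 \<times> 'a \<times> 'a) list \<Rightarrow> bool" where
  "arrangement A \<longleftrightarrow> 0 \<notin> set A \<and> sorted_wrt (\<lambda>a b. cross a b \<noteq> 0) A"

lemma arrangement_Cons: "arrangement (n # A) \<longleftrightarrow> n \<noteq> 0 \<and> (\<forall>a\<in>set A. cross n a \<noteq> 0) \<and> arrangement A"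
  by (auto simp: arrangement_def)

section \<open>Restriction of one-forms to a line and deletion of the line\<close>

lemma dot_eq_1_exists':
  fixes v :: "'a :: field \<times> 'a \<times> 'a"
  assumes "v \<noteq> 0" obtains e where "dot v e = 1"
  using dot_eq_1_exists[OF assms] dot_commute by metis

lemma eq_0_if_cross_eq_0:
  fixes v :: "'a :: field \<times> 'a \<times> 'a"
  assumes "cross a v = 0" "cross b v = 0" "cross a b \<noteq> 0" shows "v = 0"
proof (rule ccontr)
  assume v: "v \<noteq> 0"
  have "cross v a = 0" "cross v b = 0" using assms(1,2) cross_eq_0_commute by blast+
  then obtain c d where "a = smult3 c v" "b = smult3 d v" using parallel_if_cross_eq_0 v by metis
  then show False using assms(3) by simp
qed

text \<open>At the intersection of two lines the value of \<open>w\<close> is parallel to two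
  independent vectors, hence zero.\<close>

lemma omega_restrict_vanishes:
  assumes w: "w \<in> omega (n # A) k" and a: "a \<in> set A" "cross n a \<noteq> 0"
  shows "cv.ev (cross n a) (dot (C3 e) w) = 0"
proof -
  let ?h = "cv.ev (cross n a)"
  have h: "cross m (map3 ?h w) = 0" if "m \<in> set (n # A)" "dot m (cross n a) = 0" for m
  proof -
    have "dvd3 (lf m) (cross (C3 m) w)" using w that(1) unfolding omega_def by blast
    then obtain u where "cross (C3 m) w = smult3 (lf m) u" by (rule dvd3E)
    then have "map3 ?h (cross (C3 m) w) = map3 ?h (smult3 (lf m) u)" by simp
    then show ?thesis using that(2) by (simp add: vec_defs zero_prod_def)
  qed
  have "map3 ?h w = 0" by (rule eq_0_if_cross_eq_0[OF h h a(2)]) (use a in auto)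
  then show ?thesis by (simp add: vec_defs zero_prod_def)
qed

text \<open>Along the line, \<open>w\<close> is a multiple of \<open>n\<close> with factor
  \<open>dot (C3 e) w\<close>. If this factor vanishes there as well, all coefficients of
  \<open>w\<close> are divisible by \<open>lf n\<close>; the other lines are coprime to
  \<open>lf n\<close>, so their conditions pass to the quotient.\<close>

lemma omega_deletion:
  assumes w: "w \<in> omega (n # A) k" and arr: "arrangement (n # A)" and e: "dot n e = 1"
    and d: "lf n dvd dot (C3 e) w"
  obtains w' where "w = smult3 (lf n) w'" "w' \<in> omega A (k - 1)"
proof -
  have n: "n \<noteq> 0" using arr by (simp add: arrangement_Cons)
  have "dvd3 (lf n) (cross (C3 n) w)" using w by (simp add: omega_def)
  then obtain u where u: "cross (C3 n) w = smult3 (lf n) u" by (rule dvd3E)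
  obtain q where q: "dot (C3 e) w = lf n * q" using d by (rule dvdE)
  have "cross (cross (C3 n) w) (C3 e) = w - smult3 (dot (C3 e) w) (C3 n)"
    unfolding cross_cross' C_dot[symmetric] by (simp add: e dot_commute[of w])
  then have "w = smult3 (lf n) (cross u (C3 e) + smult3 q (C3 n))"
    unfolding u q by (simp add: smult3_add algebra_simps)
  then obtain w' where w': "w = smult3 (lf n) w'" by blast
  have "w' \<in> omega A (k - 1)" unfolding omega_def
  proof (intro CollectI conjI ballI)
    show "w' \<in> forms3 (k - 1)"
      using w homogeneous_lf_cancel[of k n] n by (auto simp: omega_def w' forms3_iff smult3_def)
    show "dot w' E3 = 0" using w n by (simp add: omega_def w')
    fix m assume m: "m \<in> set A"
    then have "dvd3 (lf m) (smult3 (lf n) (cross (C3 m) w'))" using w by (simp add: omega_def w')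
    moreover have "prime_elem (lf m)" "\<not> lf m dvd lf n"
      using m arr lf_dvd_lf_iff[of m n] cross_eq_0_commute[of m n] prime_lf[of m]
      by (auto simp: arrangement_def)
    ultimately show "dvd3 (lf m) (cross (C3 m) w')"
      by (simp add: dvd3_def smult3_def prime_elem_dvd_mult_iff)
  qed
  with w' show ?thesis by (rule that)
qed

lemma omega_eq_0:
  assumes "arrangement A" "k \<le> rho A" "w \<in> omega A k" shows "w = 0"
  using assms
proof (induction A arbitrary: k w)
  case Nil
  obtain a b c where "w = (C a, C b, C c)"
    using Nil(2,3) homogeneous_0_imp_C by (cases w) (simp add: omega_def forms3_iff, metis)
  then have "w = C3 (a, b, c)" by (simp add: map3_def)
  moreover from this have "(a, b, c) = 0" using Nil(3) by (simp add: omega_def)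
  ultimately show ?case by (simp add: map3_def zero_prod_def)
next
  case (Cons n A)
  have w': "w \<in> omega A k" using Cons.prems(3) by (simp add: omega_def)
  have arr: "arrangement A" "n \<noteq> 0" "\<And>a. a \<in> set A \<Longrightarrow> cross n a \<noteq> 0" using Cons.prems(1) by (auto simp: arrangement_Cons)
  \<comment> \<open>The two arguments of \<open>max\<close> in \<open>rho\<close>: either the bound
    for \<open>A\<close> applies directly, as \<open>w\<close> also belongs to
    \<open>omega A k\<close>, or the new line carries more than \<open>k\<close> meeting
    points.\<close>
  show ?case
  proof (cases "k \<le> rho A")
    case True then show ?thesis using Cons.IH[OF arr(1) _ w'] by blast
  next
    case False
    then have k: "k < length (meets n A)" "k - 1 \<le> rho A" "0 < k" using Cons.prems(2) by auto
    obtain e where e: "dot n e = 1" using dot_eq_1_exists'[OF arr(2)] .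
    have "homogeneous k (dot (C3 e) w)" using w' by (intro homogeneous_dot_C3) (simp add: omega_def)
    moreover have "cv.ev (cross n a) (dot (C3 e) w) = 0" if "a \<in> set (meets n A)" for a
      using omega_restrict_vanishes[OF Cons.prems(3), of a e] that meets_subset[of n A] arr(3) by blast
    ultimately have "\<exists>u v. dot (C3 e) w = lf n * u + prod_list (map lf (meets n A)) * v \<and>
       (if k < length (meets n A) then v = 0 else homogeneous (k - length (meets n A)) v)"
      using meets_subset[of n A] arr(3) by (intro vanishing_on_line meets_sorted) auto
    then have "lf n dvd dot (C3 e) w" using k(1) by auto
    then obtain v where "w = smult3 (lf n) v" "v \<in> omega A (k - 1)"
      using omega_deletion[OF Cons.prems(3,1) e] by blast
    then show ?thesis using Cons.IH[OF arr(1) k(2)] by auto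
  qed
qed

text \<open>Restricted to the line \<open>n\<close>, the two products are binary forms without a
  common zero, and the degree is large enough for them to generate. Repetitions within
  \<open>as\<close> and \<open>bs\<close> are allowed, so that powers of a linear form are
  covered.\<close>

lemma coprime_split:
  assumes "\<And>a. a \<in> set as \<Longrightarrow> cross n a \<noteq> 0" "\<And>a b. a \<in> set as \<Longrightarrow> b \<in> set bs \<Longrightarrow> dot b (cross n a) \<noteq> 0"
    "length as + length bs \<le> j" "homogeneous j v"
  shows "\<exists>u v1 v2. v = lf n * u + prod_list (map lf as) * v1 + prod_list (map lf bs) * v2 \<and>
    homogeneous (j - length as) v1 \<and> homogeneous (j - length bs) v2"
  using assms
proof (induction as)
  case Nil
  then show ?case by (intro exI[of _ 0] exI[of _ v]) simp
next
  case (Cons a as)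
  then obtain u v1 v2 where IH: "v = lf n * u + prod_list (map lf as) * v1 + prod_list (map lf bs) * v2"
    "homogeneous (j - length as) v1" "homogeneous (j - length bs) v2" by force
  let ?P = "cross n a" and ?B = "prod_list (map lf bs)"
  obtain m where m: "dot m ?P = 1" using dot_eq_1_exists[of ?P] Cons.prems(1) by auto
  have B: "cv.ev ?P ?B \<noteq> 0" using Cons.prems(2)[of a] by (auto simp: prod_list_zero_iff)
  \<comment> \<open>\<open>?B * z\<close> has the degree of \<open>v1\<close> and the same value at
    \<open>?P\<close>; hence the difference is divisible by \<open>lf a\<close> on the line, and
    \<open>?B * z\<close> can be moved into the other summand.\<close>
  define z where "z = C (cv.ev ?P v1 / cv.ev ?P ?B) * lf m ^ (j - length as - length bs)"
  have z: "homogeneous (j - length as - length bs) z"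
    unfolding z_def using homogeneous_power[OF homogeneous_lf(1), of "j - length as - length bs" m]
    by (intro homogeneous_C_mult) simp
  then have "homogeneous (j - length as) (?B * z)"
    using Cons.prems(3) by (intro homogeneous_mult'[OF homogeneous_prod_lf]) auto
  then have h1: "homogeneous (j - length as) (v1 - ?B * z)" using IH(2) by (rule homogeneous_diff[rotated])
  have h2: "cv.ev ?P (v1 - ?B * z) = 0" using B m by (simp add: z_def del: cv.ev_prod_list)
  have na: "?P \<noteq> 0" using Cons.prems(1) by simp
  obtain x y where xy: "v1 - ?B * z = lf n * x + lf a * y" "homogeneous (j - length as - 1) y"
    using vanishing_at_point[OF na h1 h2] by blast
  have "homogeneous (j - length bs) (prod_list (map lf as) * z)"
    using Cons.prems(3) z by (intro homogeneous_mult'[OF homogeneous_prod_lf]) auto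
  then have "homogeneous (j - length bs) (v2 + prod_list (map lf as) * z)"
    using IH(3) by (rule homogeneous_add[rotated])
  moreover have "v = lf n * (u + prod_list (map lf as) * x) + prod_list (map lf (a # as)) * y
      + ?B * (v2 + prod_list (map lf as) * z)"
  proof -
    have "v1 = lf n * x + lf a * y + ?B * z" using xy(1) by (simp add: algebra_simps)
    then show ?thesis unfolding IH(1) by (simp add: algebra_simps)
  qed
  moreover have "homogeneous (j - length (a # as)) y" using xy(2) by simp
  ultimately show ?case by blast
qed

text \<open>Think of \<open>gd j v\<close> as membership of the form \<open>v\<close> of degree \<open>j\<close> in a graded ideal containing \<open>lf n\<close>.
  The lines in \<open>g b\<close>, for different \<open>b\<close>, meet the line \<open>n\<close> in different points.\<close>
lemma omitted_products_generate:
  fixes gd :: "nat \<Rightarrow> S \<Rightarrow> bool" and g :: "complex \<times> complex \<times> complex \<Rightarrow> (complex \<times> complex \<times> complex) list"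
  assumes "\<And>k p q. gd k p \<Longrightarrow> gd k q \<Longrightarrow> gd k (p + q)"
    "\<And>j k p q. gd k p \<Longrightarrow> homogeneous j q \<Longrightarrow> gd (j + k) (q * p)"
    "\<And>k p. gd k (lf n * p)"
    "\<And>b a. b \<in> set bs \<Longrightarrow> a \<in> set (g b) \<Longrightarrow> cross n a \<noteq> 0"
    "\<And>b b' a a'. b \<in> set bs \<Longrightarrow> b' \<in> set bs \<Longrightarrow> b \<noteq> b' \<Longrightarrow> a \<in> set (g b) \<Longrightarrow> a' \<in> set (g b') \<Longrightarrow> dot a' (cross n a) \<noteq> 0"
    "distinct bs" "bs \<noteq> []"
    "\<And>b. b \<in> set bs \<Longrightarrow> gd (length (concat (map g (remove1 b bs)))) (prod_list (map lf (concat (map g (remove1 b bs)))))"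
  shows "\<exists>K. \<forall>j\<ge>K. \<forall>v. homogeneous j v \<longrightarrow> gd j v"
  using assms(7,6,1-5,8)
proof (induction bs arbitrary: gd rule: list_nonempty_induct)
  case (single b)
  have "gd 0 1" using single.prems(7)[of b] by simp
  then have "gd j v" if "homogeneous j v" for j v using single.prems(3)[of 0 1 j v] that by simp
  then show ?case by blast
next
  case (cons b bs)
  let ?l = "length (g b)" and ?p = "prod_list (map lf (g b))"
  let ?G = "concat (map g bs)"
  \<comment> \<open>The colon ideal by the product of the block \<open>g b\<close>. A product
    omitting the block of \<open>c\<close> from \<open>b # bs\<close> is \<open>?p\<close> times the
    one omitting it from \<open>bs\<close>, so the colon ideal satisfies the hypotheses for
    \<open>bs\<close>.\<close>
  define gd' where "gd' j v = gd (j + ?l) (?p * v)" for j v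
  have "\<exists>K. \<forall>j\<ge>K. \<forall>v. homogeneous j v \<longrightarrow> gd' j v"
  proof (rule cons.IH)
    show "gd' k (p + q)" if "gd' k p" "gd' k q" for k p q
      using cons.prems(2)[of "k + ?l" "?p * p" "?p * q"] that by (simp add: gd'_def algebra_simps)
    show "gd' (j + k) (q * p)" if "gd' k p" "homogeneous j q" for j k p q
      using cons.prems(3)[of "k + ?l" "?p * p" j q] that by (simp add: gd'_def algebra_simps)
    show "gd' k (lf n * p)" for k p
      using cons.prems(4)[of "k + ?l" "?p * p"] by (simp add: gd'_def algebra_simps)
    show "cross n a \<noteq> 0" if "c \<in> set bs" "a \<in> set (g c)" for c a
      using cons.prems(5)[of c a] that by simp
    show "dot a' (cross n a) \<noteq> 0" if "c \<in> set bs" "c' \<in> set bs" "c \<noteq> c'" "a \<in> set (g c)" "a' \<in> set (g c')" for c c' a a'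
      using cons.prems(6)[of c c' a a'] that by simp
    show "distinct bs" using cons.prems(1) by simp
    show "gd' (length (concat (map g (remove1 c bs)))) (prod_list (map lf (concat (map g (remove1 c bs)))))"
      if "c \<in> set bs" for c
    proof -
      have "c \<noteq> b" using that cons.prems(1) by auto
      then show ?thesis using cons.prems(7)[of c] that by (simp add: gd'_def add.commute)
    qed
  qed
  then obtain K where K: "\<And>j v. K \<le> j \<Longrightarrow> homogeneous j v \<Longrightarrow> gd' j v" by blast
  have G: "gd (length ?G) (prod_list (map lf ?G))" using cons.prems(7)[of b] by simp
  \<comment> \<open>Multiples of \<open>?p\<close> in large degree are covered by the colon ideal,
    and \<open>?G\<close> gives the product that omits the block of \<open>b\<close>.\<close>
  have "gd j v" if j: "K + ?l + length ?G \<le> j" and v: "homogeneous j v" for j v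
  proof -
    have "\<exists>u v1 v2. v = lf n * u + ?p * v1 + prod_list (map lf ?G) * v2 \<and>
      homogeneous (j - ?l) v1 \<and> homogeneous (j - length ?G) v2"
    proof (rule coprime_split)
      show "cross n a \<noteq> 0" if "a \<in> set (g b)" for a using cons.prems(5)[of b a] that by simp
      show "dot a' (cross n a) \<noteq> 0" if a: "a \<in> set (g b)" "a' \<in> set ?G" for a a'
      proof -
        obtain c where "c \<in> set bs" "a' \<in> set (g c)" using a(2) by auto
        moreover from this have "c \<noteq> b" using cons.prems(1) by auto
        ultimately show ?thesis using cons.prems(6)[of b c a a'] a(1) by auto
      qed
    qed (use j v in simp_all)
    then obtain u v1 v2 where uv: "v = lf n * u + ?p * v1 + prod_list (map lf ?G) * v2"
      "homogeneous (j - ?l) v1" "homogeneous (j - length ?G) v2" by blast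
    have "gd j (?p * v1)" using K[of "j - ?l" v1] uv(2) j by (simp add: gd'_def)
    moreover have "gd j (v2 * prod_list (map lf ?G))" using cons.prems(3)[OF G uv(3)] j by simp
    ultimately show ?thesis unfolding uv(1) using cons.prems(2,4) by (simp add: mult.commute)
  qed
  then show ?case by blast
qed

lemma prod_lf_congruent:
  assumes "mset as = mset bs" shows "prod_list (map lf as) = prod_list (map lf bs)"
  using assms by (metis mset_map prod_mset_prod_list)

lemma filter_classes:
  assumes "distinct bs" "\<And>a. a \<in> set A \<Longrightarrow> \<exists>!b. b \<in> set bs \<and> P a b"
  shows "mset (concat (map (\<lambda>b. filter (\<lambda>a. P a b) A) bs)) = mset A"
  using assms(2)
proof (induction A)
  case (Cons a A)
  then obtain b where b: "b \<in> set bs" "P a b" "\<And>c. c \<in> set bs \<Longrightarrow> P a c \<Longrightarrow> c = b" by (metis list.set_intros(1))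
  have "mset (concat (map (\<lambda>b. filter (\<lambda>a. P a b) (a # A)) cs)) = (if b \<in> set cs then {#a#} else {#})
      + mset (concat (map (\<lambda>b. filter (\<lambda>a. P a b) A) cs))" if "set cs \<subseteq> set bs" "distinct cs" for cs
    using that b(3) b(2) by (induction cs) auto
  from this[OF order.refl assms(1)] show ?case using Cons b(1) by simp
qed (induction bs; simp)

lemma dvd_prod_list: "p \<in> set ps \<Longrightarrow> p dvd prod_list (ps :: 'a :: comm_semiring_1 list)"
  by (induction ps) auto

text \<open>A linear relation between three points of the line \<open>n\<close>. It makes meeting
  \<open>n\<close> in the same point a transitive relation.\<close>

lemma dot_cross_cross: "smult3 (dot c (cross n b)) (cross n a) =
    smult3 (dot a (cross n b)) (cross n c) - smult3 (dot a (cross n c)) (cross n b)"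
  by (simp add: vec_defs algebra_simps)

lemma meets_pairwise:
  assumes "b \<in> set (meets n A)" "c \<in> set (meets n A)" "b \<noteq> c" shows "dot c (cross n b) \<noteq> 0"
proof -
  obtain i j where ij: "i < length (meets n A)" "j < length (meets n A)" "b = meets n A ! i" "c = meets n A ! j"
    using assms(1,2) by (metis in_set_conv_nth)
  with assms(3) consider "i < j" | "j < i" by fastforce
  then show ?thesis
    using meets_sorted[of n A] ij dot_cross_swap[of c n b] unfolding sorted_wrt_iff_nth_less by cases auto
qed

lemma omega_add: "v \<in> omega A k \<Longrightarrow> w \<in> omega A k \<Longrightarrow> v + w \<in> omega A k"
  by (simp add: omega_def forms3_add dot_add cross_add dvd3_add)
lemma omega_smult3: "w \<in> omega A k \<Longrightarrow> homogeneous j p \<Longrightarrow> smult3 p w \<in> omega A (j + k)"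
  by (simp add: omega_def forms3_smult3)
lemma omega_0 [simp]: "0 \<in> omega A k" by (simp add: omega_def)

text \<open>The constant vector field with value \<open>P\<close> annihilates all linear forms
  vanishing at \<open>P\<close>; multiplied by the remaining lines it becomes tangent to the whole
  arrangement. Contraction with the Euler field adds one to the degree.\<close>

lemma omega_point:
  "smult3 (prod_list (map lf (filter (\<lambda>a. dot a P \<noteq> 0) A))) (cross (C3 P) E3)
     \<in> omega A (length (filter (\<lambda>a. dot a P \<noteq> 0) A) + 1)"
  (is "smult3 ?f ?c \<in> omega A (?l + 1)")
  unfolding omega_def
proof (intro CollectI conjI ballI)
  show "smult3 ?f ?c \<in> forms3 (?l + 1)"
    by (intro forms3_smult3 homogeneous_prod_lf cross_C3_forms3 E3_forms3)
  show "dot (smult3 ?f ?c) E3 = 0" by simp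
  fix m assume m: "m \<in> set A"
  show "dvd3 (lf m) (cross (C3 m) (smult3 ?f ?c))"
  proof (cases "dot m P = 0")
    case True
    then have "cross (C3 m) ?c = smult3 (lf m) (C3 P)"
      unfolding cross_cross C_dot[symmetric] by (simp add: smult3_def zero_prod_def)
    then show ?thesis by (simp add: mult.commute)
  next
    case False
    then have "lf m dvd ?f" using m by (intro dvd_prod_list) auto
    then show ?thesis by simp
  qed
qed

text \<open>The restrictions form an ideal on the line, to which every point
  \<open>cross n b\<close> contributes an element via \<open>omega_point\<close>. Up to the common
  factor given by one line per point, these elements are products that each omit one block of lines,
  and such products generate everything in large degrees.\<close>

lemma omega_restrict_surj:
  assumes arr: "arrangement (n # A)" and e: "dot n e = 1"
  shows "\<exists>K. \<forall>k\<ge>K. \<forall>q\<in>vanishing k (map (cross n) (meets n A)). \<exists>w\<in>omega (n # A) k. lf n dvd q - dot (C3 e) w"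
proof -
  define gd where "gd k q \<longleftrightarrow> (\<exists>w\<in>omega (n # A) k. lf n dvd q - dot (C3 e) w)" for k q
  have gd_add: "gd k (p + q)" if "gd k p" "gd k q" for k p q
  proof -
    from that obtain v w where "v \<in> omega (n # A) k" "w \<in> omega (n # A) k"
      "lf n dvd p - dot (C3 e) v" "lf n dvd q - dot (C3 e) w" by (auto simp: gd_def)
    moreover have "p + q - dot (C3 e) (v + w) = (p - dot (C3 e) v) + (q - dot (C3 e) w)" by (simp add: dot_add)
    ultimately show ?thesis unfolding gd_def by (metis dvd_add omega_add)
  qed
  have gd_mult: "gd (j + k) (q * p)" if "gd k p" "homogeneous j q" for j k p q
  proof -
    from that obtain w where "w \<in> omega (n # A) k" "lf n dvd p - dot (C3 e) w" by (auto simp: gd_def)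
    moreover have "q * p - dot (C3 e) (smult3 q w) = q * (p - dot (C3 e) w)" by (simp add: algebra_simps)
    ultimately show ?thesis unfolding gd_def using that(2) by (metis dvd_mult omega_smult3)
  qed
  have gd_lf: "gd k (lf n * p)" for k p unfolding gd_def by (intro bexI[of _ 0]) auto
  have gd_point: "gd (length (filter (\<lambda>a. dot a (cross n b) \<noteq> 0) A) + 1)
      (prod_list (map lf (filter (\<lambda>a. dot a (cross n b) \<noteq> 0) A)) * lf b)" for b
  proof -
    let ?F = "filter (\<lambda>a. dot a (cross n b) \<noteq> 0) A"
    let ?f = "prod_list (map lf ?F)"
    let ?w = "smult3 ?f (cross (C3 (cross n b)) E3)"
    have "?w \<in> omega (n # A) (length ?F + 1)"
      using omega_point[of "cross n b" "n # A"] by simp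
    \<comment> \<open>Modulo \<open>lf n\<close>, contracting \<open>?w\<close> with
      \<open>e\<close> gives \<open>- ?f * lf b\<close>; the scalar -1 corrects the sign.\<close>
    then have "smult3 (C (-1)) ?w \<in> omega (n # A) (0 + (length ?F + 1))" by (rule omega_smult3) simp
    moreover have "?f * lf b - dot (C3 e) (smult3 (C (-1)) ?w) = lf n * (?f * C (dot e b))"
    proof -
      have "dot (C3 e) (cross (C3 (cross n b)) E3) = dot (cross (C3 e) (cross (C3 n) (C3 b))) E3"
        unfolding C3_cross by (rule dot_cross_assoc)
      also have "\<dots> = C (dot e b) * lf n - C (dot e n) * lf b"
        unfolding cross_cross C_dot by (simp add: dot_diff)
      finally have D: "dot (C3 e) (cross (C3 (cross n b)) E3) = C (dot e b) * lf n - lf b"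
        using e by (simp add: dot_commute[of e n])
      show ?thesis unfolding dot_smult3 D by (simp add: algebra_simps)
    qed
    ultimately show ?thesis unfolding gd_def by (intro bexI[of _ "smult3 (C (-1)) ?w"]) auto
  qed
  let ?M = "meets n A"
  have arr': "n \<noteq> 0" "\<And>a. a \<in> set A \<Longrightarrow> cross n a \<noteq> 0" using arr by (auto simp: arrangement_Cons)
  show ?thesis
  proof (cases "A = []")
    case True
    \<comment> \<open>Without lines there is no condition on \<open>b\<close>: the unit vectors give
      the three variables, and Euler's relation then gives every form of positive degree.\<close>
    have "gd k q" if q: "homogeneous k q" and k: "1 \<le> k" for k q
    proof -
      have "gd 1 (X 0)" "gd 1 (X 1)" "gd 1 (X 2)"
        using gd_point[of "(1, 0, 0)"] gd_point[of "(0, 1, 0)"] gd_point[of "(0, 0, 1)"]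
        by (simp_all add: True lf_eq)
      then have "gd (k - 1 + 1) (pd 0 q * X 0 + pd 1 q * X 1 + pd 2 q * X 2)"
        using homogeneous_pd[OF q] by (intro gd_add gd_mult)
      then have "gd (0 + k) (C (1 / of_nat k) * (of_nat k * q))"
        using k euler[OF q] by (intro gd_mult) (simp_all add: mult.commute)
      moreover have "C (1 / of_nat k) * (of_nat k * q) = q"
      proof -
        have "C (1 / of_nat k) * of_nat k = C (1 / of_nat k * of_nat k)" by (simp only: C_simps C_of_nat)
        also have "\<dots> = 1" using k by simp
        finally show ?thesis by (simp add: mult.assoc[symmetric])
      qed
      ultimately show ?thesis by simp
    qed
    then show ?thesis unfolding gd_def vanishing_def forms_def by (intro exI[of _ 1]) auto
  next
    case False
    then have ne: "?M \<noteq> []" using meets_cover[OF hd_in_set, of A n] by auto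
    have uniq: "b = c" if "b \<in> set ?M" "c \<in> set ?M" "a \<in> set A" "dot a (cross n b) = 0" "dot a (cross n c) = 0" for a b c
    proof (rule ccontr)
      assume "b \<noteq> c"
      then have "dot c (cross n b) \<noteq> 0" using meets_pairwise that(1,2) by blast
      then show False using dot_cross_cross[of c n b a] that(4,5) arr'(2)[OF that(3)] by simp
    qed
    define cl where "cl b = filter (\<lambda>a. dot a (cross n b) = 0) A" for b
    define g where "g b = remove1 b (cl b)" for b
    have MA: "b \<in> set A" if "b \<in> set ?M" for b using meets_subset that by blast
    have g_set: "a \<in> set A" "dot a (cross n b) = 0" if "a \<in> set (g b)" for a b
      using that notin_set_remove1[of a "cl b" b] by (auto simp: g_def cl_def)
    have mset_cl: "mset (concat (map cl bs)) = mset bs + mset (concat (map g bs))" if "set bs \<subseteq> set ?M" for bs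
      using that
    proof (induction bs)
      case (Cons b bs)
      then have "b \<in> set (cl b)" using MA by (simp add: cl_def)
      then have "mset (cl b) = add_mset b (mset (g b))" by (simp add: g_def)
      with Cons show ?case by simp
    qed simp
    \<comment> \<open>The lines of \<open>A\<close> that miss the point of \<open>b\<close>,
      together with \<open>b\<close>, are one representative for each point plus the blocks
      \<open>g c\<close> of all other points. The representatives are the same for every
      \<open>b\<close>, which yields the common factor.\<close>
    have main: "mset (?M @ concat (map g (remove1 b ?M))) = mset (filter (\<lambda>a. dot a (cross n b) \<noteq> 0) A @ [b])"
      if b: "b \<in> set ?M" for b
    proof -
      let ?F = "filter (\<lambda>a. dot a (cross n b) \<noteq> 0) A" and ?R = "remove1 b ?M"
      have R: "set ?R = set ?M - {b}" by (rule set_remove1_eq[OF meets_distinct])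
      have "mset (concat (map (\<lambda>c. filter (\<lambda>a. dot a (cross n c) = 0) ?F) ?R)) = mset ?F"
      proof (rule filter_classes)
        show "distinct ?R" by (simp add: meets_distinct)
        fix a assume a: "a \<in> set ?F"
        then obtain c where c: "c \<in> set ?M" "dot a (cross n c) = 0" using meets_cover[of a A n] by auto
        show "\<exists>!c. c \<in> set ?R \<and> dot a (cross n c) = 0"
        proof (rule ex1I[of _ c])
          have "c \<noteq> b" using a c(2) by auto
          then show "c \<in> set ?R \<and> dot a (cross n c) = 0" using c unfolding R by simp
          fix d assume d: "d \<in> set ?R \<and> dot a (cross n d) = 0"
          then show "d = c" using uniq[of d c a] c a unfolding R by simp
        qed
      qed
      also have "map (\<lambda>c. filter (\<lambda>a. dot a (cross n c) = 0) ?F) ?R = map cl ?R"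
      proof (rule map_cong[OF refl])
        fix c assume c: "c \<in> set ?R"
        have "dot x (cross n b) \<noteq> 0" if "x \<in> set A" "dot x (cross n c) = 0" for x
          using uniq[of b c x] b c that unfolding R by blast
        then show "filter (\<lambda>a. dot a (cross n c) = 0) ?F = cl c"
          unfolding cl_def filter_filter by (intro filter_cong[OF refl]) blast
      qed
      finally have F: "mset ?F = mset ?R + mset (concat (map g ?R))" using mset_cl[of ?R] R by auto
      have M: "mset ?M = add_mset b (mset ?R)" using b by simp
      show ?thesis unfolding mset_append F M by simp
    qed
    \<comment> \<open>The common factor, one line per point of \<open>n\<close>, is divided
      out.\<close>
    define gd' where "gd' j v = gd (j + length ?M) (prod_list (map lf ?M) * v)" for j v
    have "\<exists>K. \<forall>j\<ge>K. \<forall>v. homogeneous j v \<longrightarrow> gd' j v"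
    proof (rule omitted_products_generate[where bs = ?M and n = n and g = g])
      show "gd' k (p + q)" if "gd' k p" "gd' k q" for k p q
        using gd_add that by (simp add: gd'_def distrib_left)
      show "gd' (j + k) (q * p)" if "gd' k p" "homogeneous j q" for j k p q
        using gd_mult that by (simp add: gd'_def mult.left_commute add.assoc)
      show "gd' k (lf n * p)" for k p
        using gd_lf by (simp add: gd'_def mult.left_commute)
      show "cross n a \<noteq> 0" if "a \<in> set (g b)" for a b using g_set(1)[OF that] arr'(2) by blast
      show "dot a' (cross n a) \<noteq> 0"
        if "b \<in> set ?M" "b' \<in> set ?M" "b \<noteq> b'" and a: "a \<in> set (g b)" "a' \<in> set (g b')" for b b' a a'
      proof
        assume "dot a' (cross n a) = 0"
        then have "dot a (cross n a') = 0" using dot_cross_swap[of a n a'] by simp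
        moreover have "dot a' (cross n b) \<noteq> 0" using uniq[OF that(1,2)] that(3) g_set[OF a(2)] by blast
        ultimately show False
          using dot_cross_cross[of a' n b a] g_set[OF a(1)] arr'(2)[of a] by simp
      qed
      show "distinct ?M" "?M \<noteq> []" by (rule meets_distinct, rule ne)
      show "gd' (length (concat (map g (remove1 b ?M)))) (prod_list (map lf (concat (map g (remove1 b ?M)))))"
        if b: "b \<in> set ?M" for b
      proof -
        let ?G = "concat (map g (remove1 b ?M))" and ?F = "filter (\<lambda>a. dot a (cross n b) \<noteq> 0) A"
        have "prod_list (map lf (?M @ ?G)) = prod_list (map lf (?F @ [b]))"
          by (rule prod_lf_congruent[OF main[OF b]])
        moreover have "length (?M @ ?G) = length (?F @ [b])" by (rule mset_eq_length[OF main[OF b]])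
        ultimately show ?thesis using gd_point[of b] by (simp add: gd'_def add.commute)
      qed
    qed
    then obtain K where K: "\<And>j v. K \<le> j \<Longrightarrow> homogeneous j v \<Longrightarrow> gd' j v" by blast
    have "gd k q" if k: "K + length ?M \<le> k" and q: "q \<in> vanishing k (map (cross n) ?M)" for k q
    proof -
      have "\<exists>u v. q = lf n * u + prod_list (map lf ?M) * v \<and>
        (if k < length ?M then v = 0 else homogeneous (k - length ?M) v)"
        using q arr'(2) MA by (intro vanishing_on_line meets_sorted) (auto simp: vanishing_def forms_def)
      then obtain u v where uv: "q = lf n * u + prod_list (map lf ?M) * v" "homogeneous (k - length ?M) v"
        using k by auto
      then have "gd k (prod_list (map lf ?M) * v)" using K[of "k - length ?M" v] k by (simp add: gd'_def)
      then show ?thesis unfolding uv(1) using gd_add gd_lf by blast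
    qed
    then show ?thesis by (auto simp: gd_def)
  qed
qed

section \<open>Dimensions of the spaces of one-forms\<close>

lemma subspace_omega: "vS3.subspace (omega A k)"
  unfolding vS3.subspace_def using omega_add omega_smult3[where j = 0] by (auto simp: scal3_smult3)

lemma fin_dim_omega: "vS3.fin_dim (omega A k)"
  by (rule vS3.fin_dim_subset[OF fin_dim_forms3 subspace_omega]) (auto simp: omega_def)

lemma linear3I:
  assumes "\<And>v w. f (v + w) = f v + f w" "\<And>c v. f (smult3 (C c) v) = C c * f v"
  shows "Vector_Spaces.linear scal3 scal f"
  using assms by (simp add: Vector_Spaces.linear_iff vector_space_scal vector_space_scal3 scal_C scal3_smult3)

lemma linear33I:
  assumes "\<And>v w. f (v + w) = f v + f w" "\<And>c v. f (smult3 (C c) v) = smult3 (C c) (f v)"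
  shows "Vector_Spaces.linear scal3 scal3 f"
  using assms by (simp add: Vector_Spaces.linear_iff vector_space_scal3 scal3_smult3)

lemma linearSI:
  assumes "\<And>v w. f (v + w) = f v + f w" "\<And>c v. f (C c * v) = C c * f v"
  shows "Vector_Spaces.linear scal scal f"
  using assms by (simp add: Vector_Spaces.linear_iff vector_space_scal scal_C)

definition grad :: "S \<Rightarrow> S \<times> S \<times> S" where "grad f = (pd 0 f, pd 1 f, pd 2 f)"

lemma grad_forms3: "homogeneous d f \<Longrightarrow> grad f \<in> forms3 (d - 1)"
  using homogeneous_pd[of d f] by (simp add: grad_def forms3_iff)

lemma dot_grad_E3: "homogeneous d f \<Longrightarrow> dot (grad f) E3 = of_nat d * f"
  using euler[of d f] by (simp add: grad_def E3_def dot_def mult.commute)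

lemma grad_mult: "grad (p * q) = smult3 p (grad q) + smult3 q (grad p)"
  by (simp add: grad_def smult3_def pd_mult algebra_simps)

lemma grad_lf: "grad (lf n) = C3 n" by (simp add: grad_def lf_eq map3_def)

lemma C_inverse_of_nat: "0 < d \<Longrightarrow> C (1 / of_nat d) * of_nat d = 1"
proof -
  assume d: "0 < d"
  have "C (1 / of_nat d) * of_nat d = C (1 / of_nat d * of_nat d)" by (simp only: C_simps C_of_nat)
  then show ?thesis using d by simp
qed

text \<open>By Euler's relation, contraction with the Euler field maps \<open>forms3 k\<close> onto
  \<open>forms (k + 1)\<close>; its kernel is \<open>omega [] k\<close>.\<close>

lemma dim_omega_Nil: "vS3.dim (omega [] k) + ((k + 3) choose 2) = 3 * ((k + 2) choose 2)"
proof -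
  let ?f = "\<lambda>w. dot w E3"
  have lin: "Vector_Spaces.linear scal3 scal ?f" by (rule linear3I) (simp_all add: dot_add)
  have "?f ` forms3 k = forms (k + 1)"
  proof (intro subset_antisym subsetI)
    fix q assume "q \<in> forms (k + 1)"
    then have q: "homogeneous (k + 1) q" by (simp add: forms_def)
    let ?w = "smult3 (C (1 / of_nat (k + 1))) (grad q)"
    have "?f ?w = C (1 / of_nat (k + 1)) * of_nat (k + 1) * q"
      using dot_grad_E3[OF q] by (simp only: dot_smult3 mult.assoc)
    then have "?f ?w = q" by (simp only: C_inverse_of_nat) simp
    moreover have "?w \<in> forms3 (0 + k)"
      using grad_forms3[OF q] by (intro forms3_smult3) auto
    ultimately show "q \<in> ?f ` forms3 k" by force
  qed (use homogeneous_dot[OF _ E3_forms3] in \<open>auto simp: forms_def\<close>)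
  moreover have "{w \<in> forms3 k. ?f w = 0} = omega [] k" by (auto simp: omega_def)
  ultimately show ?thesis
    using p3S.rank_nullity(2)[OF lin fin_dim_forms3[of k]] by (simp add: dim_forms dim_forms3 numeral_3_eq_3)
qed

text \<open>Restriction to the line has kernel \<open>lf n\<close> times
  \<open>omega A (k - 1)\<close>. For large \<open>k\<close> its image consists of all forms of
  degree \<open>k\<close> on the line with zeros at the meeting points, a space of dimension
  \<open>k + 1 - length (meets n A)\<close>.\<close>

lemma dim_omega_Cons:
  assumes arr: "arrangement (n # A)"
  shows "\<exists>K. \<forall>k\<ge>K. vS3.dim (omega (n # A) k) + length (meets n A) = vS3.dim (omega A (k - 1)) + k + 1"
proof -
  let ?M = "meets n A"
  let ?P = "map (cross n) ?M"
  have arr': "n \<noteq> 0" "\<And>a. a \<in> set A \<Longrightarrow> cross n a \<noteq> 0" using arr by (auto simp: arrangement_Cons)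
  obtain e where e: "dot n e = 1" using dot_eq_1_exists'[OF arr'(1)] .
  obtain K where K: "\<And>k q. K \<le> k \<Longrightarrow> q \<in> vanishing k ?P \<Longrightarrow> \<exists>w\<in>omega (n # A) k. lf n dvd q - dot (C3 e) w"
    using omega_restrict_surj[OF arr e] by blast
  let ?phi = "\<lambda>w. proj n e (dot (C3 e) w)"
  have "vS3.dim (omega (n # A) k) + length ?M = vS3.dim (omega A (k - 1)) + k + 1"
    if k: "K + length ?M + 1 \<le> k" for k
  proof -
    have lin: "Vector_Spaces.linear scal3 scal ?phi" by (rule linear3I) (simp_all add: dot_add)
    have linp: "Vector_Spaces.linear scal scal (proj n e)" by (rule linearSI) simp_all
    have lins: "Vector_Spaces.linear scal3 scal3 (smult3 (lf n))"
      by (rule linear33I) (simp_all add: smult3_add mult.commute)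
    have linm: "Vector_Spaces.linear scal scal ((*) (lf n))"
      by (rule linearSI) (simp_all add: algebra_simps)
    have "{w \<in> omega (n # A) k. ?phi w = 0} = smult3 (lf n) ` omega A (k - 1)"
    proof (intro subset_antisym subsetI)
      fix w assume "w \<in> {w \<in> omega (n # A) k. ?phi w = 0}"
      then have w: "w \<in> omega (n # A) k" "lf n dvd dot (C3 e) w" using lf_dvd_iff[OF e] by auto
      then show "w \<in> smult3 (lf n) ` omega A (k - 1)" using omega_deletion[OF w(1) arr e w(2)] by blast
    next
      fix w assume "w \<in> smult3 (lf n) ` omega A (k - 1)"
      then obtain v where v: "w = smult3 (lf n) v" "v \<in> omega A (k - 1)" by blast
      have "w \<in> omega A (1 + (k - 1))" unfolding v(1) by (rule omega_smult3[OF v(2)]) simp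
      then have "w \<in> omega (n # A) k" using k by (simp add: omega_def v(1))
      moreover have "?phi w = 0" using proj_lf[OF e] by (simp add: v(1))
      ultimately show "w \<in> {w \<in> omega (n # A) k. ?phi w = 0}" by simp
    qed
    moreover have "vS3.dim (smult3 (lf n) ` omega A (k - 1)) = vS3.dim (omega A (k - 1))"
      by (rule p33.dim_image_inj[OF lins fin_dim_omega]) (use arr' in auto)
    ultimately have 1: "vS3.dim (omega (n # A) k) = vS3.dim (omega A (k - 1)) + vS.dim (?phi ` omega (n # A) k)"
      using p3S.rank_nullity(2)[OF lin fin_dim_omega] by simp
    have "?phi ` omega (n # A) k = proj n e ` vanishing k ?P"
    proof (intro subset_antisym subsetI)
      fix p assume "p \<in> ?phi ` omega (n # A) k"
      then obtain w where w: "w \<in> omega (n # A) k" "p = ?phi w" by blast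
      have "homogeneous k (dot (C3 e) w)" by (rule homogeneous_dot_C3) (use w(1) in \<open>simp add: omega_def\<close>)
      moreover have "cv.ev (cross n a) (dot (C3 e) w) = 0" if "a \<in> set ?M" for a
        using omega_restrict_vanishes[OF w(1)] meets_subset arr'(2) that by blast
      ultimately have "dot (C3 e) w \<in> vanishing k ?P" by (simp add: vanishing_def forms_def)
      then show "p \<in> proj n e ` vanishing k ?P" using w(2) by blast
    next
      fix p assume "p \<in> proj n e ` vanishing k ?P"
      then obtain q where q: "q \<in> vanishing k ?P" "p = proj n e q" by blast
      then obtain w where w: "w \<in> omega (n # A) k" "lf n dvd q - dot (C3 e) w" using K[of k q] k by auto
      then have "?phi w = p" using lf_dvd_iff[OF e, of "q - dot (C3 e) w"] q(2) by simp
      with w(1) show "p \<in> ?phi ` omega (n # A) k" by blast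
    qed
    moreover have "{q \<in> vanishing k ?P. proj n e q = 0} = (*) (lf n) ` forms (k - 1)"
    proof (intro subset_antisym subsetI)
      fix q assume "q \<in> {q \<in> vanishing k ?P. proj n e q = 0}"
      then have q: "homogeneous k q" "lf n dvd q" by (auto simp: lf_dvd_iff[OF e] vanishing_def forms_def)
      then obtain p where "q = lf n * p" by blast
      moreover from this have "homogeneous (k - 1) p" using homogeneous_lf_cancel[of k n p] q(1) arr'(1) by simp
      ultimately show "q \<in> (*) (lf n) ` forms (k - 1)" by (auto simp: forms_def)
    next
      fix q assume "q \<in> (*) (lf n) ` forms (k - 1)"
      then obtain p where p: "q = lf n * p" "homogeneous (k - 1) p" by (auto simp: forms_def)
      have "homogeneous k q" unfolding p(1) by (rule homogeneous_mult'[OF homogeneous_lf(1) p(2)]) (use k in simp)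
      then show "q \<in> {q \<in> vanishing k ?P. proj n e q = 0}"
        by (auto simp: vanishing_def forms_def p(1) lf_dvd_iff[OF e, symmetric])
    qed
    moreover have "vS.dim ((*) (lf n) ` forms (k - 1)) = vS.dim (forms (k - 1))"
      by (rule pSS.dim_image_inj[OF linm fin_dim_forms]) (use arr' in auto)
    ultimately have 2: "vS.dim (vanishing k ?P) = vS.dim (forms (k - 1)) + vS.dim (?phi ` omega (n # A) k)"
      using pSS.rank_nullity(2)[OF linp fin_dim_vanishing] by simp
    have "cross (cross n a) (cross n b) \<noteq> 0" if "dot b (cross n a) \<noteq> 0" for a b
    proof -
      have "cross (cross n a) (cross n b) = smult3 (- dot a (cross n b)) n"
        unfolding cross_cross' by (simp add: smult3_def prod_eq_iff zero_prod_def)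
      then show ?thesis using that arr'(1) dot_cross_swap[of b n a] by simp
    qed
    then have "sorted_wrt (\<lambda>P Q. cross P Q \<noteq> 0) ?P"
      unfolding sorted_wrt_map by (rule sorted_wrt_mono_rel[OF _ meets_sorted])
    moreover have "0 \<notin> set ?P" using meets_subset[of n A] arr'(2) by fastforce
    ultimately have "vS.dim (vanishing k ?P) + length ?M = (k + 2) choose 2"
      using dim_vanishing[of ?P k] k by simp
    moreover have "(k + 2) choose 2 = k + 1 + ((k - 1 + 2) choose 2)"
      using k by (cases k) (simp_all add: numeral_2_eq_2)
    ultimately show ?thesis using 1 2 by (simp add: dim_forms)
  qed
  then show ?thesis by blast
qed

lemma choose_2_int: "2 * int (n choose 2) = int n * (int n - 1)"
  by (induction n) (auto simp: numeral_2_eq_2 algebra_simps)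

text \<open>Written without subtraction, this is the count for syzygies of degree
  \<open>k - 1\<close>: triples of forms of that degree, minus the part of the Jacobian ideal in
  degree \<open>k + length A - 2\<close>, whose codimension is \<open>tau A\<close>. The increments
  of \<open>dim_omega_Cons\<close> match those of the binomial coefficients and of
  \<open>tau\<close>.\<close>

lemma dim_omega:
  assumes "arrangement A"
  shows "\<exists>K. \<forall>k\<ge>K. vS3.dim (omega A k) + ((k + length A) choose 2) = 3 * ((k + 1) choose 2) + tau A"
  using assms
proof (induction A)
  case Nil
  have "vS3.dim (omega [] k) + (k choose 2) = 3 * ((k + 1) choose 2)" for k
  proof -
    have "2 * int (vS3.dim (omega [] k)) + 2 * int ((k + 3) choose 2) = 3 * (2 * int ((k + 2) choose 2))"
      using dim_omega_Nil[of k] by linarith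
    then have "2 * int (vS3.dim (omega [] k)) + 2 * int (k choose 2) = 3 * (2 * int ((k + 1) choose 2))"
      unfolding choose_2_int by (simp add: algebra_simps)
    then show ?thesis by linarith
  qed
  then show ?case by simp
next
  case (Cons n A)
  then obtain K where K: "\<And>k. K \<le> k \<Longrightarrow> vS3.dim (omega A k) + ((k + length A) choose 2) = 3 * ((k + 1) choose 2) + tau A"
    by (auto simp: arrangement_Cons)
  obtain L where L: "\<And>k. L \<le> k \<Longrightarrow> vS3.dim (omega (n # A) k) + length (meets n A) = vS3.dim (omega A (k - 1)) + k + 1"
    using dim_omega_Cons[OF Cons.prems] by blast
  have "vS3.dim (omega (n # A) k) + ((k + length (n # A)) choose 2) = 3 * ((k + 1) choose 2) + tau (n # A)"
    if k: "K + L + 1 \<le> k" for k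
  proof -
    define j where "j = k - 1"
    have j: "k = j + 1" using k unfolding j_def by linarith
    have Kj: "K \<le> j" using k unfolding j_def by linarith
    have "2 * int (vS3.dim (omega A j)) + 2 * int ((j + length A) choose 2) = 3 * (2 * int ((j + 1) choose 2)) + 2 * int (tau A)"
      using K[OF Kj] by linarith
    then have 1: "2 * int (vS3.dim (omega A j)) = 3 * (int j + 1) * int j + 2 * int (tau A) - (int j + int (length A)) * (int j + int (length A) - 1)"
      unfolding choose_2_int by (simp add: algebra_simps)
    have 2: "2 * int (vS3.dim (omega (n # A) k)) + 2 * int (length (meets n A)) = 2 * int (vS3.dim (omega A j)) + 2 * int k + 2"
      using L[of k] k j by simp
    have 3: "int (tau (n # A)) = int (tau A) + 2 * int (length A) - int (length (meets n A))"
      using length_meets[of n A] by simp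
    have "2 * int (vS3.dim (omega (n # A) k)) + 2 * int ((k + length (n # A)) choose 2)
       = 3 * (2 * int ((k + 1) choose 2)) + 2 * int (tau (n # A))"
      unfolding choose_2_int 3 using 1 2 j by (simp add: algebra_simps)
    then show ?thesis by linarith
  qed
  then show ?case by blast
qed

section \<open>Syzygies, the Jacobian ideal and one-forms\<close>

definition syz :: "S \<Rightarrow> nat \<Rightarrow> (S \<times> S \<times> S) set" where
  "syz f j = {v \<in> forms3 j. dot v (grad f) = 0}"

lemma mdr_eqI:
  assumes "v \<in> syz f r" "v \<noteq> 0" "\<And>k v. k < r \<Longrightarrow> v \<in> syz f k \<Longrightarrow> v = 0"
  shows "mdr f = r"
proof -
  have syz: "(a, b, c) \<in> AR f \<and> (a, b, c) \<noteq> (0, 0, 0) \<and> homogeneous k a \<and> homogeneous k b \<and> homogeneous k c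
    \<longleftrightarrow> (a, b, c) \<in> syz f k \<and> (a, b, c) \<noteq> 0" for a b c k
    by (auto simp: AR_def syz_def forms3_iff dot_def grad_def zero_prod_def)
  show ?thesis unfolding mdr_def syz
  proof (rule Least_equality)
    show "\<exists>a b c. (a, b, c) \<in> syz f r \<and> (a, b, c) \<noteq> 0" using assms(1,2) by (cases v) blast
    show "r \<le> k" if "\<exists>a b c. (a, b, c) \<in> syz f k \<and> (a, b, c) \<noteq> 0" for k
      using that assms(3) by (meson not_le)
  qed
qed

lemma linear_dot: "Vector_Spaces.linear scal3 scal (\<lambda>v. dot v g)"
  by (rule linear3I) (simp_all add: dot_add)

lemma subspace_jacobian_ideal: "vS.subspace (jacobian_ideal f)"
proof -
  have "jacobian_ideal f = (\<lambda>v. dot v (grad f)) ` UNIV"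
    unfolding jacobian_ideal_def image_def by (auto simp: dot_def grad_def)
  then show ?thesis
    using p3S.linear_subspace_image[OF linear_dot vS3.subspace_UNIV] by metis
qed

text \<open>As the partial derivatives are homogeneous of degree \<open>d - 1\<close>, the
  coefficients in a representation can be cut down to their components of degree
  \<open>j\<close>.\<close>

lemma jacobian_ideal_forms:
  assumes f: "homogeneous d f" and d: "0 < d"
  shows "forms (j + d - 1) \<inter> jacobian_ideal f = (\<lambda>v. dot v (grad f)) ` forms3 j"
proof (intro subset_antisym subsetI)
  fix p assume p: "p \<in> forms (j + d - 1) \<inter> jacobian_ideal f"
  then obtain a b c where abc: "p = a * pd 0 f + b * pd 1 f + c * pd 2 f" by (auto simp: jacobian_ideal_def)
  have "hom_part (j + d - 1) (a * pd i f) = hom_part j a * pd i f" for a i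
    using hom_part_mult[OF homogeneous_pd[OF f], of "j + d - 1" a i] d by simp
  then have "p = dot (hom_part j a, hom_part j b, hom_part j c) (grad f)"
    using p hom_part_homogeneous[of "j + d - 1" p "j + d - 1"]
    by (simp add: forms_def abc dot_def grad_def)
  then show "p \<in> (\<lambda>v. dot v (grad f)) ` forms3 j"
    by (intro image_eqI[of _ _ "(hom_part j a, hom_part j b, hom_part j c)"]) (auto simp: forms3_iff)
next
  fix p assume "p \<in> (\<lambda>v. dot v (grad f)) ` forms3 j"
  then obtain v where v: "p = dot v (grad f)" "v \<in> forms3 j" by blast
  have "homogeneous (j + (d - 1)) p" unfolding v(1) by (rule homogeneous_dot[OF v(2) grad_forms3[OF f]])
  then show "p \<in> forms (j + d - 1) \<inter> jacobian_ideal f"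
    using d v(1) by (auto simp: forms_def jacobian_ideal_def dot_def grad_def)
qed

lemma dim_jacobian_ideal:
  assumes f: "homogeneous d f" and d: "0 < d"
  shows "vS.dim (forms (j + d - 1) \<inter> jacobian_ideal f) + vS3.dim (syz f j) = 3 * ((j + 2) choose 2)"
  unfolding jacobian_ideal_forms[OF assms] syz_def
  using p3S.rank_nullity(2)[OF linear_dot[of "grad f"] fin_dim_forms3[of j]] by (simp add: dim_forms3)

lemma tjurina_number_eqI:
  assumes "\<And>k. K \<le> k \<Longrightarrow> vS.dim (forms k) = vS.dim (forms k \<inter> jacobian_ideal f) + t"
  shows "tjurina_number f = t"
  unfolding tjurina_number_def forms_def[symmetric]
proof (rule the_equality)
  show "\<forall>\<^sub>F k in sequentially. quotient_dim (forms k) (jacobian_ideal f) t"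
    unfolding eventually_sequentially
    using quotient_dim_if[OF fin_dim_forms subspace_jacobian_ideal] assms by blast
  fix s assume "\<forall>\<^sub>F k in sequentially. quotient_dim (forms k) (jacobian_ideal f) s"
  then obtain L where L: "\<And>k. L \<le> k \<Longrightarrow> quotient_dim (forms k) (jacobian_ideal f) s"
    unfolding eventually_sequentially by blast
  show "s = t"
    using quotient_dim_imp[OF fin_dim_forms subspace_jacobian_ideal L[of "K + L"]] assms[of "K + L"] by simp
qed

abbreviation lines :: "(complex \<times> complex \<times> complex) list \<Rightarrow> S" where
  "lines A \<equiv> prod_list (map lf A)"

lemma lines_neq_0: "arrangement A \<Longrightarrow> lines A \<noteq> 0"
  by (auto simp: prod_list_zero_iff arrangement_def)

lemma arrangement_split:
  assumes "arrangement (as @ n # bs)"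
  shows "n \<noteq> 0" "\<And>m. m \<in> set (as @ bs) \<Longrightarrow> cross n m \<noteq> 0" "\<not> lf n dvd lines (as @ bs)"
proof -
  show n: "n \<noteq> 0" using assms by (auto simp: arrangement_def)
  show c: "cross n m \<noteq> 0" if "m \<in> set (as @ bs)" for m
    using assms that cross_eq_0_commute[of n m] by (auto simp: arrangement_def sorted_wrt_append)
  show "\<not> lf n dvd lines (as @ bs)" using lf_dvd_prod_lf_imp[of n "as @ bs"] n c by blast
qed

text \<open>By the Leibniz rule the cross product is a sum over the lines \<open>n\<close>, with
  \<open>cross (C3 n) w\<close> multiplied by the product of the other lines.\<close>

lemma grad_lines_cross:
  assumes "\<And>n. n \<in> set A \<Longrightarrow> dvd3 (lf n) (cross (C3 n) w)"
  shows "dvd3 (lines A) (cross (grad (lines A)) w)"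
  using assms
proof (induction A)
  case Nil
  then show ?case by (simp add: dvd3_def)
next
  case (Cons n A)
  have "cross (grad (lines (n # A))) w = smult3 (lf n) (cross (grad (lines A)) w) + smult3 (lines A) (cross (C3 n) w)"
    by (simp add: grad_mult grad_lf cross_add)
  moreover have "dvd3 (lf n * lines A) (smult3 (lf n) (cross (grad (lines A)) w))"
    using Cons by (intro dvd3_mult) simp
  moreover have "dvd3 (lines A * lf n) (smult3 (lines A) (cross (C3 n) w))"
    using Cons.prems by (intro dvd3_mult) simp
  ultimately show ?case by (simp add: dvd3_add mult.commute)
qed

text \<open>A derivation that kills the product must map each linear factor to a multiple of itself,
  since the other factors are coprime to it. Along the line, the double cross product with
  \<open>C3 n\<close> then vanishes.\<close>

lemma syz_imp_omega:
  assumes arr: "arrangement A" and v: "v \<in> syz (lines A) j"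
  shows "cross v E3 \<in> omega A (j + 1)"
  unfolding omega_def
proof (intro CollectI conjI ballI)
  show "cross v E3 \<in> forms3 (j + 1)" using v E3_forms3 by (intro cross_forms3) (simp add: syz_def)
  show "dot (cross v E3) E3 = 0" by simp
  fix n assume "n \<in> set A"
  then obtain as bs where A: "A = as @ n # bs" by (meson split_list)
  let ?g = "lines (as @ bs)"
  have f: "lines A = lf n * ?g" by (simp add: A algebra_simps)
  have "dot v (grad (lines A)) = lf n * dot v (grad ?g) + ?g * dot v (C3 n)"
    unfolding f grad_mult grad_lf by (simp add: dot_add)
  then have "lf n dvd ?g * dot v (C3 n)"
    using v by (simp add: syz_def) (metis add_eq_0_iff dvd_minus_iff dvd_triv_left)
  then have "lf n dvd dot v (C3 n)"
    using arrangement_split[OF arr[unfolded A]] prime_lf prime_elem_dvd_mult_iff by blast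
  then have "lf n dvd dot (C3 n) v" by (simp add: dot_commute)
  moreover have "cross (C3 n) (cross v E3) = smult3 (lf n) v + smult3 (dot (C3 n) v) (smult3 (-1) E3)"
    unfolding cross_cross by (simp add: smult3_def)
  ultimately show "dvd3 (lf n) (cross (C3 n) (cross v E3))" by (simp add: dvd3_add)
qed

text \<open>\<open>cross v E3 = 0\<close> makes \<open>v\<close> proportional to the Euler field,
  which multiplies \<open>f\<close> by \<open>d\<close> instead of killing it.\<close>

lemma syz_eq_0:
  assumes f: "homogeneous d f" "0 < d" "f \<noteq> 0" and v: "v \<in> syz f j" "cross v E3 = 0"
  shows "v = 0"
proof -
  have "cross (grad f) (cross v E3) = smult3 (of_nat d * f) v - smult3 (dot (grad f) v) E3"
    unfolding cross_cross dot_grad_E3[OF f(1)] ..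
  then have "smult3 (of_nat d * f) v = 0" using v by (simp add: syz_def dot_commute)
  then show ?thesis using f by simp
qed

text \<open>The inverse of the contraction: \<open>cross (grad f) w\<close> is divisible by
  \<open>f\<close>, and the quotient over the number of lines is the syzygy. A further cross product
  with \<open>E3\<close> returns \<open>w\<close>, because \<open>w\<close> annihilates the Euler
  field.\<close>

lemma omega_imp_syz:
  assumes arr: "arrangement A" and ne: "A \<noteq> []" and w: "w \<in> omega A (j + 1)"
  shows "\<exists>v\<in>syz (lines A) j. cross v E3 = w"
proof -
  let ?f = "lines A" and ?d = "length A"
  have f: "homogeneous ?d ?f" "?f \<noteq> 0" "0 < ?d" using homogeneous_prod_lf lines_neq_0[OF arr] ne by auto
  have w': "dot w E3 = 0" "w \<in> forms3 (j + 1)" "\<And>n. n \<in> set A \<Longrightarrow> dvd3 (lf n) (cross (C3 n) w)"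
    using w by (auto simp: omega_def)
  obtain u where u: "cross (grad ?f) w = smult3 ?f u" using grad_lines_cross[OF w'(3)] by (rule dvd3E)
  let ?v = "smult3 (C (1 / of_nat ?d)) u"
  have "u \<in> forms3 j"
  proof -
    have "smult3 ?f u \<in> forms3 (?d - 1 + (j + 1))"
      unfolding u[symmetric] by (rule cross_forms3[OF grad_forms3[OF f(1)] w'(2)])
    moreover have "homogeneous j p" if "homogeneous (?d - 1 + (j + 1)) (?f * p)" for p
      using homogeneous_cancel(1)[OF f(1,2) that] f(3) by (cases "p = 0") auto
    ultimately show ?thesis by (simp add: forms3_iff smult3_def)
  qed
  then have "?v \<in> forms3 (0 + j)" by (intro forms3_smult3) simp_all
  moreover have "?f * dot u (grad ?f) = 0"
    using u by (metis dot_cross_self(3) dot_smult3(2))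
  ultimately have "?v \<in> syz ?f j" using f(2) by (simp add: syz_def)
  moreover have "cross ?v E3 = w"
  proof -
    have "smult3 ?f (cross u E3) = cross (cross (grad ?f) w) E3" by (simp add: u)
    also have "\<dots> = smult3 ?f (smult3 (of_nat ?d) w)"
      unfolding cross_cross' dot_grad_E3[OF f(1)] w'(1) by (simp add: mult.commute)
    finally have "smult3 ?f (cross u E3 - smult3 (of_nat ?d) w) = 0"
      by (simp add: smult3_def zero_prod_def prod_eq_iff)
    then have "cross u E3 = smult3 (of_nat ?d) w" using f(2) by simp
    then show ?thesis by (simp add: C_inverse_of_nat[OF f(3)])
  qed
  ultimately show ?thesis by blast
qed

lemma dim_syz_lines:
  assumes arr: "arrangement A" and ne: "A \<noteq> []"
  shows "vS3.dim (syz (lines A) j) = vS3.dim (omega A (j + 1))"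
proof -
  have f: "homogeneous (length A) (lines A)" "0 < length A" "lines A \<noteq> 0"
    using homogeneous_prod_lf lines_neq_0[OF arr] ne by auto
  have fd: "vS3.fin_dim (syz (lines A) j)" unfolding syz_def
    by (rule vS3.fin_dim_subset[OF fin_dim_forms3 p3S.subspace_kernel[OF linear_dot subspace_forms3] Collect_subset])
  have lin: "Vector_Spaces.linear scal3 scal3 (\<lambda>v. cross v E3)"
    by (rule linear33I) (simp_all add: cross_add)
  have "(\<lambda>v. cross v E3) ` syz (lines A) j = omega A (j + 1)"
    using syz_imp_omega[OF arr] omega_imp_syz[OF arr ne] by blast
  then show ?thesis using p33.dim_image_inj[OF lin fd syz_eq_0[OF f]] by simp
qed

lemma tjurina_number_lines:
  assumes arr: "arrangement A" and ne: "A \<noteq> []"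
  shows "tjurina_number (lines A) = tau A"
proof -
  let ?d = "length A"
  have f: "homogeneous ?d (lines A)" "0 < ?d" using homogeneous_prod_lf ne by auto
  obtain K where K: "\<And>k. K \<le> k \<Longrightarrow> vS3.dim (omega A k) + ((k + ?d) choose 2) = 3 * ((k + 1) choose 2) + tau A"
    using dim_omega[OF arr] by blast
  show ?thesis
  proof (rule tjurina_number_eqI[of "K + ?d"])
    fix k assume k: "K + ?d \<le> k"
    define j where "j = k + 1 - ?d"
    have j: "j + ?d - 1 = k" "j + 1 + ?d = k + 2" "K \<le> j + 1" using k f(2) by (auto simp: j_def)
    show "vS.dim (forms k) = vS.dim (forms k \<inter> jacobian_ideal (lines A)) + tau A"
      using dim_jacobian_ideal[OF f, of j, unfolded j(1)] dim_syz_lines[OF arr ne, of j] K[OF j(3), unfolded j(2)]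
      by (simp add: dim_forms)
  qed
qed

text \<open>The point \<open>P\<close> supplies a syzygy of degree \<open>r\<close>, and
  \<open>rho\<close> excludes smaller degrees: a syzygy of degree \<open>k < r\<close> corresponds
  to a one-form of degree \<open>k + 1 \<le> rho A\<close>.\<close>

lemma mdr_lines:
  assumes arr: "arrangement A" and ne: "A \<noteq> []" and P: "P \<noteq> 0"
    and r: "rho A = r" "length (filter (\<lambda>a. dot a P \<noteq> 0) A) = r"
  shows "mdr (lines A) = r"
proof -
  have f: "homogeneous (length A) (lines A)" "0 < length A" "lines A \<noteq> 0"
    using homogeneous_prod_lf lines_neq_0[OF arr] ne by auto
  let ?g = "lines (filter (\<lambda>a. dot a P \<noteq> 0) A)"
  let ?w = "smult3 ?g (cross (C3 P) E3)"
  have "?w \<in> omega A (r + 1)" using omega_point[of P A] r(2) by simp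
  then obtain v where v: "v \<in> syz (lines A) r" "cross v E3 = ?w" using omega_imp_syz[OF arr ne] by blast
  have "?w \<noteq> 0"
  proof
    assume "?w = 0"
    moreover have "?g \<noteq> 0" using arr by (auto simp: prod_list_zero_iff arrangement_def)
    ultimately have c: "cross (C3 P) E3 = 0" by simp
    have "cross P Q = 0" for Q
    proof -
      have "map3 (cv.ev Q) (cross (C3 P) E3) = 0" unfolding c by (simp add: map3_def zero_prod_def)
      then show ?thesis by (simp add: vec_defs E3_def zero_prod_def)
    qed
    from this[of "(1, 0, 0)"] this[of "(0, 1, 0)"] show False
      using P by (simp add: cross_def prod_eq_iff zero_prod_def)
  qed
  with v(2) have "v \<noteq> 0" by auto
  show ?thesis
  proof (rule mdr_eqI[OF v(1) \<open>v \<noteq> 0\<close>])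
    fix k u assume "k < r" and u: "u \<in> syz (lines A) k"
    then have "cross u E3 = 0" using omega_eq_0[OF arr _ syz_imp_omega[OF arr u]] r(1) by simp
    then show "u = 0" by (rule syz_eq_0[OF f u])
  qed
qed

text \<open>Stands in for unique factorisation: the primes can be cancelled one by one against the
  cofactor of \<open>p\<close>.\<close>

lemma unit_if_no_prime_dvd:
  fixes p :: "'a :: idom"
  assumes "\<And>q. q \<in> set qs \<Longrightarrow> prime_elem q" "p dvd prod_list qs" "\<And>q. q \<in> set qs \<Longrightarrow> \<not> q dvd p"
  shows "p dvd 1"
  using assms
proof (induction qs)
  case (Cons q qs)
  obtain r where r: "q * prod_list qs = p * r" using Cons.prems(2) by auto
  then have "q dvd p * r" by (metis dvd_triv_left)
  then have "q dvd r" using Cons.prems(1,3) prime_elem_dvd_mult_iff by (metis list.set_intros(1))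
  then obtain s where "r = q * s" by blast
  moreover have "q \<noteq> 0" using Cons.prems(1)[of q] by auto
  ultimately have "prod_list qs = p * s" using r by simp
  then show ?case using Cons by simp
qed simp

lemma squarefree_lines: assumes arr: "arrangement A" shows "squarefree (lines A)"
  unfolding squarefree_def
proof (intro allI impI)
  fix x assume x: "x\<^sup>2 dvd lines A"
  show "x dvd 1"
  proof (rule unit_if_no_prime_dvd[of "map lf A"])
    show "prime_elem q" if "q \<in> set (map lf A)" for q
    proof -
      from that obtain n where n: "n \<in> set A" "q = lf n" by (metis in_set_conv_nth length_map nth_map nth_mem)
      then have "n \<noteq> 0" using arr unfolding arrangement_def by metis
      then show ?thesis using n(2) prime_lf by simp
    qed
    show "x dvd lines A" using x by (metis dvd_mult_left power2_eq_square)
    fix q assume "q \<in> set (map lf A)"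
    then obtain n as bs where q: "q = lf n" and A: "A = as @ n # bs" by (auto dest: split_list)
    show "\<not> q dvd x"
    proof
      assume "q dvd x"
      then have "q * q dvd x * x" by (intro mult_dvd_mono)
      then have "lf n * lf n dvd lines A" using x unfolding q power2_eq_square by (rule dvd_trans)
      moreover have "lines A = lf n * lines (as @ bs)" by (simp add: A algebra_simps)
      ultimately have "lf n dvd lines (as @ bs)" using arrangement_split(1)[OF arr[unfolded A]] by simp
      then show False using arrangement_split(3)[OF arr[unfolded A]] by blast
    qed
  qed
qed

lemma line_arrangement_lines: assumes arr: "arrangement A" shows "line_arrangement (lines A)"
  unfolding line_arrangement_def
proof (intro exI[of _ "length A"] exI[of _ "\<lambda>i. lf (A ! i)"] conjI allI impI)
  show "homogeneous 1 (lf (A ! i))" for i by simp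
  show nz: "lf (A ! i) \<noteq> 0" if "i < length A" for i using arr nth_mem[OF that] unfolding arrangement_def by (metis lf_eq_0)
  show "lines A = (\<Prod>i<length A. lf (A ! i))" by (simp add: prod.list_conv_set_nth atLeast0LessThan)
  fix i j assume ij: "i < length A" "j < length A" "i \<noteq> j"
  then have c: "cross (A ! i) (A ! j) \<noteq> 0"
    using arr cross_eq_0_commute[of "A ! i" "A ! j"] unfolding arrangement_def sorted_wrt_iff_nth_less
    by (metis linorder_neqE_nat)
  have "A ! i \<noteq> 0" using nz[OF ij(1)] by auto
  then have "\<not> lf (A ! i) dvd lf (A ! j)" by (rule lf_dvd_lf_iff[OF _ c])
  then show "\<nexists>c. lf (A ! j) = scal c (lf (A ! i))" by (auto simp: scal_C)
qed

lemma maximal_tjurina_lines: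
  assumes "arrangement A" "A \<noteq> []" "P \<noteq> 0" "rho A = r" "length (filter (\<lambda>a. dot a P \<noteq> 0) A) = r"
    "int (tau A) = tau_max (length A) r"
  shows "maximal_tjurina_curve (length A) r (lines A)"
  using assms squarefree_lines[OF assms(1)] tjurina_number_lines[OF assms(1,2)] mdr_lines[OF assms(1-5)]
    homogeneous_prod_lf[of A]
  by (simp add: maximal_tjurina_curve_def reduced_plane_curve_def)

section \<open>Chebyshev curves\<close>

lemma interpolation:
  assumes "sorted_wrt (\<lambda>P Q. cross P Q \<noteq> 0) Ps" "0 \<notin> set Ps" "length Ps \<le> k"
  shows "\<exists>g. homogeneous k g \<and> (\<forall>P\<in>set Ps. cv.ev P g = val P)"
  using assms
proof (induction Ps)
  case Nil
  show ?case by (intro exI[of _ 0]) simp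
next
  case (Cons P Ps)
  then obtain g where g: "homogeneous k g" "\<forall>Q\<in>set Ps. cv.ev Q g = val Q" by auto
  obtain q where q: "q \<in> vanishing k Ps" "cv.ev P q = 1"
    by (rule separating_form[of Ps P k]) (use Cons.prems in auto)
  let ?g = "g + C (val P - cv.ev P g) * q"
  have "homogeneous k ?g"
    using g(1) q(1) by (intro homogeneous_add homogeneous_C_mult) (auto simp: vanishing_def forms_def)
  moreover have "cv.ev Q ?g = val Q" if "Q \<in> set (P # Ps)" for Q
    using that g(2) q by (cases "Q = P") (auto simp: vanishing_def)
  ultimately show ?case by blast
qed

lemma lines_dvd:
  assumes "arrangement A" "\<And>n. n \<in> set A \<Longrightarrow> lf n dvd q" shows "lines A dvd q"
  using assms
proof (induction A arbitrary: q)
  case (Cons n A)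
  from Cons.prems(2)[of n] obtain r where r: "q = lf n * r" by auto
  have "lf m dvd r" if "m \<in> set A" for m
  proof -
    have "m \<noteq> 0" using Cons.prems(1) that unfolding arrangement_def by (metis list.set_intros(2))
    moreover have "cross m n \<noteq> 0" using Cons.prems(1) that cross_eq_0_commute[of m n] by (simp add: arrangement_Cons)
    ultimately have "\<not> lf m dvd lf n" "prime_elem (lf m)" by (rule lf_dvd_lf_iff, intro prime_lf)
    moreover have "lf m dvd lf n * r" using Cons.prems(2)[of m] that r by simp
    ultimately show ?thesis using prime_elem_dvd_mult_iff by blast
  qed
  then have "lines A dvd r" using Cons.IH Cons.prems(1) by (simp add: arrangement_Cons)
  then show ?case by (simp add: r)
qed simp

lemma prime_power_dvd_cancel:
  fixes p :: "'a :: idom"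
  assumes "prime_elem p" "\<not> p dvd r"
  shows "p ^ m dvd s * r \<Longrightarrow> p ^ m dvd s"
proof (induction m)
  case (Suc m)
  then have "p ^ m dvd s * r" by (metis dvd_mult_right power_Suc)
  then obtain t where t: "s = p ^ m * t" using Suc.IH by blast
  have "p ^ m * p dvd p ^ m * (t * r)" using Suc.prems by (simp add: t mult_ac)
  moreover have "p ^ m \<noteq> 0" using assms(1) by auto
  ultimately have "p dvd t * r" by (simp only: dvd_mult_cancel_left) simp
  then have "p dvd t" using assms prime_elem_dvd_mult_iff by blast
  then show ?case by (simp add: t mult.commute mult_dvd_mono)
qed simp

text \<open>\<open>chebT x z n\<close> and \<open>chebU x z n\<close> are the homogenised Chebyshev
  polynomials \<open>z^n * T_n (x / z)\<close> and \<open>z^n * U_n (x / z)\<close>. Over an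
  arbitrary ring the same recurrences serve forms, numbers and univariate polynomials.\<close>

fun chebT :: "'a :: comm_ring_1 \<Rightarrow> 'a \<Rightarrow> nat \<Rightarrow> 'a" where
  "chebT x z 0 = 1"
| "chebT x z (Suc 0) = x"
| "chebT x z (Suc (Suc n)) = 2 * x * chebT x z (Suc n) - z\<^sup>2 * chebT x z n"

fun chebU :: "'a :: comm_ring_1 \<Rightarrow> 'a \<Rightarrow> nat \<Rightarrow> 'a" where
  "chebU x z 0 = 1"
| "chebU x z (Suc 0) = 2 * x"
| "chebU x z (Suc (Suc n)) = 2 * x * chebU x z (Suc n) - z\<^sup>2 * chebU x z n"

lemma homogeneous_cheb_step:
  assumes "homogeneous 1 x" "homogeneous 1 z" "homogeneous (Suc n) p" "homogeneous n q"
  shows "homogeneous (Suc (Suc n)) (2 * x * p - z\<^sup>2 * q)"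
proof -
  have "homogeneous (0 + 1 + Suc n) (C 2 * x * p)"
    by (intro homogeneous_mult homogeneous_C assms)
  moreover have "homogeneous (2 * 1 + n) (z\<^sup>2 * q)"
    by (intro homogeneous_mult homogeneous_power assms)
  ultimately show ?thesis by (auto intro!: homogeneous_diff)
qed

lemma homogeneous_chebT: "homogeneous 1 x \<Longrightarrow> homogeneous 1 z \<Longrightarrow> homogeneous n (chebT x z n)"
  by (induction x z n rule: chebT.induct) (auto intro: homogeneous_cheb_step)

lemma homogeneous_chebU: "homogeneous 1 x \<Longrightarrow> homogeneous 1 z \<Longrightarrow> homogeneous n (chebU x z n)"
proof (induction x z n rule: chebU.induct)
  case (2 x z)
  then show ?case using homogeneous_C_mult[of 1 x 2] by simp
qed (auto intro: homogeneous_cheb_step)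

lemma chebT_eq_chebU: "chebT x z (Suc n) = chebU x z (Suc n) - x * chebU x z n"
proof (induction x z n rule: chebU.induct)
  case (3 x z n)
  have "chebT x z (Suc (Suc (Suc n))) = 2 * x * chebT x z (Suc (Suc n)) - z\<^sup>2 * chebT x z (Suc n)"
    by (rule chebT.simps(3))
  also have "\<dots> = (2 * x * chebU x z (Suc (Suc n)) - z\<^sup>2 * chebU x z (Suc n)) - x * (2 * x * chebU x z (Suc n) - z\<^sup>2 * chebU x z n)"
    unfolding 3 by (simp only: algebra_simps)
  finally show ?case by (simp only: chebU.simps(3)[symmetric])
qed (simp_all add: power2_eq_square)

text \<open>The homogeneous version of \<open>T_n' = n * U_(n-1)\<close>. The recurrence looks back
  two steps, so two consecutive cases are carried along.\<close>

lemma pd_chebT: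
  assumes "pd i x = 1" "pd i z = 0"
  shows "pd i (chebT x z (Suc n)) = of_nat (Suc n) * chebU x z n \<and> pd i (chebT x z (Suc (Suc n))) = of_nat (Suc (Suc n)) * chebU x z (Suc n)"
proof (induction n)
  case 0
  show ?case using assms by (simp add: pd_mult power2_eq_square)
next
  case (Suc n)
  have step: "pd i (2 * x * p - z\<^sup>2 * q) = 2 * p + 2 * x * pd i p - z\<^sup>2 * pd i q" for p q
    using assms by (simp add: pd_mult power2_eq_square algebra_simps)
  have "pd i (chebT x z (Suc (Suc (Suc n)))) = 2 * chebT x z (Suc (Suc n))
      + 2 * x * (of_nat (Suc (Suc n)) * chebU x z (Suc n)) - z\<^sup>2 * (of_nat (Suc n) * chebU x z n)"
    using Suc by (simp only: chebT.simps(3)[of x z "Suc n"] step)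
  also have "\<dots> = of_nat (Suc (Suc (Suc n))) * chebU x z (Suc (Suc n))"
    unfolding chebT_eq_chebU by (simp add: algebra_simps power2_eq_square)
  finally show ?case using Suc by blast
qed

lemma pd_chebT':
  assumes "pd i x = 1" "pd i z = 0" "0 < n" shows "pd i (chebT x z n) = of_nat n * chebU x z (n - 1)"
proof -
  obtain m where "n = Suc m" using assms(3) gr0_implies_Suc by blast
  then show ?thesis using pd_chebT[OF assms(1,2), of m] by (simp only: diff_Suc_1)
qed

lemma pd_chebT_0: "pd i x = 0 \<Longrightarrow> pd i z = 0 \<Longrightarrow> pd i (chebT x z n) = 0"
  by (induction x z n rule: chebT.induct) (simp_all add: pd_mult power2_eq_square)

lemma ev_cheb [simp]: "cv.ev P (chebT x z n) = chebT (cv.ev P x) (cv.ev P z) n"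
  "cv.ev P (chebU x z n) = chebU (cv.ev P x) (cv.ev P z) n"
  by (induction x z n rule: chebT.induct) simp_all

lemma proj_numeral [simp]: "proj n e (numeral k) = numeral k"
  using proj_simps(4)[of n e "numeral k"] by (simp del: proj_simps)

lemma proj_cheb [simp]: "proj m e (chebT x z n) = chebT (proj m e x) (proj m e z) n"
  "proj m e (chebU x z n) = chebU (proj m e x) (proj m e z) n"
  by (induction x z n rule: chebT.induct) simp_all

lemma C_chebU: "C (chebU x z n) = chebU (C x) (C z) n"
  by (induction x z n rule: chebU.induct) simp_all

lemma chebU_scaled: "chebU (t * x) (t * z) n = t ^ n * chebU x z n"
  by (induction x z n rule: chebU.induct) (simp_all add: algebra_simps power2_eq_square)

lemma chebT_z_0: "chebT x 0 (Suc n) = 2 ^ n * x ^ Suc n"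
  by (induction n) (simp_all add: algebra_simps)

lemma chebU_z_0: "chebU x 0 n = 2 ^ n * x ^ n"
proof (induction n)
  case (Suc n)
  then show ?case by (cases n) (simp_all add: algebra_simps)
qed simp

lemma chebT_cos: "chebT (complex_of_real (cos \<psi>)) 1 n = of_real (cos (of_nat n * \<psi>))"
proof -
  have "chebT (complex_of_real (cos \<psi>)) 1 n = of_real (cos (of_nat n * \<psi>)) \<and>
    chebT (complex_of_real (cos \<psi>)) 1 (Suc n) = of_real (cos (of_nat (Suc n) * \<psi>))"
  proof (induction n)
    case (Suc n)
    have "cos (of_nat (Suc (Suc n)) * \<psi>) = 2 * cos \<psi> * cos (of_nat (Suc n) * \<psi>) - cos (of_nat n * \<psi>)"
    proof -
      have a: "of_nat (Suc (Suc n)) * \<psi> = of_nat (Suc n) * \<psi> + \<psi>" and b: "of_nat n * \<psi> = of_nat (Suc n) * \<psi> - \<psi>"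
        by (simp_all add: algebra_simps)
      show ?thesis unfolding a b cos_add cos_diff by simp
    qed
    with Suc show ?case by simp
  qed simp
  then show ?thesis ..
qed

lemma chebU_cos: "chebU (complex_of_real (cos \<psi>)) 1 n * of_real (sin \<psi>) = of_real (sin (of_nat (Suc n) * \<psi>))"
proof -
  have "chebU (complex_of_real (cos \<psi>)) 1 n * of_real (sin \<psi>) = of_real (sin (of_nat (Suc n) * \<psi>)) \<and>
    chebU (complex_of_real (cos \<psi>)) 1 (Suc n) * of_real (sin \<psi>) = of_real (sin (of_nat (Suc (Suc n)) * \<psi>))"
  proof (induction n)
    case 0
    show ?case using sin_double[of \<psi>] by simp
  next
    case (Suc n)
    have "sin (of_nat (Suc (Suc (Suc n))) * \<psi>) = 2 * cos \<psi> * sin (of_nat (Suc (Suc n)) * \<psi>) - sin (of_nat (Suc n) * \<psi>)"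
    proof -
      have a: "of_nat (Suc (Suc (Suc n))) * \<psi> = of_nat (Suc (Suc n)) * \<psi> + \<psi>" and b: "of_nat (Suc n) * \<psi> = of_nat (Suc (Suc n)) * \<psi> - \<psi>"
        by (simp_all add: algebra_simps)
      show ?thesis unfolding a b sin_add sin_diff by simp
    qed
    moreover have "chebU (complex_of_real (cos \<psi>)) 1 (Suc (Suc n)) * of_real (sin \<psi>) =
      2 * of_real (cos \<psi>) * (chebU (complex_of_real (cos \<psi>)) 1 (Suc n) * of_real (sin \<psi>)) - chebU (complex_of_real (cos \<psi>)) 1 n * of_real (sin \<psi>)"
      by (simp only: chebU.simps(3) power_one mult_1_left left_diff_distrib mult.assoc)
    ultimately show ?case using Suc by simp
  qed
  then show ?thesis ..
qed

text \<open>For \<open>0 < i < d\<close> these are the critical points of \<open>T_d\<close>, with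
  critical values alternating between -1 and 1; \<open>i = 0\<close> and \<open>i = d\<close> give
  the end points 1 and -1.\<close>

definition node :: "nat \<Rightarrow> nat \<Rightarrow> complex" where
  "node d i = of_real (cos (of_nat i * pi / of_nat d))"

lemma sin_node_neq_0: assumes "0 < d" "\<not> d dvd i" shows "sin (of_nat i * pi / of_nat d) \<noteq> 0"
proof
  assume "sin (of_nat i * pi / of_nat d) = 0"
  then obtain m :: int where "of_nat i * pi / of_nat d = of_int m * pi" unfolding sin_zero_iff_int2 by blast
  then have "of_nat i = of_int m * (of_nat d :: real)" using assms(1) by (simp add: field_simps)
  then have "int i = m * int d" by (metis of_int_eq_iff of_int_mult of_int_of_nat_eq)
  then have "int d dvd int i" by simp
  then show False using assms(2) by simp
qed

lemma chebU_node: assumes "0 < d" "\<not> d dvd i" shows "chebU (node d i) 1 (d - 1) = 0"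
proof -
  let ?p = "of_nat i * pi / of_nat d :: real"
  have "of_nat (Suc (d - 1)) * ?p = of_nat i * pi" using assms(1) by simp
  then have "sin (of_nat (Suc (d - 1)) * ?p) = 0" by simp
  then show ?thesis using chebU_cos[of ?p "d - 1"] sin_node_neq_0[OF assms] by (simp add: node_def)
qed

lemma chebT_node: assumes "0 < d" shows "chebT (node d i) 1 d = (- 1) ^ i"
proof -
  have "of_nat d * (of_nat i * pi / of_nat d) = of_nat i * pi" using assms by simp
  then show ?thesis unfolding node_def chebT_cos by simp
qed

lemma node_inj: assumes "0 < d" "i \<le> d" "j \<le> d" "node d i = node d j" shows "i = j"
proof -
  have "cos (of_nat i * pi / of_nat d) = cos (of_nat j * pi / of_nat d)"
    using assms(4) unfolding node_def of_real_eq_iff .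
  then have "of_nat i * pi / of_nat d = of_nat j * pi / of_nat d"
    by (rule cos_inj_pi[rotated -1]) (use assms in \<open>auto simp: field_simps\<close>)
  then show ?thesis using assms(1) by simp
qed

lemma lf_unit [simp]: "lf (1, 0, 0) = X 0" "lf (0, 1, 0) = X 1" "lf (0, 0, 1) = X 2"
  by (simp_all add: lf_eq)

lemma proj_lf': "proj n e (lf m) = lf m - lf n * C (dot m e)"
  by (simp add: proj_def sv_ev_lf) (simp add: lf_eq vec_defs algebra_simps)

lemma proj_z: "proj (0, 0, 1) (0, 0, 1) (X 0) = X 0" "proj (0, 0, 1) (0, 0, 1) (X 1) = X 1"
  "proj (0, 0, 1) (0, 0, 1) (X 2) = 0"
  by (simp_all add: proj_def)

lemma z_dvd_iff: "X 2 dvd p \<longleftrightarrow> proj (0, 0, 1) (0, 0, 1) p = 0"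
  using lf_dvd_iff[of "(0, 0, 1)" "(0, 0, 1)" p] by (simp add: dot_def)

text \<open>The critical points of \<open>T_d\<close> as \<open>d - 1\<close> parallel lines. The
  choices (1, 0) and (0, 1) for \<open>a\<close> and \<open>b\<close> give the two families of lines
  of the grid of critical points.\<close>

definition cols :: "complex \<Rightarrow> complex \<Rightarrow> nat \<Rightarrow> (complex \<times> complex \<times> complex) list" where
  "cols a b d = map (\<lambda>i. (a, b, - node d i)) [1..<d]"

lemma length_cols [simp]: "length (cols a b d) = d - 1" by (simp add: cols_def)

lemma arrangement_cols: assumes "a * a + b * b = 1" "0 < d" shows "arrangement (cols a b d)"
proof -
  have ab: "a \<noteq> 0 \<or> b \<noteq> 0" using assms(1) by auto
  have "sorted_wrt (\<lambda>i j. cross (a, b, - node d i) (a, b, - node d j) \<noteq> 0) [1..<d]"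
  proof (rule sorted_wrt_mono_rel[OF _ sorted_wrt_upt])
    fix i j assume "i \<in> set [1..<d]" "j \<in> set [1..<d]" "i < j"
    then have "node d i \<noteq> node d j" using node_inj[of d i j] by auto
    then show "cross (a, b, - node d i) (a, b, - node d j) \<noteq> 0"
      using ab by (auto simp: cross_def zero_prod_def)
  qed
  then show ?thesis using ab by (auto simp: arrangement_def cols_def sorted_wrt_map zero_prod_def)
qed

text \<open>On each of these lines \<open>chebU\<close> is a power of \<open>z\<close> times its
  value at a node, which is zero. The degrees agree, and setting \<open>z = 0\<close> leaves the
  leading term, so the constant quotient is nonzero.\<close>

lemma chebU_factor:
  assumes ab: "a * a + b * b = 1" and d: "0 < d"
  shows "\<exists>\<kappa>. \<kappa> \<noteq> 0 \<and> chebU (lf (a, b, 0)) (X 2) (d - 1) = C \<kappa> * lines (cols a b d)"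
proof -
  let ?Y = "lf (a, b, 0)"
  let ?U = "chebU ?Y (X 2) (d - 1)"
  have "lines (cols a b d) dvd ?U"
  proof (rule lines_dvd[OF arrangement_cols[OF assms]])
    fix n assume "n \<in> set (cols a b d)"
    then obtain i where i: "n = (a, b, - node d i)" "1 \<le> i" "i < d" by (auto simp: cols_def)
    then have "\<not> d dvd i" by (auto dest: dvd_imp_le)
    have e: "dot n (a, b, 0) = 1" using ab by (simp add: i dot_def)
    have "proj n (a, b, 0) ?Y = X 2 * C (node d i)"
      using ab by (simp add: proj_lf' dot_def) (simp add: i lf_eq)
    moreover have "proj n (a, b, 0) (X 2) = X 2 * 1"
      using proj_lf'[of n "(a, b, 0)" "(0, 0, 1)"] by (simp add: dot_def)
    ultimately have "proj n (a, b, 0) ?U = X 2 ^ (d - 1) * chebU (C (node d i)) 1 (d - 1)"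
      by (simp only: proj_cheb chebU_scaled)
    also have "chebU (C (node d i)) 1 (d - 1) = C (chebU (node d i) 1 (d - 1))" by (simp add: C_chebU)
    also have "\<dots> = 0" using chebU_node[OF d \<open>\<not> d dvd i\<close>] by simp
    finally show "lf n dvd ?U" using lf_dvd_iff[OF e] by simp
  qed
  then obtain q where q: "?U = lines (cols a b d) * q" by blast
  have "proj (0, 0, 1) (0, 0, 1) ?U = 2 ^ (d - 1) * ?Y ^ (d - 1)"
    by (simp add: proj_z chebU_z_0 proj_lf' dot_def)
  moreover have "(a, b, 0) \<noteq> (0 :: complex \<times> complex \<times> complex)" using ab by (auto simp: zero_prod_def)
  then have "2 ^ (d - 1) * ?Y ^ (d - 1) \<noteq> 0" by simp
  ultimately have "?U \<noteq> 0" by (metis proj_simps(5))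
  then have q0: "q \<noteq> 0" using q by auto
  have "homogeneous (d - 1) ?U" by (rule homogeneous_chebU) (use homogeneous_lf homogeneous_X in auto)
  then have "homogeneous (d - 1 - (d - 1)) q"
    using homogeneous_cancel(1)[of "d - 1" "lines (cols a b d)" "d - 1" q] homogeneous_prod_lf[of "cols a b d"]
      q q0 lines_neq_0[OF arrangement_cols[OF assms]] by simp
  then obtain \<kappa> where "q = C \<kappa>" using homogeneous_0_imp_C by auto
  then show ?thesis using q q0 by (intro exI[of _ \<kappa>]) (simp add: mult.commute)
qed

text \<open>Dehomogenised, this is the curve \<open>T\<^sub>d(x) + T\<^sub>d\<^sub>-\<^sub>1(y) = 0\<close>. Both polynomials have critical values
  \<open>1\<close> and \<open>-1\<close>, so the curve is singular at the critical points whose values have opposite signs.\<close>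
definition cheb_curve :: "nat \<Rightarrow> S" where
  "cheb_curve d = chebT (X 0) (X 2) d + X 2 * chebT (X 1) (X 2) (d - 1)"

lemma homogeneous_cheb_curve: "0 < d \<Longrightarrow> homogeneous d (cheb_curve d)"
  unfolding cheb_curve_def
  by (intro homogeneous_add homogeneous_mult'[OF homogeneous_X, where k = "d - 1"] homogeneous_chebT homogeneous_X) simp

lemma pd_cheb_curve:
  assumes "2 \<le> d"
  shows "pd 0 (cheb_curve d) = of_nat d * chebU (X 0) (X 2) (d - 1)"
    "pd 1 (cheb_curve d) = X 2 * (of_nat (d - 1) * chebU (X 1) (X 2) (d - 1 - 1))"
proof -
  have "pd 0 (chebT (X 0) (X 2) d) = of_nat d * chebU (X 0) (X 2) (d - 1)"
    "pd 1 (chebT (X 1) (X 2) (d - 1)) = of_nat (d - 1) * chebU (X 1) (X 2) (d - 1 - 1)"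
    by (rule pd_chebT'; use assms in simp)+
  then show "pd 0 (cheb_curve d) = of_nat d * chebU (X 0) (X 2) (d - 1)"
    "pd 1 (cheb_curve d) = X 2 * (of_nat (d - 1) * chebU (X 1) (X 2) (d - 1 - 1))"
    using pd_chebT_0[of 0 "X 1" "X 2" "d - 1"] pd_chebT_0[of 1 "X 0" "X 2" d]
    by (simp_all only: cheb_curve_def pd_add pd_mult pd_X) simp_all
qed

lemma pd_cheb_curve_factor:
  assumes "2 \<le> d"
  shows "\<exists>\<kappa>. \<kappa> \<noteq> 0 \<and> pd 0 (cheb_curve d) = C \<kappa> * lines (cols 1 0 d)"
    "\<exists>\<kappa>. \<kappa> \<noteq> 0 \<and> pd 1 (cheb_curve d) = C \<kappa> * (X 2 * lines (cols 0 1 (d - 1)))"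
proof -
  have nz: "of_nat d \<noteq> (0 :: complex)" "of_nat (d - 1) \<noteq> (0 :: complex)" using assms by simp_all
  obtain \<kappa> where k: "\<kappa> \<noteq> 0" "chebU (X 0) (X 2) (d - 1) = C \<kappa> * lines (cols 1 0 d)"
    using chebU_factor[of 1 0 d] assms by auto
  have "pd 0 (cheb_curve d) = C (of_nat d * \<kappa>) * lines (cols 1 0 d)"
    unfolding pd_cheb_curve[OF assms] by (simp only: k(2) C_simps C_of_nat mult.assoc)
  then show "\<exists>\<kappa>. \<kappa> \<noteq> 0 \<and> pd 0 (cheb_curve d) = C \<kappa> * lines (cols 1 0 d)"
    using k(1) nz mult_eq_0_iff by blast
  obtain \<mu> where l: "\<mu> \<noteq> 0" "chebU (X 1) (X 2) (d - 1 - 1) = C \<mu> * lines (cols 0 1 (d - 1))"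
    using chebU_factor[of 0 1 "d - 1"] assms by auto
  have "pd 1 (cheb_curve d) = C (of_nat (d - 1) * \<mu>) * (X 2 * lines (cols 0 1 (d - 1)))"
    unfolding pd_cheb_curve[OF assms] by (simp only: l(2) C_simps C_of_nat mult_ac)
  then show "\<exists>\<kappa>. \<kappa> \<noteq> 0 \<and> pd 1 (cheb_curve d) = C \<kappa> * (X 2 * lines (cols 0 1 (d - 1)))"
    using l(1) nz mult_eq_0_iff by blast
qed

lemma pd_chebT_2: "X 2 dvd pd 2 (chebT (X 0) (X 2) n)"
proof -
  have "X 2 dvd pd 2 (chebT (X 0) (X 2) n) \<and> X 2 dvd pd 2 (chebT (X 0) (X 2) (Suc n))"
    by (induction n) (auto simp: pd_mult power2_eq_square intro!: dvd_diff dvd_add)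
  then show ?thesis ..
qed

text \<open>The factor \<open>X 2\<close> in front of the second summand leaves a multiple of
  \<open>X 1 ^ (d - 1)\<close> at infinity, where the other two derivatives are a multiple of
  \<open>X 0 ^ (d - 1)\<close> and zero. Hence there are no singular points at infinity.\<close>

lemma pd_cheb_curve_2:
  assumes "2 \<le> d" shows "X 2 dvd pd 2 (cheb_curve d) - C (2 ^ (d - 2)) * X 1 ^ (d - 1)"
proof -
  obtain n where d: "d = Suc (Suc n)" using assms by (metis One_nat_def Suc_1 Suc_le_D Suc_le_mono)
  have "proj (0, 0, 1) (0, 0, 1) (pd 2 (cheb_curve d)) = chebT (X 1) 0 (Suc n)"
    using pd_chebT_2[of d] unfolding z_dvd_iff by (simp add: cheb_curve_def pd_mult d proj_z)
  then show ?thesis unfolding z_dvd_iff by (simp add: chebT_z_0 d proj_z)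
qed

lemma ev_cheb_curve: "cv.ev (a, b, 1) (cheb_curve d) = chebT a 1 d + chebT b 1 (d - 1)"
  by (simp add: cheb_curve_def)

lemma ev_lines_eq_0: "n \<in> set A \<Longrightarrow> dot n P = 0 \<Longrightarrow> cv.ev P (lines A) = 0"
  by (force simp: prod_list_zero_iff)

abbreviation grid_point :: "nat \<Rightarrow> nat \<Rightarrow> nat \<Rightarrow> complex \<times> complex \<times> complex" where
  "grid_point d i j \<equiv> (node d i, node (d - 1) j, 1)"

lemma ev_cheb_curve_grid:
  assumes "2 \<le> d"
  shows "cv.ev (grid_point d i j) (cheb_curve d) = (- 1) ^ i + (- 1) ^ j"
  using assms by (simp add: ev_cheb_curve chebT_node)

text \<open>Both coordinates are critical points, and since the last coordinate is 1, Euler's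
  relation reduces the third derivative to the value of the curve.\<close>

lemma ev_pd_cheb_curve_grid:
  assumes d: "2 \<le> d" and i: "\<not> d dvd i" and j: "\<not> (d - 1) dvd j"
  shows "cv.ev (grid_point d i j) (pd 0 (cheb_curve d)) = 0" "cv.ev (grid_point d i j) (pd 1 (cheb_curve d)) = 0"
    "cv.ev (grid_point d i j) (pd 2 (cheb_curve d)) = of_nat d * cv.ev (grid_point d i j) (cheb_curve d)"
proof -
  let ?P = "grid_point d i j"
  show 0: "cv.ev ?P (pd 0 (cheb_curve d)) = 0"
    using chebU_node[OF _ i] d by (simp add: pd_cheb_curve)
  show 1: "cv.ev ?P (pd 1 (cheb_curve d)) = 0"
    using chebU_node[OF _ j] d by (simp add: pd_cheb_curve)
  have "cv.ev ?P (X 0 * pd 0 (cheb_curve d) + X 1 * pd 1 (cheb_curve d) + X 2 * pd 2 (cheb_curve d)) = cv.ev ?P (of_nat d * cheb_curve d)"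
    using euler[OF homogeneous_cheb_curve[of d]] d by simp
  then show "cv.ev ?P (pd 2 (cheb_curve d)) = of_nat d * cv.ev ?P (cheb_curve d)" using 0 1 by simp
qed

section \<open>Pullback to a rational Chebyshev curve\<close>

interpretation pv: coeff_hom "\<lambda>c :: complex. [:c:]" by unfold_locales simp_all

lemma poly_pv_ev: "poly (pv.ev (p, q, r) c) t = cv.ev (poly p t, poly q t, poly r t) c"
proof (induction c rule: poly_induct)
  case (var i) then show ?case using exhaust_three[of i] by auto
qed simp_all

lemma poly_chebT: "poly (chebT x z n) t = chebT (poly x t) (poly z t) n"
  by (induction x z n rule: chebT.induct) simp_all

lemma degree_chebT: "degree (chebT [:0, 1:] 1 n :: complex poly) = n \<and> chebT [:0, 1 :: complex:] 1 n \<noteq> 0"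
proof -
  let ?T = "\<lambda>n. chebT [:0, 1 :: complex:] 1 n"
  have "degree (?T n) \<le> n \<and> coeff (?T n) n \<noteq> 0 \<and> degree (?T (Suc n)) \<le> Suc n \<and> coeff (?T (Suc n)) (Suc n) \<noteq> 0"
  proof (induction n)
    case (Suc n)
    have eq: "?T (Suc (Suc n)) = pCons 0 (smult 2 (?T (Suc n))) - ?T n" by (simp add: numeral_poly)
    have "degree (?T (Suc (Suc n))) \<le> Suc (Suc n)" unfolding eq
      using Suc by (intro degree_diff_le) (auto intro!: order.trans[OF degree_pCons_le])
    moreover have "coeff (?T n) (Suc (Suc n)) = 0" using Suc by (intro coeff_eq_0) auto
    then have "coeff (?T (Suc (Suc n))) (Suc (Suc n)) \<noteq> 0" unfolding eq using Suc by simp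
    ultimately show ?case using Suc by blast
  qed simp
  then show ?thesis using le_degree[of "?T n" n] by force
qed

text \<open>The points \<open>grid_point d s s\<close> are the points \<open>(T\<^sub>d\<^sub>-\<^sub>1(t), T\<^sub>d(t), 1)\<close> of the rational curve
  \<open>T\<^sub>d(x) = T\<^sub>d\<^sub>-\<^sub>1(y)\<close> for \<open>t = node (d * (d - 1)) s\<close>; a form of degree at most \<open>d - 3\<close> pulls back to a
  polynomial of degree at most \<open>d * (d - 3)\<close>, which has more than that many zeros.\<close>
lemma unisolvence:
  assumes c: "homogeneous m c" and m: "m + 3 \<le> d"
    and zero: "\<And>s. \<not> d dvd s \<Longrightarrow> \<not> (d - 1) dvd s \<Longrightarrow> cv.ev (grid_point d s s) c = 0"
  shows "c = 0"
proof (rule ccontr)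
  assume "c \<noteq> 0"
  let ?T = "\<lambda>n. chebT [:0, 1 :: complex:] 1 n"
  let ?v = "(?T (d - 1), ?T d, 1 :: complex poly)"
  let ?D = "\<lambda>m. lookup m 0 * (d - 1) + lookup m 1 * d"
  let ?N = "d * (d - 1)"
  define p where "p = pv.ev ?v c"
  have d: "3 \<le> d" using m by simp
  have mon: "degree (pv.mon ?v m) = ?D m" "pv.mon ?v m \<noteq> 0" for m
    using degree_chebT by (auto simp: pv.mon_def degree_mult_eq degree_power_eq)
  have term0: "degree ([:a:] * pv.mon ?v m) \<le> ?D m" for a m
    using degree_smult_le[of a "pv.mon ?v m"] mon(1)[of m] by simp
  have p: "p = (\<Sum>m\<in>keys c. [:lookup c m:] * pv.mon ?v m)" by (simp add: p_def pv.ev_def)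
  have D_le: "?D e \<le> d * (d - 3)" if "e \<in> keys c" for e
  proof -
    have e: "lookup e 0 + lookup e 1 \<le> d - 3" using c that m by (auto simp: homogeneous_iff mdeg_eq)
    have "?D e \<le> lookup e 0 * d + lookup e 1 * d" by simp
    also have "\<dots> = (lookup e 0 + lookup e 1) * d" by (simp add: algebra_simps)
    also have "\<dots> \<le> (d - 3) * d" using e by (rule mult_right_mono) simp
    finally show ?thesis by (simp add: mult.commute)
  qed
  have "degree p \<le> d * (d - 3)"
    unfolding p by (rule degree_sum_le[OF finite_keys order.trans[OF term0 D_le]])
  \<comment> \<open>Modulo \<open>d\<close> the pulled-back degree determines the exponent of the
    first variable, which is below \<open>d\<close>. Distinct monomials thus pull back to distinct
    degrees, and no cancellation can make \<open>p\<close> zero.\<close>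
  have D_inj: "e = e'" if "e \<in> keys c" "e' \<in> keys c" "?D e = ?D e'" for e e'
  proof -
    have e: "lookup e 0 + lookup e 1 + lookup e 2 = m" "lookup e' 0 + lookup e' 1 + lookup e' 2 = m"
      using c that by (auto simp: homogeneous_iff mdeg_eq)
    have "int (d - 1) = int d - 1" using d by simp
    then have "int (lookup e 0) * (int d - 1) + int (lookup e 1) * int d = int (lookup e' 0) * (int d - 1) + int (lookup e' 1) * int d"
      using arg_cong[OF that(3), of int] by (simp only: of_nat_add of_nat_mult)
    then have "int (lookup e 0) - int (lookup e' 0)
        = int d * (int (lookup e 0) + int (lookup e 1) - int (lookup e' 0) - int (lookup e' 1))"
      by (simp add: algebra_simps)
    then have dvd: "int d dvd int (lookup e 0) - int (lookup e' 0)" by simp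
    have lt: "\<bar>int (lookup e 0) - int (lookup e' 0)\<bar> < int d" using e m by linarith
    have "int (lookup e 0) - int (lookup e' 0) = 0"
    proof (rule ccontr)
      assume "int (lookup e 0) - int (lookup e' 0) \<noteq> 0"
      from dvd_imp_le_int[OF this dvd] lt show False by simp
    qed
    then have 0: "lookup e 0 = lookup e' 0" by simp
    then have 1: "lookup e 1 = lookup e' 1" using that(3) d by simp
    show "e = e'"
    proof (rule poly_mapping_eqI)
      fix i :: 3 show "lookup e i = lookup e' i" using exhaust_three[of i] 0 1 e by auto
    qed
  qed
  have "p \<noteq> 0"
  proof -
    have fin: "finite (?D ` keys c)" "?D ` keys c \<noteq> {}" using \<open>c \<noteq> 0\<close> by auto
    obtain e where e: "e \<in> keys c" "?D e = Max (?D ` keys c)" using Max_in[OF fin] by auto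
    have "coeff ([:lookup c e':] * pv.mon ?v e') (?D e) = 0" if e': "e' \<in> keys c" "e' \<noteq> e" for e'
    proof (rule coeff_eq_0)
      have "?D e' \<le> ?D e" unfolding e(2) using e'(1) fin(1) by (intro Max_ge) auto
      moreover have "?D e' \<noteq> ?D e" using D_inj[OF e'(1) e(1)] e'(2) by blast
      ultimately show "degree ([:lookup c e':] * pv.mon ?v e') < ?D e" using term0[of "lookup c e'" e'] by linarith
    qed
    then have "coeff p (?D e) = (\<Sum>e'\<in>{e}. coeff ([:lookup c e':] * pv.mon ?v e') (?D e))"
      unfolding p coeff_sum using e(1) by (intro sum.mono_neutral_right) auto
    also have "\<dots> = lookup c e * lead_coeff (pv.mon ?v e)" unfolding mon(1) by simp
    also have "\<dots> \<noteq> 0" using e(1) mon(2) by (simp add: in_keys_iff)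
    finally show ?thesis by auto
  qed
  \<comment> \<open>Of the \<open>?N - 1\<close> candidates at most \<open>d - 2\<close> multiples
    of \<open>d\<close> and \<open>d - 1\<close> multiples of \<open>d - 1\<close> drop out. At
    least \<open>(d - 1) * (d - 2)\<close> zeros remain, more than the degree bound
    \<open>d * (d - 3)\<close>.\<close>
  let ?S = "{s \<in> {1..<?N}. \<not> d dvd s \<and> \<not> (d - 1) dvd s}"
  have N: "0 < ?N" using d by simp
  have roots: "node ?N ` ?S \<subseteq> {t. poly p t = 0}"
  proof
    fix t assume "t \<in> node ?N ` ?S"
    then obtain s where s: "t = node ?N s" "\<not> d dvd s" "\<not> (d - 1) dvd s" by blast
    have "of_nat (d - 1) * (of_nat s * pi / of_nat ?N) = of_nat s * pi / of_nat d"
      "of_nat d * (of_nat s * pi / of_nat ?N) = of_nat s * pi / of_nat (d - 1)"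
      using d by (simp_all add: field_simps)
    then have "chebT t 1 (d - 1) = node d s" "chebT t 1 d = node (d - 1) s"
      unfolding s(1) node_def chebT_cos by simp_all
    then have "poly p t = cv.ev (grid_point d s s) c"
      by (simp add: p_def poly_pv_ev poly_chebT)
    then show "t \<in> {t. poly p t = 0}" using zero s by simp
  qed
  have "inj_on (node ?N) ?S"
  proof (rule inj_onI)
    fix i j assume "i \<in> ?S" "j \<in> ?S" "node ?N i = node ?N j"
    then show "i = j" using node_inj[OF N, of i j] by simp
  qed
  then have "card ?S = card (node ?N ` ?S)" by (simp add: card_image)
  also have "\<dots> \<le> card {t. poly p t = 0}" by (rule card_mono[OF poly_roots_finite[OF \<open>p \<noteq> 0\<close>] roots])
  also have "\<dots> \<le> degree p" by (rule card_poly_roots_bound[OF \<open>p \<noteq> 0\<close>])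
  also have "\<dots> \<le> d * (d - 3)" by fact
  finally have le: "card ?S \<le> d * (d - 3)" .
  have "{1..<?N} \<subseteq> ?S \<union> ((*) d ` {1..<d - 1} \<union> (*) (d - 1) ` {1..<d})"
  proof
    fix s assume s: "s \<in> {1..<?N}"
    show "s \<in> ?S \<union> ((*) d ` {1..<d - 1} \<union> (*) (d - 1) ` {1..<d})"
    proof (cases "d dvd s \<or> (d - 1) dvd s")
      case True
      then show ?thesis
      proof
        assume "d dvd s"
        then obtain k where k: "s = d * k" by blast
        with s have "1 \<le> k" "k < d - 1" by (auto simp: Suc_le_eq)
        with k show ?thesis by auto
      next
        assume "(d - 1) dvd s"
        then obtain k where k: "s = (d - 1) * k" by blast
        with s have "1 \<le> k" "k < d" by (auto simp: Suc_le_eq mult.commute[of d])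
        with k show ?thesis by auto
      qed
    qed (use s in blast)
  qed
  then have "card {1..<?N} \<le> card (?S \<union> ((*) d ` {1..<d - 1} \<union> (*) (d - 1) ` {1..<d}))"
    by (rule card_mono[rotated]) simp
  also have "\<dots> \<le> card ?S + (card ((*) d ` {1..<d - 1}) + card ((*) (d - 1) ` {1..<d}))"
    by (intro order.trans[OF card_Un_le] add_left_mono card_Un_le)
  also have "\<dots> \<le> card ?S + ((d - 1 - 1) + (d - 1))"
    using card_image_le[of "{1..<d - 1}" "(*) d"] card_image_le[of "{1..<d}" "(*) (d - 1)"] by simp
  finally have "?N - 1 \<le> d * (d - 3) + ((d - 1 - 1) + (d - 1))" using le by simp
  moreover obtain e where "d = e + 3" using d by (metis add.commute le_Suc_ex)
  ultimately show False by (simp add: algebra_simps)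
qed

section \<open>Reducedness and minimal syzygy degree of the Chebyshev curve\<close>

lemma C_inverse_mult: "\<kappa> \<noteq> 0 \<Longrightarrow> C (1 / \<kappa>) * (C \<kappa> * p) = p"
proof -
  assume "\<kappa> \<noteq> 0"
  then have "C (1 / \<kappa>) * C \<kappa> = 1" by (simp only: C_simps(6)[symmetric]) simp
  then show ?thesis by (metis mult.assoc mult_1)
qed

lemma dvd_C_mult: "\<kappa> \<noteq> 0 \<Longrightarrow> p dvd C \<kappa> * q \<longleftrightarrow> p dvd q"
proof
  assume k: "\<kappa> \<noteq> 0" and dvd: "p dvd C \<kappa> * q"
  from dvd have "p dvd C (1 / \<kappa>) * (C \<kappa> * q)" by (rule dvd_mult)
  then show "p dvd q" unfolding C_inverse_mult[OF k] .
qed simp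

lemma cols_not_dvd:
  assumes "n \<in> set (cols 1 0 d)" shows "\<not> lf n dvd X 2 * lines (cols 0 1 e)"
proof
  assume "lf n dvd X 2 * lines (cols 0 1 e)"
  then have "lf n dvd lines ((0, 0, 1) # cols 0 1 e)" by simp
  moreover obtain \<alpha> where n: "n = (1, 0, - \<alpha>)" using assms by (auto simp: cols_def)
  ultimately obtain m where m: "m \<in> set ((0, 0, 1) # cols 0 1 e)" "cross n m = 0"
    using lf_dvd_prod_lf_imp[of n "(0, 0, 1) # cols 0 1 e"] by (auto simp: zero_prod_def)
  then show False by (auto simp: n cols_def cross_def zero_prod_def)
qed

lemma prime_cols: "n \<in> set (cols 1 0 d) \<Longrightarrow> prime_elem (lf n)"
  by (intro prime_lf) (auto simp: cols_def zero_prod_def)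

text \<open>A double factor divides the first two partial derivatives, and these are products of
  lines, with no line in common.\<close>

lemma squarefree_cheb_curve: assumes d: "2 \<le> d" shows "squarefree (cheb_curve d)"
  unfolding squarefree_def
proof (intro allI impI)
  fix x assume "x\<^sup>2 dvd cheb_curve d"
  then obtain g where "cheb_curve d = x\<^sup>2 * g" by (rule dvdE)
  then have g: "cheb_curve d = x * (x * g)" by (simp add: power2_eq_square mult.assoc)
  have x: "x dvd pd i (cheb_curve d)" for i
    unfolding g pd_mult[of i x "x * g"] by (rule dvd_add[OF dvd_mult[OF dvd_triv_left] dvd_triv_left])
  obtain \<kappa> where "\<kappa> \<noteq> 0" "pd 0 (cheb_curve d) = C \<kappa> * lines (cols 1 0 d)"
    using pd_cheb_curve_factor(1)[OF d] by blast
  then have x0: "x dvd lines (cols 1 0 d)" using x[of 0] by (simp add: dvd_C_mult)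
  obtain \<mu> where m: "\<mu> \<noteq> 0" "pd 1 (cheb_curve d) = C \<mu> * (X 2 * lines (cols 0 1 (d - 1)))"
    using pd_cheb_curve_factor(2)[OF d] by blast
  show "x dvd 1"
  proof (rule unit_if_no_prime_dvd[OF _ x0])
    fix q assume "q \<in> set (map lf (cols 1 0 d))"
    then obtain n where n: "q = lf n" "n \<in> set (cols 1 0 d)" by (metis in_set_conv_nth length_map nth_map nth_mem)
    show "prime_elem q" using prime_cols n by simp
    show "\<not> q dvd x"
    proof
      assume "q dvd x"
      then have "q dvd C \<mu> * (X 2 * lines (cols 0 1 (d - 1)))" using x[of 1] unfolding m(2) by (rule dvd_trans)
      then show False using cols_not_dvd[OF n(2)] by (simp add: dvd_C_mult[OF m(1)] n(1))
    qed
  qed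
qed

lemma proj_lines_cols: "proj (0, 0, 1) (0, 0, 1) (lines (cols a b d)) = lf (a, b, 0) ^ (d - 1)"
proof -
  have "proj (0, 0, 1) (0, 0, 1) (lf (a, b, c)) = lf (a, b, 0)" for c
    unfolding proj_lf' by (simp add: dot_def) (simp add: lf_eq)
  then have "map (proj (0, 0, 1) (0, 0, 1)) (map lf (cols a b d)) = replicate (d - 1) (lf (a, b, 0))"
    by (simp add: cols_def map_replicate_const comp_def)
  then show ?thesis by (simp only: proj_simps(7) prod_list_replicate)
qed

text \<open>The degree \<open>d - 1\<close> is attained by the Koszul syzygy of the first two
  partial derivatives; the rest of the proof excludes smaller degrees.\<close>

lemma mdr_cheb_curve: assumes d: "3 \<le> d" shows "mdr (cheb_curve d) = d - 1"
proof -
  let ?F = "cheb_curve d" and ?Xs = "cols 1 0 d" and ?Ys = "cols 0 1 (d - 1)"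
  let ?p = "proj (0, 0, 1) (0, 0, 1)"
  have d2: "2 \<le> d" "0 < d" using d by auto
  have F: "homogeneous d ?F" using homogeneous_cheb_curve d2 by blast
  obtain \<kappa> where k: "\<kappa> \<noteq> 0" "pd 0 ?F = C \<kappa> * lines ?Xs"
    using pd_cheb_curve_factor(1)[OF d2(1)] by blast
  obtain \<mu> where m: "\<mu> \<noteq> 0" "pd 1 ?F = C \<mu> * (X 2 * lines ?Ys)"
    using pd_cheb_curve_factor(2)[OF d2(1)] by blast
  have arr: "arrangement ?Xs" using arrangement_cols[of 1 0 d] d2 by simp
  then have F0: "pd 0 ?F \<noteq> 0" using k lines_neq_0 by simp
  show ?thesis
  proof (rule mdr_eqI[of "(pd 1 ?F, - pd 0 ?F, 0)"])
    show "(pd 1 ?F, - pd 0 ?F, 0) \<in> syz ?F (d - 1)"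
      using homogeneous_pd[OF F] by (simp add: syz_def forms3_iff dot_def grad_def)
    show "(pd 1 ?F, - pd 0 ?F, 0) \<noteq> 0" using F0 by (simp add: zero_prod_def)
    fix j v assume j: "j < d - 1" and v: "v \<in> syz ?F j"
    obtain a b c where abc: "v = (a, b, c)" by (cases v)
    have hom: "homogeneous j a" "homogeneous j b" "homogeneous j c"
      and eq: "a * pd 0 ?F + b * pd 1 ?F + c * pd 2 ?F = 0"
      using v by (auto simp: abc syz_def forms3_iff dot_def grad_def)
    \<comment> \<open>At infinity only the first and third derivatives survive, as multiples of the
      coprime forms \<open>X 0 ^ (d - 1)\<close> and \<open>X 1 ^ (d - 1)\<close>. So
      \<open>X 0 ^ (d - 1)\<close> divides \<open>c\<close> there, which forces \<open>c\<close> to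
      vanish at infinity because its degree is below \<open>d - 1\<close>.\<close>
    have "X 2 dvd c"
    proof -
      have 0: "?p (pd 0 ?F) = C \<kappa> * X 0 ^ (d - 1)"
        unfolding k(2) proj_simps(2,4) proj_lines_cols by simp
      have 1: "?p (pd 1 ?F) = 0" by (simp add: m(2) proj_z)
      have 2: "?p (pd 2 ?F) = C (2 ^ (d - 2)) * X 1 ^ (d - 1)"
        using pd_cheb_curve_2[OF d2(1)] unfolding z_dvd_iff by (simp add: proj_z)
      have "?p (a * pd 0 ?F + b * pd 1 ?F + c * pd 2 ?F) = 0" unfolding eq by simp
      then have "X 0 ^ (d - 1) * (?p a * C \<kappa>) + ?p c * C (2 ^ (d - 2)) * X 1 ^ (d - 1) = 0"
        unfolding proj_simps 0 1 2 by (simp add: algebra_simps)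
      then have "?p c * C (2 ^ (d - 2)) * X 1 ^ (d - 1) = X 0 ^ (d - 1) * (- (?p a * C \<kappa>))"
        by (simp add: add_eq_0_iff)
      then have pow: "X 0 ^ (d - 1) dvd ?p c * C (2 ^ (d - 2)) * X 1 ^ (d - 1)" by simp
      have p0: "prime_elem (X 0)" using prime_lf[of "(1, 0, 0)"] by (simp add: zero_prod_def)
      have "\<not> X 0 dvd X 1"
        using lf_dvd_lf_iff[of "(1, 0, 0)" "(0, 1, 0)"] by (simp add: zero_prod_def cross_def)
      then have "\<not> X 0 dvd X 1 ^ (d - 1)" using prime_elem_dvd_power[OF p0] by blast
      from prime_power_dvd_cancel[OF p0 this pow]
      have "X 0 ^ (d - 1) dvd ?p c * C (2 ^ (d - 2))" .
      then have "X 0 ^ (d - 1) dvd C (2 ^ (d - 2)) * ?p c" by (simp only: mult.commute)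
      then have "X 0 ^ (d - 1) dvd ?p c" using dvd_C_mult[of "2 ^ (d - 2)"] by simp
      then obtain t where t: "?p c = t * X 0 ^ (d - 1)" by (metis dvdE mult.commute)
      have "X 2 dvd c - ?p c" using lf_dvd_diff_proj[of "(0, 0, 1)" c "(0, 0, 1)"] by simp
      then obtain s where s: "c - ?p c = s * X 2" by (metis dvdE mult.commute)
      from s have c: "c = s * X 2 + t * X 0 ^ (d - 1)" unfolding t by (simp add: algebra_simps)
      have X0: "homogeneous (d - 1) (X 0 ^ (d - 1))" using homogeneous_power[OF homogeneous_X, of "d - 1" 0] by simp
      have "c = hom_part j c" using hom_part_homogeneous[OF hom(3)] by simp
      also have "\<dots> = hom_part j (s * X 2) + hom_part j (t * X 0 ^ (d - 1))" by (subst c) simp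
      also have "hom_part j (t * X 0 ^ (d - 1)) = 0" unfolding hom_part_mult[OF X0] using j by simp
      finally have "c = (if 1 \<le> j then hom_part (j - 1) s * X 2 else 0)" by (simp add: hom_part_mult[OF homogeneous_X])
      then show ?thesis by (metis dvd_0_right dvd_triv_right)
    qed
    then obtain c' where c': "c = X 2 * c'" by blast
    \<comment> \<open>At these points the first two derivatives vanish, and the third is
      \<open>d\<close> times the value \<open>2 * (- 1) ^ s\<close> of the curve, so
      \<open>c'\<close> must vanish. Removing the factor \<open>X 2\<close> has brought the degree
      down to at most \<open>d - 3\<close>.\<close>
    have "c' = 0"
    proof (rule unisolvence)
      show "homogeneous (j - 1) c'" using homogeneous_lf_cancel[of j "(0, 0, 1)" c'] hom(3) by (simp add: c' zero_prod_def)
      show "j - 1 + 3 \<le> d" using j d by simp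
      fix s assume s: "\<not> d dvd s" "\<not> (d - 1) dvd s"
      let ?P = "grid_point d s s"
      have "cv.ev ?P (a * pd 0 ?F + b * pd 1 ?F + c * pd 2 ?F) = 0" by (simp add: eq)
      then have "cv.ev ?P c' * (of_nat d * (2 * (- 1) ^ s)) = 0"
        using ev_pd_cheb_curve_grid[OF d2(1) s] ev_cheb_curve_grid[OF d2(1), of s s] by (simp add: c')
      then show "cv.ev ?P c' = 0" using d2 by simp
    qed
    then have c: "c = 0" by (simp add: c')
    \<comment> \<open>With \<open>c = 0\<close> the relation involves only two coprime derivatives,
      so the \<open>d - 1\<close> lines of the first one divide \<open>b\<close>, whose degree is
      too small.\<close>
    have "lf n dvd b" if n: "n \<in> set ?Xs" for n
    proof -
      have "lf n dvd pd 0 ?F" unfolding k(2) using n by (intro dvd_mult dvd_prod_list) auto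
      then have "lf n dvd a * pd 0 ?F" by simp
      moreover have "b * pd 1 ?F = - (a * pd 0 ?F)" using eq by (simp add: c eq_neg_iff_add_eq_0 add.commute)
      ultimately have "lf n dvd b * pd 1 ?F" by simp
      then have "lf n dvd C \<mu> * (b * (X 2 * lines ?Ys))" unfolding m(2) by (simp only: mult.left_commute)
      then have "lf n dvd b * (X 2 * lines ?Ys)" using dvd_C_mult[OF m(1)] by blast
      then show ?thesis using cols_not_dvd[OF n] prime_cols[OF n] prime_elem_dvd_multD by blast
    qed
    then have "lines ?Xs dvd b" by (rule lines_dvd[OF arr])
    then have b: "b = 0"
      using homogeneous_dvd_imp_eq_0[OF homogeneous_prod_lf _ hom(2), of ?Xs] j by simp
    then have "a = 0" using eq F0 by (simp add: c)
    then show "v = 0" by (simp add: abc b c zero_prod_def)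
  qed
qed

section \<open>The nodes and the Tjurina number of the Chebyshev curve\<close>

lemma grid_ideal:
  assumes "\<And>a b. a \<in> set As \<Longrightarrow> b \<in> set Bs \<Longrightarrow> cross a b \<noteq> 0"
    "\<And>a. a \<in> set As \<Longrightarrow> sorted_wrt (\<lambda>b b'. dot b' (cross a b) \<noteq> 0) Bs"
    "sorted_wrt (\<lambda>a a'. \<forall>b\<in>set Bs. dot a (cross a' b) \<noteq> 0) As"
    "homogeneous k q" "\<And>a b. a \<in> set As \<Longrightarrow> b \<in> set Bs \<Longrightarrow> cv.ev (cross a b) q = 0"
  shows "\<exists>u v. q = lines As * u + lines Bs * v"
  using assms
proof (induction As arbitrary: k q)
  case Nil
  show ?case by (intro exI[of _ q] exI[of _ 0]) simp
next
  case (Cons a As)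
  \<comment> \<open>On the line \<open>a\<close> the form \<open>q\<close> is a multiple of
    \<open>lines Bs\<close>. After subtracting this multiple, the cofactor of \<open>lf a\<close>
    vanishes on the grid of the remaining lines, which shows that the grid is a complete
    intersection.\<close>
  have "\<exists>u v. q = lf a * u + lines Bs * v \<and> (if k < length Bs then v = 0 else homogeneous (k - length Bs) v)"
    using Cons.prems by (intro vanishing_on_line) auto
  then obtain u v where uv: "q = lf a * u + lines Bs * v" "if k < length Bs then v = 0 else homogeneous (k - length Bs) v"
    by blast
  show ?case
  proof (cases "Bs = []")
    case True
    then show ?thesis by (intro exI[of _ 0] exI[of _ q]) simp
  next
    case False
    then have a: "a \<noteq> 0" using Cons.prems(1)[of a "hd Bs"] by auto
    have "homogeneous k (lines Bs * v)"
      using uv(2) by (cases "k < length Bs") (auto intro!: homogeneous_mult'[OF homogeneous_prod_lf])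
    then have "homogeneous k (q - lines Bs * v)" using Cons.prems(4) by (intro homogeneous_diff)
    then have "homogeneous (k - 1) u" using homogeneous_lf_cancel[OF _ a] uv(1) by simp
    moreover have "cv.ev (cross a' b) u = 0" if "a' \<in> set As" "b \<in> set Bs" for a' b
    proof -
      have "cv.ev (cross a' b) (lines Bs) = 0" using that by (intro ev_lines_eq_0[of b]) auto
      moreover have "cv.ev (cross a' b) q = 0" using Cons.prems(5) that by simp
      moreover have "dot a (cross a' b) \<noteq> 0" using Cons.prems(3) that by simp
      ultimately show ?thesis unfolding uv(1) by (simp del: cv.ev_prod_list)
    qed
    ultimately obtain u' v' where "u = lines As * u' + lines Bs * v'"
      using Cons.IH[of "k - 1" u] Cons.prems(1,2,3) by auto
    then have "q = lines (a # As) * u' + lines Bs * (lf a * v' + v)"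
      unfolding uv(1) by (simp add: algebra_simps)
    then show ?thesis by blast
  qed
qed

lemma affine_points_list:
  assumes "finite S" "\<And>P. P \<in> S \<Longrightarrow> snd (snd P) = (1 :: complex)"
  obtains Ps where "set Ps = S" "length Ps = card S" "sorted_wrt (\<lambda>P Q. cross P Q \<noteq> 0) Ps" "0 \<notin> set Ps"
proof -
  obtain Ps where Ps: "set Ps = S" "distinct Ps" using finite_distinct_list[OF assms(1)] by blast
  have "sorted_wrt (\<lambda>P Q. cross P Q \<noteq> 0) Ps"
    unfolding sorted_wrt_iff_nth_less
  proof (intro allI impI)
    fix i j assume ij: "i < j" "j < length Ps"
    then have "Ps ! i \<noteq> Ps ! j" using Ps(2) by (simp add: nth_eq_iff_index_eq)
    moreover have "snd (snd (Ps ! i)) = 1" "snd (snd (Ps ! j)) = 1"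
      using assms(2) Ps(1) ij nth_mem by (metis order.strict_trans)+
    ultimately show "cross (Ps ! i) (Ps ! j) \<noteq> 0"
      by (cases "Ps ! i"; cases "Ps ! j") (auto simp: cross_def zero_prod_def)
  qed
  moreover have "0 \<notin> set Ps" using assms(2) Ps(1) by (metis snd_zero zero_neq_one)
  ultimately show ?thesis using that Ps distinct_card by metis
qed

text \<open>The parity of \<open>i + j\<close> decides whether the two critical values cancel:
  \<open>False\<close> gives the nodes of the curve, \<open>True\<close> the other critical
  points.\<close>

definition grid_index :: "nat \<Rightarrow> bool \<Rightarrow> (nat \<times> nat) set" where
  "grid_index d e = {(i, j). i \<in> {1..<d} \<and> j \<in> {1..<d - 1} \<and> even (i + j) = e}"

lemma finite_grid_index: "finite (grid_index d e)"
  by (rule finite_subset[of _ "{1..<d} \<times> {1..<d - 1}"]) (auto simp: grid_index_def)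

text \<open>One of \<open>d\<close> and \<open>d - 1\<close> is odd, so reflecting the corresponding
  index exchanges the two parities.\<close>

lemma card_grid_index: "2 * card (grid_index d e) = (d - 1) * (d - 2)"
proof -
  have "\<exists>h. bij_betw h (grid_index d True) (grid_index d False)"
  proof (cases "odd d")
    case True
    then have "bij_betw (\<lambda>(i, j). (d - i, j)) (grid_index d True) (grid_index d False)"
      by (intro bij_betw_byWitness[where f' = "\<lambda>(i, j). (d - i, j)"]) (auto simp: grid_index_def)
    then show ?thesis by blast
  next
    case False
    then have "bij_betw (\<lambda>(i, j). (i, d - 1 - j)) (grid_index d True) (grid_index d False)"
      by (intro bij_betw_byWitness[where f' = "\<lambda>(i, j). (i, d - 1 - j)"]) (auto simp: grid_index_def)
    then show ?thesis by blast
  qed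
  then have eq: "card (grid_index d True) = card (grid_index d False)" using bij_betw_same_card by blast
  have "{1..<d} \<times> {1..<d - 1} = grid_index d True \<union> grid_index d False" by (auto simp: grid_index_def)
  moreover have "grid_index d True \<inter> grid_index d False = {}" by (auto simp: grid_index_def)
  ultimately have "card ({1..<d} \<times> {1..<d - 1}) = card (grid_index d True) + card (grid_index d False)"
    using card_Un_disjoint[OF finite_grid_index finite_grid_index] by metis
  moreover have "card ({1..<d} \<times> {1..<d - 1}) = (d - 1) * (d - 2)"
    by (simp add: card_cartesian_product numeral_2_eq_2)
  ultimately show ?thesis using eq by (cases e) auto
qed

lemma jacobian_ideal_add: "p \<in> jacobian_ideal f \<Longrightarrow> q \<in> jacobian_ideal f \<Longrightarrow> p + q \<in> jacobian_ideal f"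
  by (rule vS.subspace_add[OF subspace_jacobian_ideal])

lemma jacobian_ideal_mult: "p \<in> jacobian_ideal f \<Longrightarrow> r * p \<in> jacobian_ideal f"
proof -
  assume "p \<in> jacobian_ideal f"
  then obtain a b c where "p = a * pd 0 f + b * pd 1 f + c * pd 2 f" by (auto simp: jacobian_ideal_def)
  then have "r * p = (r * a) * pd 0 f + (r * b) * pd 1 f + (r * c) * pd 2 f" by (simp add: algebra_simps)
  then show ?thesis unfolding jacobian_ideal_def by blast
qed

lemma jacobian_ideal_C:
  assumes "\<kappa> \<noteq> 0" "C \<kappa> * p \<in> jacobian_ideal f" shows "p \<in> jacobian_ideal f"
  using jacobian_ideal_mult[OF assms(2), of "C (1 / \<kappa>)"] unfolding C_inverse_mult[OF assms(1)] .

lemma pd_in_jacobian_ideal: "pd i f \<in> jacobian_ideal f"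
proof -
  have "pd 0 f = 1 * pd 0 f + 0 * pd 1 f + 0 * pd 2 f" "pd 1 f = 0 * pd 0 f + 1 * pd 1 f + 0 * pd 2 f"
    "pd 2 f = 0 * pd 0 f + 0 * pd 1 f + 1 * pd 2 f" by simp_all
  then show ?thesis unfolding jacobian_ideal_def using exhaust_three[of i] by blast
qed

lemma in_jacobian_ideal: assumes "homogeneous d f" "0 < d" shows "f \<in> jacobian_ideal f"
proof -
  have "C (of_nat d) * f = X 0 * pd 0 f + X 1 * pd 1 f + X 2 * pd 2 f" using euler[OF assms(1)] by simp
  also have "\<dots> \<in> jacobian_ideal f" by (intro jacobian_ideal_add jacobian_ideal_mult pd_in_jacobian_ideal)
  finally have "C (of_nat d) * f \<in> jacobian_ideal f" .
  moreover have "(of_nat d :: complex) \<noteq> 0" using assms(2) by simp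
  ultimately show ?thesis using jacobian_ideal_C by blast
qed

text \<open>A multiple of the curve corrects the values at the other critical points, after which
  the form lies in the ideal of the two line products of the grid. The first product belongs to the
  Jacobian ideal; the second does after multiplication by \<open>X 2\<close>,
  \<open>X 0 ^ (d - 1)\<close> or \<open>X 1 ^ (d - 1)\<close>, and these three generate all forms
  of large degree.\<close>

lemma cheb_curve_vanishing_in_ideal:
  assumes d: "3 \<le> d"
  shows "\<exists>K. \<forall>k\<ge>K. \<forall>q. homogeneous k q \<longrightarrow> (\<forall>(i, j)\<in>grid_index d False. cv.ev (grid_point d i j) q = 0)
    \<longrightarrow> q \<in> jacobian_ideal (cheb_curve d)"
proof -
  let ?F = "cheb_curve d" and ?Xs = "cols 1 0 d" and ?Ys = "cols 0 1 (d - 1)"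
  let ?J = "jacobian_ideal ?F"
  have d2: "2 \<le> d" "0 < d" using d by auto
  have F: "homogeneous d ?F" using homogeneous_cheb_curve d2 by blast
  have FJ: "?F \<in> ?J" by (rule in_jacobian_ideal[OF F d2(2)])
  obtain \<kappa> where k: "\<kappa> \<noteq> 0" "pd 0 ?F = C \<kappa> * lines ?Xs"
    using pd_cheb_curve_factor(1)[OF d2(1)] by blast
  then have XJ: "lines ?Xs \<in> ?J" using pd_in_jacobian_ideal[of 0 ?F] jacobian_ideal_C by metis
  obtain \<mu> where m: "\<mu> \<noteq> 0" "pd 1 ?F = C \<mu> * (X 2 * lines ?Ys)"
    using pd_cheb_curve_factor(2)[OF d2(1)] by blast
  then have YJ: "X 2 * lines ?Ys \<in> ?J" using pd_in_jacobian_ideal[of 1 ?F] jacobian_ideal_C by metis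
  have X0J: "lines ?Ys * X 0 ^ (d - 1) \<in> ?J"
  proof -
    \<comment> \<open>At infinity the lines of \<open>?Xs\<close> all become
      \<open>X 0\<close>.\<close>
    have "X 2 dvd X 0 ^ (d - 1) - lines ?Xs" unfolding z_dvd_iff proj_simps(3,8) proj_lines_cols proj_z by simp
    then obtain s where "X 0 ^ (d - 1) - lines ?Xs = X 2 * s" by blast
    then have "X 0 ^ (d - 1) = lines ?Xs + X 2 * s" by (simp add: algebra_simps)
    then have "lines ?Ys * X 0 ^ (d - 1) = lines ?Ys * lines ?Xs + s * (X 2 * lines ?Ys)" by (simp add: algebra_simps)
    also have "\<dots> \<in> ?J"
      by (rule jacobian_ideal_add[OF jacobian_ideal_mult[OF XJ] jacobian_ideal_mult[OF YJ]])
    finally show ?thesis .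
  qed
  have X1J: "lines ?Ys * X 1 ^ (d - 1) \<in> ?J"
  proof (rule jacobian_ideal_C[of "2 ^ (d - 2)"])
    obtain s where "pd 2 ?F - C (2 ^ (d - 2)) * X 1 ^ (d - 1) = X 2 * s"
      using pd_cheb_curve_2[OF d2(1)] by blast
    then have "C (2 ^ (d - 2)) * X 1 ^ (d - 1) = pd 2 ?F + X 2 * (- s)" by (simp add: algebra_simps)
    then have "lines ?Ys * (C (2 ^ (d - 2)) * X 1 ^ (d - 1)) = lines ?Ys * pd 2 ?F + (- s) * (X 2 * lines ?Ys)"
      by (simp only: algebra_simps)
    also have "\<dots> \<in> ?J"
      by (rule jacobian_ideal_add[OF jacobian_ideal_mult[OF pd_in_jacobian_ideal] jacobian_ideal_mult[OF YJ]])
    finally show "C (2 ^ (d - 2)) * (lines ?Ys * X 1 ^ (d - 1)) \<in> ?J" by (simp only: mult.left_commute)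
  qed simp
  let ?pt = "\<lambda>(i, j). grid_point d i j"
  obtain Ps where Ps: "set Ps = ?pt ` grid_index d True" "sorted_wrt (\<lambda>P Q. cross P Q \<noteq> 0) Ps" "0 \<notin> set Ps"
    by (rule affine_points_list[of "?pt ` grid_index d True"]) (auto simp: finite_grid_index)
  have main: "q \<in> ?J" if K: "length Ps + 3 * d \<le> k" and q: "homogeneous k q"
    and zero: "\<And>i j. (i, j) \<in> grid_index d False \<Longrightarrow> cv.ev (grid_point d i j) q = 0" for k q
  proof -
    \<comment> \<open>The values at the points off the curve are prescribed for a cofactor
      \<open>g\<close> of degree \<open>k - d\<close>; interpolation needs this degree to be at
      least the number of points.\<close>
    have kd: "length Ps \<le> k - d" using K by linarith
    obtain g where g: "homogeneous (k - d) g" "\<And>P. P \<in> set Ps \<Longrightarrow> cv.ev P g = cv.ev P q / cv.ev P ?F"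
      using interpolation[OF Ps(2,3) kd, of "\<lambda>P. cv.ev P q / cv.ev P ?F"] by blast
    let ?q = "q - g * ?F"
    have hq: "homogeneous k ?q"
      using K by (intro homogeneous_diff q homogeneous_mult'[OF g(1) F]) simp
    have vq: "cv.ev (grid_point d i j) ?q = 0" if ij: "i \<in> {1..<d}" "j \<in> {1..<d - 1}" for i j
    proof (cases "even (i + j)")
      case True
      then have "grid_point d i j \<in> set Ps" using ij unfolding Ps(1) by (force simp: grid_index_def)
      moreover have "cv.ev (grid_point d i j) ?F \<noteq> 0"
        unfolding ev_cheb_curve_grid[OF d2(1)] using True by (cases "even i") auto
      ultimately show ?thesis using g(2) by simp
    next
      case False
      then have "cv.ev (grid_point d i j) q = 0" using ij by (intro zero) (auto simp: grid_index_def)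
      moreover have "cv.ev (grid_point d i j) ?F = 0"
        unfolding ev_cheb_curve_grid[OF d2(1)] using False by (cases "even i") auto
      ultimately show ?thesis by simp
    qed
    have cr: "cross (1, 0, - a) (0, 1, - b) = (a, b, 1)" for a b :: complex by (simp add: cross_def)
    have "\<exists>u v. ?q = lines ?Xs * u + lines ?Ys * v"
    proof (rule grid_ideal[OF _ _ _ hq])
      show "cross a b \<noteq> 0" if "a \<in> set ?Xs" "b \<in> set ?Ys" for a b
        using that by (auto simp: cols_def cr zero_prod_def)
      show "cv.ev (cross a b) ?q = 0" if "a \<in> set ?Xs" "b \<in> set ?Ys" for a b
        using that vq by (auto simp: cols_def cr)
      have n1: "node d i \<noteq> node d i'" if "i \<in> set [1..<d]" "i' \<in> set [1..<d]" "i < i'" for i i'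
        using node_inj[of d i i'] that by auto
      have n2: "node (d - 1) i \<noteq> node (d - 1) i'" if "i \<in> set [1..<d - 1]" "i' \<in> set [1..<d - 1]" "i < i'" for i i'
        using node_inj[of "d - 1" i i'] that d by auto
      show "sorted_wrt (\<lambda>b b'. dot b' (cross a b) \<noteq> 0) ?Ys" if aX: "a \<in> set ?Xs" for a
      proof -
        obtain \<alpha> where a: "a = (1, 0, - \<alpha>)" using aX by (auto simp: cols_def)
        show ?thesis unfolding cols_def sorted_wrt_map a cr
          by (rule sorted_wrt_mono_rel[OF _ sorted_wrt_upt]) (use n2 in \<open>auto simp: dot_def\<close>)
      qed
      show "sorted_wrt (\<lambda>a a'. \<forall>b\<in>set ?Ys. dot a (cross a' b) \<noteq> 0) ?Xs"
        unfolding cols_def[of 1] sorted_wrt_map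
        by (rule sorted_wrt_mono_rel[OF _ sorted_wrt_upt]) (use n1 in \<open>force simp: dot_def cols_def cr\<close>)
    qed
    then obtain u v where uv: "?q = lines ?Xs * u + lines ?Ys * v" by blast
    let ?j = "k - (d - 2)"
    have Xs: "homogeneous (d - 1) (lines ?Xs)" using homogeneous_prod_lf[of ?Xs] by simp
    have Ys: "homogeneous (d - 2) (lines ?Ys)"
      using homogeneous_prod_lf[of ?Ys] by (simp add: numeral_2_eq_2)
    have le: "d - 1 \<le> k" "d - 2 \<le> k" using K by linarith+
    have "?q = hom_part k (u * lines ?Xs + v * lines ?Ys)"
      using hom_part_homogeneous[OF hq, of k] uv by (simp add: mult.commute)
    then have q': "?q = hom_part (k - (d - 1)) u * lines ?Xs + hom_part ?j v * lines ?Ys"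
      unfolding hom_part_simps hom_part_mult[OF Xs] hom_part_mult[OF Ys] using le by simp
    \<comment> \<open>Repeated lines produce the powers \<open>X 0 ^ (d - 1)\<close> and
      \<open>X 1 ^ (d - 1)\<close>, which have no common zero on the line at infinity.\<close>
    let ?as = "replicate (d - 1) (1, 0, 0) :: (complex \<times> complex \<times> complex) list"
    let ?bs = "replicate (d - 1) (0, 1, 0) :: (complex \<times> complex \<times> complex) list"
    have "\<exists>w v1 v2. hom_part ?j v = lf (0, 0, 1) * w + lines ?as * v1 + lines ?bs * v2 \<and>
      homogeneous (?j - length ?as) v1 \<and> homogeneous (?j - length ?bs) v2"
      by (rule coprime_split) (use K in \<open>auto simp: cross_def dot_def zero_prod_def\<close>)
    then obtain w v1 v2 where "hom_part ?j v = X 2 * w + X 0 ^ (d - 1) * v1 + X 1 ^ (d - 1) * v2"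
      by (auto simp: prod_list_replicate)
    then have "hom_part ?j v * lines ?Ys = w * (X 2 * lines ?Ys) + v1 * (lines ?Ys * X 0 ^ (d - 1)) + v2 * (lines ?Ys * X 1 ^ (d - 1))"
      by (simp add: algebra_simps)
    also have "\<dots> \<in> ?J"
      by (rule jacobian_ideal_add[OF jacobian_ideal_add[OF jacobian_ideal_mult[OF YJ] jacobian_ideal_mult[OF X0J]]
            jacobian_ideal_mult[OF X1J]])
    finally have vJ: "hom_part ?j v * lines ?Ys \<in> ?J" .
    have "?q + g * ?F \<in> ?J"
      unfolding q'
      by (rule jacobian_ideal_add[OF jacobian_ideal_add[OF jacobian_ideal_mult[OF XJ] vJ] jacobian_ideal_mult[OF FJ]])
    then show ?thesis by simp
  qed
  show ?thesis
  proof (intro exI allI impI)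
    fix k q assume "length Ps + 3 * d \<le> k" "homogeneous k q"
      and zero: "\<forall>(i, j)\<in>grid_index d False. cv.ev (grid_point d i j) q = 0"
    moreover have "cv.ev (grid_point d i j) q = 0" if "(i, j) \<in> grid_index d False" for i j
      using bspec[OF zero that] by simp
    ultimately show "q \<in> ?J" by (intro main)
  qed
qed

text \<open>In large degrees the Jacobian ideal consists of the forms vanishing at the nodes, and
  the nodes impose independent conditions, so the codimension counts them.\<close>

lemma tjurina_number_cheb_curve:
  assumes d: "3 \<le> d" shows "2 * tjurina_number (cheb_curve d) = (d - 1) * (d - 2)"
proof -
  let ?F = "cheb_curve d" and ?pt = "\<lambda>(i, j). grid_point d i j"
  let ?I = "grid_index d False"
  have d2: "2 \<le> d" "0 < d" using d by auto
  obtain K where K: "\<And>k q. K \<le> k \<Longrightarrow> homogeneous k q \<Longrightarrow> (\<forall>(i, j)\<in>?I. cv.ev (grid_point d i j) q = 0)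
    \<Longrightarrow> q \<in> jacobian_ideal ?F"
    using cheb_curve_vanishing_in_ideal[OF d] by blast
  obtain Ps where Ps: "set Ps = ?pt ` ?I" "length Ps = card (?pt ` ?I)" "sorted_wrt (\<lambda>P Q. cross P Q \<noteq> 0) Ps" "0 \<notin> set Ps"
    by (rule affine_points_list[of "?pt ` ?I"]) (auto simp: finite_grid_index)
  have "inj_on ?pt ?I"
    using node_inj[of d] node_inj[of "d - 1"] by (intro inj_onI) (auto simp: grid_index_def)
  then have len: "length Ps = card ?I" using Ps(2) by (simp add: card_image)
  have "tjurina_number ?F = card ?I"
  proof (rule tjurina_number_eqI[of "K + length Ps"])
    fix k assume k: "K + length Ps \<le> k"
    have "forms k \<inter> jacobian_ideal ?F = vanishing k Ps"
    proof (intro subset_antisym subsetI)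
      fix q assume q: "q \<in> forms k \<inter> jacobian_ideal ?F"
      then obtain a b c where abc: "q = a * pd 0 ?F + b * pd 1 ?F + c * pd 2 ?F" by (auto simp: jacobian_ideal_def)
      have "cv.ev (grid_point d i j) q = 0" if ij: "(i, j) \<in> ?I" for i j
      proof -
        have nd: "\<not> d dvd i" "\<not> (d - 1) dvd j" using ij by (auto simp: grid_index_def dest!: dvd_imp_le)
        have "cv.ev (grid_point d i j) ?F = 0"
          unfolding ev_cheb_curve_grid[OF d2(1)] using ij by (cases "even i") (auto simp: grid_index_def)
        then show ?thesis using ev_pd_cheb_curve_grid[OF d2(1) nd] by (simp add: abc)
      qed
      then show "q \<in> vanishing k Ps" using q by (auto simp: vanishing_def Ps(1))
    next
      fix q assume q: "q \<in> vanishing k Ps"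
      then have "q \<in> jacobian_ideal ?F"
        using k by (intro K[of k]) (auto simp: vanishing_def forms_def Ps(1))
      then show "q \<in> forms k \<inter> jacobian_ideal ?F" using q by (simp add: vanishing_def)
    qed
    then show "vS.dim (forms k) = vS.dim (forms k \<inter> jacobian_ideal ?F) + card ?I"
      using dim_vanishing[OF Ps(3,4), of k] k len by (simp add: dim_forms)
  qed
  then show ?thesis using card_grid_index by simp
qed

lemma maximal_tjurina_cheb_curve:
  assumes d: "3 \<le> d" shows "maximal_tjurina_curve d (d - 1) (cheb_curve d)"
proof -
  obtain e where e: "d = e + 3" using d by (metis add.commute le_Suc_ex)
  have "2 * int (tjurina_number (cheb_curve d)) = int ((d - 1) * (d - 2))"
    using tjurina_number_cheb_curve[OF d] by linarith
  moreover have "2 * tau_max d (d - 1) = int ((d - 1) * (d - 2))"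
  proof -
    have "2 * (d - 1) + 2 - d = d" using d by simp
    then have "2 * tau_max d (d - 1) = 2 * int (d - 1) ^ 2 - 2 * int (d choose 2)"
      using d by (simp add: tau_max_def of_nat_diff)
    also have "\<dots> = int ((d - 1) * (d - 2))"
      unfolding choose_2_int by (simp add: e algebra_simps power2_eq_square)
    finally show ?thesis .
  qed
  ultimately have "int (tjurina_number (cheb_curve d)) = tau_max d (d - 1)" by simp
  then show ?thesis
    using d squarefree_cheb_curve homogeneous_cheb_curve mdr_cheb_curve[OF d]
    by (simp add: maximal_tjurina_curve_def reduced_plane_curve_def)
qed

section \<open>Maximal Tjurina arrangements\<close>

abbreviation of_int3 :: "int \<times> int \<times> int \<Rightarrow> complex \<times> complex \<times> complex" where
  "of_int3 \<equiv> map3 of_int"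

lemma dot_of_int3 [simp]: "dot (of_int3 u) (of_int3 v) = of_int (dot u v)"
  by (simp add: vec_defs)
lemma cross_of_int3 [simp]: "cross (of_int3 u) (of_int3 v) = of_int3 (cross u v)"
  by (simp add: vec_defs)
lemma of_int3_eq_0 [simp]: "of_int3 v = 0 \<longleftrightarrow> v = 0"
  by (simp add: map3_def zero_prod_def prod_eq_iff)

lemma meets_of_int3: "meets (of_int3 n) (map of_int3 A) = map of_int3 (meets n A)"
  by (induction A) auto
lemma rho_of_int3: "rho (map of_int3 A) = rho A"
  by (induction A) (auto simp: meets_of_int3)
lemma tau_of_int3: "tau (map of_int3 A) = tau A"
  by (induction A) (auto simp: meets_of_int3)
lemma arrangement_of_int3: "arrangement (map of_int3 A) = arrangement A"
  by (auto simp: arrangement_def sorted_wrt_map)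

text \<open>Integer coefficients make all hypotheses executable. The point of high multiplicity is
  (1, 0, 0), and the lines missing it are those with nonzero first coefficient.\<close>

lemma maximal_tjurina_int_lines:
  fixes A :: "(int \<times> int \<times> int) list"
  assumes "arrangement A" "A \<noteq> []" "rho A = r" "length (filter (\<lambda>a. fst a \<noteq> 0) A) = r"
    "int (tau A) = tau_max (length A) r"
  shows "\<exists>f. line_arrangement f \<and> maximal_tjurina_curve (length A) r f"
proof -
  let ?A = "map of_int3 A"
  have arr: "arrangement ?A" using assms(1) by (simp add: arrangement_of_int3)
  have "filter (\<lambda>a. dot a (of_int3 (1, 0, 0)) \<noteq> 0) ?A = map of_int3 (filter (\<lambda>a. fst a \<noteq> 0) A)"
    unfolding filter_map comp_def by (simp add: dot_def map3_def)
  then have "maximal_tjurina_curve (length ?A) r (lines ?A)"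
    using assms by (intro maximal_tjurina_lines[OF arr, of "of_int3 (1, 0, 0)"])
      (simp_all add: rho_of_int3 tau_of_int3 map3_def zero_prod_def)
  with line_arrangement_lines[OF arr] show ?thesis by auto
qed

text \<open>For \<open>s \<ge> 1\<close>, the list with index \<open>s\<close> starts with the \<open>2 * s + 1\<close> lines of a grid: two pencils of
  \<open>s + 1\<close> lines sharing the line at infinity. The \<open>i\<close>-th line added to the grid meets its predecessors in
  exactly \<open>s + 1 + i\<close> points, so that the first \<open>d\<close> lines are maximal Tjurina of type \<open>(d, d - 1 - s)\<close>.\<close>
definition line_lists :: "(int \<times> int \<times> int) list list" where
  "line_lists = [
    [],
    [(0, 0, 1), (1, 0, 0), (0, 1, 0), (1, -1, -1), (1, -2, 1), (1, 1, -2), (2, -1, 1), (1, 2, 3), (1, 3, 2), (2, 3, -1), (3, 1, 2)],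
    [(0, 0, 1), (1, 0, 0), (0, 1, 0), (1, 0, -1), (0, 1, -1), (1, 1, 0), (1, -1, -1), (1, -2, 1), (1, 1, 2), (1, -1, -3), (1, 2, -2)],
    [(0, 0, 1), (1, 0, 0), (0, 1, 0), (1, 0, -1), (0, 1, -1), (1, 0, 1), (0, 1, 1), (1, -1, -1), (1, -2, 0), (1, 2, 0), (1, -1, -2)],
    [(0, 0, 1), (1, 0, 0), (0, 1, 0), (1, 0, -1), (0, 1, -1), (1, 0, 1), (0, 1, 1), (1, 0, -2), (0, 1, -2), (1, 1, 0), (1, -2, 0)]]"

text \<open>\<open>rev\<close> is needed because \<open>rho\<close> and \<open>tau\<close> treat the
  head of a list as the line added last. The index \<open>d - 1 - r\<close> stays constant while
  lines are added.\<close>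

definition lines_of_type :: "nat \<Rightarrow> nat \<Rightarrow> (int \<times> int \<times> int) list" where
  "lines_of_type d r = rev (take d (line_lists ! (d - 1 - r)))"

text \<open>Only finitely many pairs occur, and every condition evaluates over the integers. Exactly
  \<open>d - r\<close> lines of each list prefix pass through (1, 0, 0), all of them grid
  lines.\<close>

lemma lines_of_type:
  assumes "3 \<le> d" "d \<le> 11" "d \<le> 2 * r" "r + 2 \<le> d"
  shows "arrangement (lines_of_type d r) \<and> length (lines_of_type d r) = d \<and> rho (lines_of_type d r) = r \<and>
    length (filter (\<lambda>a. fst a \<noteq> 0) (lines_of_type d r)) = r \<and> int (tau (lines_of_type d r)) = tau_max d r"
proof -
  have "\<forall>d\<in>set [3..<12]. \<forall>r\<in>set [0..<12]. d \<le> 2 * r \<longrightarrow> r + 2 \<le> d \<longrightarrow>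
    arrangement (lines_of_type d r) \<and> length (lines_of_type d r) = d \<and> rho (lines_of_type d r) = r \<and>
    length (filter (\<lambda>a. fst a \<noteq> 0) (lines_of_type d r)) = r \<and> int (tau (lines_of_type d r)) = tau_max d r"
    by code_simp
  moreover have "d \<in> set [3..<12]" "r \<in> set [0..<12]" using assms by auto
  ultimately show ?thesis using assms by blast
qed

theorem corollary1p3:
  "(\<forall>d r :: nat. 3 \<le> d \<and> d \<le> 11 \<and> real d / 2 \<le> real r \<and> r \<le> d - 1 \<longrightarrow>
      (\<exists>f. maximal_tjurina_curve d r f)) \<and>
   (\<forall>d r :: nat. 3 \<le> d \<and> d \<le> 11 \<and> real d / 2 \<le> real r \<and> r \<le> d - 2 \<longrightarrow>
      (\<exists>f. line_arrangement f \<and> maximal_tjurina_curve d r f))"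
proof (intro conjI allI impI)
  have lines: "\<exists>f. line_arrangement f \<and> maximal_tjurina_curve d r f"
    if "3 \<le> d \<and> d \<le> 11 \<and> real d / 2 \<le> real r \<and> r \<le> d - 2" for d r :: nat
  proof -
    have "d \<le> 2 * r" "r + 2 \<le> d" using that by linarith+
    then have "arrangement (lines_of_type d r)" "length (lines_of_type d r) = d" "rho (lines_of_type d r) = r"
      "length (filter (\<lambda>a. fst a \<noteq> 0) (lines_of_type d r)) = r" "int (tau (lines_of_type d r)) = tau_max d r"
      using lines_of_type[of d r] that by blast+
    then show ?thesis using maximal_tjurina_int_lines[of "lines_of_type d r" r] that by fastforce
  qed
  fix d r :: nat
  show "\<exists>f. line_arrangement f \<and> maximal_tjurina_curve d r f"
    if "3 \<le> d \<and> d \<le> 11 \<and> real d / 2 \<le> real r \<and> r \<le> d - 2"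
    using lines[OF that] .
  show "\<exists>f. maximal_tjurina_curve d r f"
    if "3 \<le> d \<and> d \<le> 11 \<and> real d / 2 \<le> real r \<and> r \<le> d - 1"
  proof (cases "r = d - 1")
    case True
    then show ?thesis using maximal_tjurina_cheb_curve that by blast
  next
    case False
    then have "r \<le> d - 2" using that by linarith
    then show ?thesis using lines that by blast
  qed
qed

end
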